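(* Let $n \geq 2$, let $\Omega \subset \mathbb{R}^n$ be a bounded domain of class $\mathcal{C}^2$ with $0 \in \Omega$, let $f : [0,\infty) \to \mathbb{R}$ be locally Lipschitz continuous, and let $\alpha < 0$ be a constant. Let $u \in C^2(\overline{\Omega} \setminus \{0\})$ be a solution to $$\begin{cases} -\Delta u = f(u) & \text{in } \Omega \setminus \{0\}, \\ u > 0 & \text{in } \Omega \setminus \{0\}, \\ u = 0 & \text{on } \partial\Omega, \\ \partial_\nu u = \alpha & \text{on } \partial\Omega, \end{cases}$$ where $\nu$ is the outward unit normal on $\partial\Omega$, and assume that $u$ has a non-removable singularity at $0$. Then $\Omega$ is a ball centered at the origin, and $u$ is radially symmetric (about the origin) and decreasing (as a function of $|x|$).
   Context: A domain is a connected open set. The solution $u$ is said to have a non-removable singularity at $0$ if $u$ does not admit a smooth extension all over $\Omega$; namely, it is not possible to find $\tilde u \in H^1(\Omega)$ such that $u \equiv \tilde u$ in $\Omega$ (that is, $u = \tilde u$ a.e. in $\Omega$, $u$ being defined on $\Omega \setminus \{0\}$). *)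

theory Defs
  imports "HOL-Analysis.Analysis"
begin

text \<open>
  \<open>Ck_upto k U S f\<close> means that \<open>f\<close> is of class \<open>C^k\<close> on the open set \<open>U\<close> and that \<open>f\<close>
  and its derivatives of order at most \<open>k\<close> extend continuously to \<open>S\<close>, where
  \<open>U \<subseteq> S \<subseteq> closure U\<close>; on \<open>S - U\<close> the function \<open>f\<close> itself must agree with its extension.
  For \<open>S = U\<close> this is the usual \<open>C^k(U)\<close>.
\<close>
primrec Ck_upto :: "nat \<Rightarrow> 'a::euclidean_space set \<Rightarrow> 'a set \<Rightarrow> ('a \<Rightarrow> real) \<Rightarrow> bool" where
  "Ck_upto 0 U S f \<longleftrightarrow> continuous_on S f"
| "Ck_upto (Suc k) U S f \<longleftrightarrow> continuous_on S f \<and>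
     (\<exists>g. (\<forall>x\<in>U. GDERIV f x :> g x) \<and> (\<forall>i\<in>Basis. Ck_upto k U S (\<lambda>x. g x \<bullet> i)))"

definition partial_deriv :: "'a::euclidean_space \<Rightarrow> ('a \<Rightarrow> real) \<Rightarrow> 'a \<Rightarrow> real" where
  "partial_deriv i f x = deriv (\<lambda>t. f (x + t *\<^sub>R i)) 0"

definition laplacian :: "('a::euclidean_space \<Rightarrow> real) \<Rightarrow> 'a \<Rightarrow> real" where
  "laplacian f x = (\<Sum>i\<in>Basis. partial_deriv i (partial_deriv i f) x)"

text \<open>
  Near each boundary point, \<open>\<Omega>\<close> is the epigraph of a \<open>C^2\<close> function over a hyperplane.
  The unit vector \<open>e\<close> is the vertical direction, \<open>x - (x \<bullet> e) *\<^sub>R e\<close> is the horizontal part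
  of \<open>x\<close>, and only the values of \<open>\<gamma>\<close> on the hyperplane orthogonal to \<open>e\<close> are used.
\<close>
definition C2_boundary :: "'a::euclidean_space set \<Rightarrow> bool" where
  "C2_boundary \<Omega> \<longleftrightarrow> (\<forall>x\<^sub>0\<in>frontier \<Omega>. \<exists>r>0. \<exists>e \<gamma>. norm e = 1 \<and> Ck_upto 2 UNIV UNIV \<gamma> \<and>
     \<Omega> \<inter> ball x\<^sub>0 r = {x \<in> ball x\<^sub>0 r. \<gamma> (x - (x \<bullet> e) *\<^sub>R e) < x \<bullet> e})"

definition tangent_vector :: "'a::euclidean_space set \<Rightarrow> 'a \<Rightarrow> 'a \<Rightarrow> bool" where
  "tangent_vector M x v \<longleftrightarrow> (\<exists>c. c 0 = x \<and> (\<forall>\<^sub>F t in at (0::real). c t \<in> M) \<and>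
     (c has_vector_derivative v) (at 0))"

definition outward_unit_normal :: "'a::euclidean_space set \<Rightarrow> 'a \<Rightarrow> 'a \<Rightarrow> bool" where
  "outward_unit_normal \<Omega> x \<nu> \<longleftrightarrow> norm \<nu> = 1 \<and>
     (\<forall>v. tangent_vector (frontier \<Omega>) x v \<longrightarrow> \<nu> \<bullet> v = 0) \<and>
     (\<forall>\<^sub>F t in at_right (0::real). x - t *\<^sub>R \<nu> \<in> \<Omega> \<and> x + t *\<^sub>R \<nu> \<notin> closure \<Omega>)"

text \<open>
  One-sided derivative in direction \<open>\<nu>\<close>, taken from inside the domain since \<open>\<nu>\<close> points outward.
\<close>
definition has_normal_derivative :: "('a::euclidean_space \<Rightarrow> real) \<Rightarrow> 'a \<Rightarrow> 'a \<Rightarrow> real \<Rightarrow> bool" where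
  "has_normal_derivative u x \<nu> a \<longleftrightarrow>
     ((\<lambda>t. u (x + t *\<^sub>R \<nu>)) has_real_derivative a) (at_left 0)"

definition square_integrable_on :: "'a::euclidean_space set \<Rightarrow> ('a \<Rightarrow> real) \<Rightarrow> bool" where
  "square_integrable_on \<Omega> v \<longleftrightarrow> v \<in> borel_measurable (lebesgue_on \<Omega>) \<and>
     integrable (lebesgue_on \<Omega>) (\<lambda>x. (v x)\<^sup>2)"

definition test_function :: "'a::euclidean_space set \<Rightarrow> ('a \<Rightarrow> real) \<Rightarrow> bool" where
  "test_function \<Omega> \<phi> \<longleftrightarrow> (\<forall>k. Ck_upto k UNIV UNIV \<phi>) \<and>
     compact (closure {x. \<phi> x \<noteq> 0}) \<and> closure {x. \<phi> x \<noteq> 0} \<subseteq> \<Omega>"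

definition weak_partial_deriv ::
  "'a::euclidean_space set \<Rightarrow> 'a \<Rightarrow> ('a \<Rightarrow> real) \<Rightarrow> ('a \<Rightarrow> real) \<Rightarrow> bool" where
  "weak_partial_deriv \<Omega> i v w \<longleftrightarrow> (\<forall>\<phi>. test_function \<Omega> \<phi> \<longrightarrow>
     (LINT x|lebesgue_on \<Omega>. v x * partial_deriv i \<phi> x) = - (LINT x|lebesgue_on \<Omega>. w x * \<phi> x))"

definition in_H1 :: "'a::euclidean_space set \<Rightarrow> ('a \<Rightarrow> real) \<Rightarrow> bool" where
  "in_H1 \<Omega> v \<longleftrightarrow> square_integrable_on \<Omega> v \<and>
     (\<forall>i\<in>Basis. \<exists>w. square_integrable_on \<Omega> w \<and> weak_partial_deriv \<Omega> i v w)"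

text \<open>
  The function \<open>u\<close> is only meaningful off the singular point; its value there is
  immaterial because a point is a null set.
\<close>
definition removable_singularity :: "'a::euclidean_space set \<Rightarrow> ('a \<Rightarrow> real) \<Rightarrow> bool" where
  "removable_singularity \<Omega> u \<longleftrightarrow> (\<exists>v. in_H1 \<Omega> v \<and> (AE x in lebesgue_on \<Omega>. u x = v x))"

definition locally_lipschitz_on :: "real set \<Rightarrow> (real \<Rightarrow> real) \<Rightarrow> bool" where
  "locally_lipschitz_on X f \<longleftrightarrow> (\<forall>x\<in>X. \<exists>d>0. \<exists>L. L-lipschitz_on (cball x d \<inter> X) f)"

end

theory Submission
  imports Defs
begin

text \<open>
  The proof is the moving plane method. Extend \<open>u\<close> by zero and, for a unit vector \<open>e\<close>, reflect it in the
  planes \<open>x \<bullet> e = t\<close>, moving \<open>t\<close> down from infinity. While \<open>t > 0\<close> the cap \<open>x \<bullet> e > t\<close> avoids the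
  singularity, so \<open>u\<close> is bounded there and a maximum principle ignoring the reflected singular point
  applies. The plane cannot stop at some \<open>t > 0\<close>: equality of \<open>u\<close> and its reflection would remove
  the singularity, an interior tangency is excluded by Hopf's lemma, and orthogonality of the plane to the
  boundary by Serrin's corner lemma, since the reflected difference vanishes to second order there.
  Reaching \<open>t = 0\<close> in all directions gives symmetry about every hyperplane through the origin, and
  strictness of the inequality for \<open>t > 0\<close> gives monotonicity.
\<close>

section \<open>Pointwise Laplacians and reflections\<close>

text \<open>Nothing is known about \<open>u\<close> at the origin: no growth rate, not even a limit.
  So the reflected function is uncontrolled at the mirror image \<open>q\<close> of
  \<open>0\<close>; near \<open>q\<close> the argument may use only that it is positive, while
  \<open>u\<close> itself is bounded there as long as \<open>t > 0\<close>. The linear coefficient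
  coming from \<open>f\<close> has no sign. It is harmless because the reflected difference
  \<open>w\<close> is nonnegative in the cap, so that its Laplacian is at most \<open>L * w\<close>,
  and the Hopf-type barriers are built with Laplacian above \<open>L\<close> times themselves.
  Pushing the plane below \<open>t\<close> uses compactness rather than a maximum principle for thin
  domains. Violations for planes tending to \<open>t\<close> accumulate at a point of the closed
  cap: off the plane this contradicts strict positivity, on the plane a strictly negative derivative
  of \<open>u\<close> along \<open>e\<close>, and accumulation at \<open>q\<close> is excluded by
  the singular maximum principle. Frontier points on the plane are where the corner lemma is needed.
  The Neumann datum gives the gradient constant length on the frontier, which both the Hopf
  comparison and the corner expansion use.\<close>

lemma gderiv_line:
  fixes W :: "'a::real_inner \<Rightarrow> real"
  assumes "GDERIV W (x + t *\<^sub>R v) :> D"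
  shows "((\<lambda>t. W (x + t *\<^sub>R v)) has_real_derivative D \<bullet> v) (at t)"
proof -
  have 1: "((\<lambda>t. x + t *\<^sub>R v) has_derivative (\<lambda>h. h *\<^sub>R v)) (at t)"
    by (auto intro!: derivative_eq_intros)
  have "((\<lambda>t. W (x + t *\<^sub>R v)) has_derivative (\<lambda>h. (h *\<^sub>R v) \<bullet> D)) (at t)"
    by (rule has_derivative_compose[OF 1]) (use assms in \<open>simp add: gderiv_def\<close>)
  moreover have "(\<lambda>h. (h *\<^sub>R v) \<bullet> D) = (*) (D \<bullet> v)"
    by (auto simp: inner_commute)
  ultimately show ?thesis
    by (simp add: has_field_derivative_def)
qed

text \<open>Differentiability is asked only inside the open segment, so that an endpoint may be a
  frontier point.\<close>

lemma gderiv_mvt: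
  fixes W :: "'a::real_inner \<Rightarrow> real"
  assumes "continuous_on {0..1} (\<lambda>s. W (x + s *\<^sub>R d))"
    and "\<And>s. 0 < s \<Longrightarrow> s < 1 \<Longrightarrow> GDERIV W (x + s *\<^sub>R d) :> g (x + s *\<^sub>R d)"
  obtains s where "0 < s" "s < 1" "W (x + d) - W x = g (x + s *\<^sub>R d) \<bullet> d"
proof -
  have "\<exists>s::real>0. s < 1 \<and> W (x + 1 *\<^sub>R d) - W (x + 0 *\<^sub>R d) = (1 - 0) * (g (x + s *\<^sub>R d) \<bullet> d)"
  proof -
    obtain l z where z: "0 < z" "z < 1" "((\<lambda>s. W (x + s *\<^sub>R d)) has_real_derivative l) (at z)"
      "W (x + 1 *\<^sub>R d) - W (x + 0 *\<^sub>R d) = (1 - 0) * l"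
      using MVT[of 0 1 "\<lambda>s. W (x + s *\<^sub>R d)"] assms gderiv_line real_differentiable_def
      by (metis zero_less_one)
    moreover have "l = g (x + z *\<^sub>R d) \<bullet> d"
      using z DERIV_unique assms(2) gderiv_line by blast
    ultimately show ?thesis by auto
  qed
  then show ?thesis using that by auto
qed

lemma gderiv_imp_isCont: "GDERIV W x :> D \<Longrightarrow> isCont W x"
  unfolding gderiv_def by (rule has_derivative_continuous)

text \<open>The trace of the derivative of the gradient. As a relation it avoids
  \<open>deriv\<close> and lets differences and reflections be formed without regularity side
  conditions; the gradient must exist near \<open>p\<close>, the Hessian only at
  \<open>p\<close>.\<close>

definition lap_at :: "('a::euclidean_space \<Rightarrow> real) \<Rightarrow> 'a \<Rightarrow> real \<Rightarrow> bool" where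
  "lap_at W p l \<longleftrightarrow> (\<exists>G H. (\<forall>\<^sub>F y in nhds p. GDERIV W y :> G y) \<and>
     (G has_derivative H) (at p) \<and> l = (\<Sum>i\<in>Basis. H i \<bullet> i))"

lemma lap_at_diff:
  assumes "lap_at W p l" "lap_at V p k"
  shows "lap_at (\<lambda>y. W y - V y) p (l - k)"
proof -
  obtain G H where 1: "\<forall>\<^sub>F y in nhds p. GDERIV W y :> G y" "(G has_derivative H) (at p)"
    "l = (\<Sum>i\<in>Basis. H i \<bullet> i)"
    using assms(1) unfolding lap_at_def by blast
  obtain G' H' where 2: "\<forall>\<^sub>F y in nhds p. GDERIV V y :> G' y" "(G' has_derivative H') (at p)"
    "k = (\<Sum>i\<in>Basis. H' i \<bullet> i)"
    using assms(2) unfolding lap_at_def by blast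
  have "\<forall>\<^sub>F y in nhds p. GDERIV (\<lambda>y. W y - V y) y :> G y - G' y"
    using 1(1) 2(1) by eventually_elim (rule GDERIV_diff)
  moreover have "((\<lambda>y. G y - G' y) has_derivative (\<lambda>h. H h - H' h)) (at p)"
    using 1 2 by (intro derivative_intros)
  moreover have "l - k = (\<Sum>i\<in>Basis. (H i - H' i) \<bullet> i)"
    using 1 2 by (simp add: inner_diff_left sum_subtractf)
  ultimately show ?thesis
    unfolding lap_at_def by (intro exI[of _ "\<lambda>y. G y - G' y"] exI[of _ "\<lambda>h. H h - H' h"]) auto
qed

lemma lap_at_cmult:
  assumes "lap_at W p l"
  shows "lap_at (\<lambda>y. c * W y) p (c * l)"
proof -
  obtain G H where 1: "\<forall>\<^sub>F y in nhds p. GDERIV W y :> G y" "(G has_derivative H) (at p)"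
    "l = (\<Sum>i\<in>Basis. H i \<bullet> i)"
    using assms(1) unfolding lap_at_def by blast
  have "\<forall>\<^sub>F y in nhds p. GDERIV (\<lambda>y. c * W y) y :> c *\<^sub>R G y"
    using 1(1)
    by eventually_elim (auto simp: gderiv_def intro!: derivative_eq_intros)
  moreover have "((\<lambda>y. c *\<^sub>R G y) has_derivative (\<lambda>h. c *\<^sub>R H h)) (at p)"
    using 1 by (auto intro!: derivative_eq_intros)
  moreover have "c * l = (\<Sum>i\<in>Basis. (c *\<^sub>R H i) \<bullet> i)"
    using 1 by (simp add: sum_distrib_left)
  ultimately show ?thesis
    unfolding lap_at_def by (intro exI[of _ "\<lambda>y. c *\<^sub>R G y"] exI[of _ "\<lambda>h. c *\<^sub>R H h"]) auto
qed

text \<open>A negative second derivative along a basis vector would make the first derivative, which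
  vanishes at \<open>p\<close>, negative just after \<open>p\<close>, and the mean value theorem
  would give a value below the minimum.\<close>

lemma lap_at_local_min:
  assumes l: "lap_at W p l" and min: "\<forall>\<^sub>F y in nhds p. W p \<le> W y"
  shows "0 \<le> l"
proof -
  obtain G H where 1: "\<forall>\<^sub>F y in nhds p. GDERIV W y :> G y" "(G has_derivative H) (at p)"
    "l = (\<Sum>i\<in>Basis. H i \<bullet> i)"
    using assms(1) unfolding lap_at_def by blast
  obtain r where r: "r > 0" "\<And>y. dist y p < r \<Longrightarrow> GDERIV W y :> G y \<and> W p \<le> W y"
    using eventually_conj[OF 1(1) min] unfolding eventually_nhds_metric by blast
  have "0 \<le> H i \<bullet> i" if i: "i \<in> Basis" for i
  proof (rule ccontr)
    assume neg: "\<not> 0 \<le> H i \<bullet> i"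
    have d: "((\<lambda>t. W (p + t *\<^sub>R i)) has_real_derivative G (p + t *\<^sub>R i) \<bullet> i) (at t)" if "\<bar>t\<bar> < r" for t
      by (rule gderiv_line) (use r that i in \<open>auto simp: dist_norm\<close>)
    have "G (p + 0 *\<^sub>R i) \<bullet> i = 0"
      by (rule DERIV_local_min[OF d[of 0], of r]) (use r i in \<open>auto simp: dist_norm\<close>)
    moreover have "((\<lambda>t. G (p + t *\<^sub>R i) \<bullet> i) has_real_derivative H i \<bullet> i) (at 0)"
    proof -
      have b: "bounded_linear H" using 1(2) by (rule has_derivative_bounded_linear)
      have "((\<lambda>t. p + t *\<^sub>R i) has_derivative (\<lambda>h. h *\<^sub>R i)) (at 0)"
        by (auto intro!: derivative_eq_intros)
      then have "((\<lambda>t. G (p + t *\<^sub>R i)) has_derivative (\<lambda>h. H (h *\<^sub>R i))) (at 0)"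
        by (rule has_derivative_compose) (use 1 in simp)
      then have "((\<lambda>t. G (p + t *\<^sub>R i) \<bullet> i) has_derivative (\<lambda>h. H (h *\<^sub>R i) \<bullet> i)) (at 0)"
        by (rule has_derivative_inner_left)
      moreover have "(\<lambda>h. H (h *\<^sub>R i) \<bullet> i) = (*) (H i \<bullet> i)"
        using b by (auto simp: linear_simps mult.commute)
      ultimately show ?thesis by (simp add: has_field_derivative_def)
    qed
    ultimately obtain d0 where d0: "d0 > 0" "\<And>h. 0 < h \<Longrightarrow> h < d0 \<Longrightarrow> G (p + h *\<^sub>R i) \<bullet> i < 0"
      using DERIV_neg_dec_right[of "\<lambda>t. G (p + t *\<^sub>R i) \<bullet> i" "H i \<bullet> i" 0] neg by auto
    define h where "h = min d0 r / 2"
    have h: "0 < h" "h < d0" "h < r" using d0 r unfolding h_def by auto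
    obtain z where z: "0 < z" "z < h"
      "W (p + h *\<^sub>R i) - W (p + 0 *\<^sub>R i) = (h - 0) * (G (p + z *\<^sub>R i) \<bullet> i)"
      using MVT2[of 0 h "\<lambda>t. W (p + t *\<^sub>R i)" "\<lambda>t. G (p + t *\<^sub>R i) \<bullet> i"] d h by auto
    moreover have "(h - 0) * (G (p + z *\<^sub>R i) \<bullet> i) < 0"
      using d0(2)[of z] z h by (simp add: mult_pos_neg)
    moreover have "W p \<le> W (p + h *\<^sub>R i)" using r(2)[of "p + h *\<^sub>R i"] h i by (auto simp: dist_norm)
    ultimately show False by simp
  qed
  then show ?thesis using 1(3) by (simp add: sum_nonneg)
qed

lemma gderiv_inner_self:
  "GDERIV (\<lambda>y::'a::real_inner. (y - c) \<bullet> (y - c)) y :> 2 *\<^sub>R (y - c)"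
  unfolding gderiv_def
  by (auto intro!: derivative_eq_intros simp: inner_commute algebra_simps)

text \<open>Profiles are functions of the squared distance \<open>q\<close>, which is a polynomial
  in \<open>y\<close>. In terms of the radius the value is the usual second radial derivative plus
  \<open>(n - 1) / radius\<close> times the first.\<close>

lemma lap_at_radial:
  fixes c p :: "'a::euclidean_space" and F F' :: "real \<Rightarrow> real"
  assumes D1: "\<forall>\<^sub>F q in nhds ((p - c) \<bullet> (p - c)). (F has_real_derivative F' q) (at q)"
    and D2: "(F' has_real_derivative f2) (at ((p - c) \<bullet> (p - c)))"
  shows "lap_at (\<lambda>y. F ((y - c) \<bullet> (y - c))) p
           (4 * ((p - c) \<bullet> (p - c)) * f2 + 2 * real DIM('a) * F' ((p - c) \<bullet> (p - c)))"
proof -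
  define Q where "Q = (\<lambda>y. (y - c) \<bullet> (y - c))"
  have "(Q \<longlongrightarrow> Q p) (nhds p)"
    unfolding Q_def by (intro tendsto_intros filterlim_ident)
  then have "\<forall>\<^sub>F y in nhds p. (F has_real_derivative F' (Q y)) (at (Q y))"
    using D1 unfolding filterlim_iff Q_def by blast
  then have a: "\<forall>\<^sub>F y in nhds p. GDERIV (\<lambda>y. F (Q y)) y :> F' (Q y) *\<^sub>R (2 *\<^sub>R (y - c))"
    by eventually_elim (rule GDERIV_DERIV_compose, simp_all add: Q_def gderiv_inner_self)
  have q: "((\<lambda>y. F' (Q y)) has_derivative (\<lambda>h. h \<bullet> (f2 *\<^sub>R (2 *\<^sub>R (p - c))))) (at p)"
    using GDERIV_DERIV_compose[OF gderiv_inner_self[of c p] D2] unfolding gderiv_def Q_def .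
  have b: "((\<lambda>y. F' (Q y) *\<^sub>R (2 *\<^sub>R (y - c))) has_derivative
     (\<lambda>h. F' (Q p) *\<^sub>R (2 *\<^sub>R h) + (h \<bullet> (f2 *\<^sub>R (2 *\<^sub>R (p - c)))) *\<^sub>R (2 *\<^sub>R (p - c)))) (at p)"
    by (auto intro!: derivative_eq_intros q)
  have s: "(\<Sum>i\<in>Basis. (i \<bullet> (p - c)) * ((p - c) \<bullet> i)) = Q p"
    unfolding Q_def by (subst euclidean_inner) (simp add: inner_commute)
  have "(\<Sum>i\<in>Basis. (F' (Q p) *\<^sub>R (2 *\<^sub>R i) + (i \<bullet> (f2 *\<^sub>R (2 *\<^sub>R (p - c)))) *\<^sub>R (2 *\<^sub>R (p - c))) \<bullet> i)
     = (\<Sum>i\<in>Basis. 2 * F' (Q p) * (i \<bullet> (i::'a)) + 4 * f2 * ((i \<bullet> (p - c)) * ((p - c) \<bullet> i)))"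
    by (rule sum.cong) (simp_all add: inner_add_left)
  also have "\<dots> = 2 * F' (Q p) * DIM('a) + 4 * f2 * Q p"
    by (simp add: sum.distrib sum_distrib_left[symmetric] s inner_Basis)
  finally show ?thesis
    unfolding lap_at_def using a b
    by (intro exI[of _ "\<lambda>y. F' (Q y) *\<^sub>R (2 *\<^sub>R (y - c))"] exI conjI) (auto simp: Q_def mult_ac)
qed

text \<open>The product rule: twice the inner product of \<open>e\<close> with the gradient of the
  radial factor contributes the additional 4 in the coefficient of \<open>F'\<close>.\<close>

lemma lap_at_linear_times_radial:
  fixes c p e :: "'a::euclidean_space" and F F' :: "real \<Rightarrow> real"
  assumes D1: "\<forall>\<^sub>F q in nhds ((p - c) \<bullet> (p - c)). (F has_real_derivative F' q) (at q)"
    and D2: "(F' has_real_derivative f2) (at ((p - c) \<bullet> (p - c)))"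
  shows "lap_at (\<lambda>y. ((y - c) \<bullet> e) * F ((y - c) \<bullet> (y - c))) p
           (((p - c) \<bullet> e) * (4 * ((p - c) \<bullet> (p - c)) * f2 + (2 * real DIM('a) + 4) * F' ((p - c) \<bullet> (p - c))))"
proof -
  define Q where "Q = (\<lambda>y. (y - c) \<bullet> (y - c))"
  have "(Q \<longlongrightarrow> Q p) (nhds p)"
    unfolding Q_def by (intro tendsto_intros filterlim_ident)
  then have "\<forall>\<^sub>F y in nhds p. (F has_real_derivative F' (Q y)) (at (Q y))"
    using D1 unfolding filterlim_iff Q_def by blast
  then have a: "\<forall>\<^sub>F y in nhds p. GDERIV (\<lambda>y. ((y - c) \<bullet> e) * F (Q y)) y :>
       ((y - c) \<bullet> e) *\<^sub>R (F' (Q y) *\<^sub>R (2 *\<^sub>R (y - c))) + F (Q y) *\<^sub>R e"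
  proof eventually_elim
    case (elim y)
    have "GDERIV (\<lambda>y. F (Q y)) y :> F' (Q y) *\<^sub>R (2 *\<^sub>R (y - c))"
      by (rule GDERIV_DERIV_compose) (use elim in \<open>simp_all add: Q_def gderiv_inner_self\<close>)
    moreover have "GDERIV (\<lambda>y. (y - c) \<bullet> e) y :> e"
      unfolding gderiv_def by (auto intro!: derivative_eq_intros)
    ultimately show ?case by (intro GDERIV_mult)
  qed
  have q: "((\<lambda>y. F' (Q y)) has_derivative (\<lambda>h. h \<bullet> (f2 *\<^sub>R (2 *\<^sub>R (p - c))))) (at p)"
    using GDERIV_DERIV_compose[OF gderiv_inner_self[of c p] D2] unfolding gderiv_def Q_def .
  have "(F has_real_derivative F' (Q p)) (at (Q p))"
    using D1 unfolding Q_def by (rule eventually_nhds_x_imp_x)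
  then have q0: "((\<lambda>y. F (Q y)) has_derivative (\<lambda>h. h \<bullet> (F' (Q p) *\<^sub>R (2 *\<^sub>R (p - c))))) (at p)"
    using GDERIV_DERIV_compose[OF gderiv_inner_self[of c p]] unfolding gderiv_def Q_def by blast
  have b: "((\<lambda>y. ((y - c) \<bullet> e) *\<^sub>R (F' (Q y) *\<^sub>R (2 *\<^sub>R (y - c))) + F (Q y) *\<^sub>R e) has_derivative
     (\<lambda>h. (h \<bullet> e) *\<^sub>R (F' (Q p) *\<^sub>R (2 *\<^sub>R (p - c))) +
       ((p - c) \<bullet> e) *\<^sub>R (F' (Q p) *\<^sub>R (2 *\<^sub>R h) + (h \<bullet> (f2 *\<^sub>R (2 *\<^sub>R (p - c)))) *\<^sub>R (2 *\<^sub>R (p - c)))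
       + (h \<bullet> (F' (Q p) *\<^sub>R (2 *\<^sub>R (p - c)))) *\<^sub>R e)) (at p)"
    by (auto intro!: derivative_eq_intros q q0 simp: fun_eq_iff scaleR_add_left scaleR_add_right algebra_simps)
  \<comment> \<open>The three sums are Parseval identities, which evaluate the traces of the
    rank-one terms.\<close>
  have s: "(\<Sum>i\<in>Basis. (i \<bullet> (p - c)) * ((p - c) \<bullet> i)) = Q p"
    unfolding Q_def by (subst euclidean_inner) (simp add: inner_commute)
  have s2: "(\<Sum>i\<in>Basis. (i \<bullet> e) * ((p - c) \<bullet> i)) = (p - c) \<bullet> e"
    by (subst euclidean_inner) (simp add: inner_commute mult.commute)
  have s3: "(\<Sum>i\<in>Basis. (i \<bullet> (p - c)) * (e \<bullet> i)) = (p - c) \<bullet> e"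
    by (subst euclidean_inner) (simp add: inner_commute mult.commute)
  have summand: "((i \<bullet> e) *\<^sub>R (k *\<^sub>R (2 *\<^sub>R d)) +
       (d \<bullet> e) *\<^sub>R (k *\<^sub>R (2 *\<^sub>R i) + (i \<bullet> (f2 *\<^sub>R (2 *\<^sub>R d))) *\<^sub>R (2 *\<^sub>R d))
       + (i \<bullet> (k *\<^sub>R (2 *\<^sub>R d))) *\<^sub>R e) \<bullet> i
     = 2 * k * ((i \<bullet> e) * (d \<bullet> i)) + (d \<bullet> e) * (2 * k) * (i \<bullet> i) +
       (d \<bullet> e) * (4 * f2) * ((i \<bullet> d) * (d \<bullet> i)) + 2 * k * ((i \<bullet> d) * (e \<bullet> i))"
    for i d :: 'a and k :: real
    by (simp add: inner_add_left algebra_simps)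
  have "(\<Sum>i\<in>Basis. ((i \<bullet> e) *\<^sub>R (F' (Q p) *\<^sub>R (2 *\<^sub>R (p - c))) +
       ((p - c) \<bullet> e) *\<^sub>R (F' (Q p) *\<^sub>R (2 *\<^sub>R i) + (i \<bullet> (f2 *\<^sub>R (2 *\<^sub>R (p - c)))) *\<^sub>R (2 *\<^sub>R (p - c)))
       + (i \<bullet> (F' (Q p) *\<^sub>R (2 *\<^sub>R (p - c)))) *\<^sub>R e) \<bullet> i)
     = (\<Sum>i\<in>Basis. 2 * F' (Q p) * ((i \<bullet> e) * ((p - c) \<bullet> i)) +
          ((p - c) \<bullet> e) * (2 * F' (Q p)) * (i \<bullet> (i::'a)) + 
          ((p - c) \<bullet> e) * (4 * f2) * ((i \<bullet> (p - c)) * ((p - c) \<bullet> i)) + 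
          2 * F' (Q p) * ((i \<bullet> (p - c)) * (e \<bullet> i)))"
    by (rule sum.cong) (simp_all only: summand)
  also have "\<dots> = 2 * F' (Q p) * ((p - c) \<bullet> e) + ((p - c) \<bullet> e) * (2 * F' (Q p)) * DIM('a)
     + ((p - c) \<bullet> e) * (4 * f2) * Q p + 2 * F' (Q p) * ((p - c) \<bullet> e)"
    unfolding sum.distrib sum_distrib_left[symmetric] s s2 s3 by (simp add: inner_Basis)
  also have "\<dots> = ((p - c) \<bullet> e) * (4 * Q p * f2 + (2 * real DIM('a) + 4) * F' (Q p))"
    by (simp add: algebra_simps)
  finally show ?thesis
    unfolding lap_at_def using a b
    by (intro exI[of _ "\<lambda>y. ((y - c) \<bullet> e) *\<^sub>R (F' (Q y) *\<^sub>R (2 *\<^sub>R (y - c))) + F (Q y) *\<^sub>R e"] exI conjI) 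
      (auto simp: Q_def)
qed

section \<open>Reflections in hyperplanes and their action on gradients and Laplacians\<close>

definition reflect :: "'a::real_inner \<Rightarrow> real \<Rightarrow> 'a \<Rightarrow> 'a" where
  "reflect e t x = x - (2 * (x \<bullet> e - t)) *\<^sub>R e"

lemma reflect_inner: "norm e = 1 \<Longrightarrow> reflect e t x \<bullet> e = 2 * t - x \<bullet> e"
  by (simp add: reflect_def inner_diff_left power2_norm_eq_inner[symmetric] flip: power2_norm_eq_inner dot_square_norm)

lemma reflect_reflect [simp]: "norm e = 1 \<Longrightarrow> reflect e t (reflect e t x) = x"
  by (simp add: reflect_def[of e t "reflect e t x"] reflect_inner) (simp add: reflect_def algebra_simps)

lemma reflect_fixed: "x \<bullet> e = t \<Longrightarrow> reflect e t x = x"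
  by (simp add: reflect_def)

lemma reflect_diff: "reflect e t x - reflect e t y = reflect e 0 (x - y)"
  by (simp add: reflect_def inner_diff_left algebra_simps)

lemma reflect0_adjoint: "reflect e 0 x \<bullet> y = x \<bullet> reflect e 0 y"
  by (simp add: reflect_def inner_diff_left inner_diff_right inner_commute algebra_simps)

lemma reflect0_inner: "norm e = 1 \<Longrightarrow> reflect e 0 x \<bullet> reflect e 0 y = x \<bullet> y"
  by (simp add: reflect0_adjoint)

lemma norm_reflect0 [simp]: "norm e = 1 \<Longrightarrow> norm (reflect e 0 x) = norm x"
  by (simp add: norm_eq_sqrt_inner reflect0_inner)

lemma dist_reflect [simp]: "norm e = 1 \<Longrightarrow> dist (reflect e t x) (reflect e t y) = dist x y"
  by (simp add: dist_norm reflect_diff)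

lemma reflect0_linear: "bounded_linear (reflect e 0)"
  unfolding reflect_def by (auto intro!: bounded_linear_intros)

lemma reflect_has_derivative: "(reflect e t has_derivative reflect e 0) (at x within S)"
  unfolding reflect_def by (auto intro!: derivative_eq_intros)

lemma continuous_on_reflect [continuous_intros]:
  "continuous_on S f \<Longrightarrow> continuous_on S (\<lambda>x. reflect e t (f x))"
  unfolding reflect_def by (intro continuous_intros)

lemma tendsto_reflect [tendsto_intros]:
  "(f \<longlongrightarrow> a) F \<Longrightarrow> (s \<longlongrightarrow> t) F \<Longrightarrow> ((\<lambda>x. reflect e (s x) (f x)) \<longlongrightarrow> reflect e t a) F"
  unfolding reflect_def by (intro tendsto_intros)

text \<open>The linear part of the reflection is \<open>reflect e 0\<close> for every
  \<open>t\<close>; being self-adjoint, it moves over to the gradient.\<close>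

lemma gderiv_reflect:
  assumes "GDERIV W (reflect e t y) :> D"
  shows "GDERIV (\<lambda>y. W (reflect e t y)) y :> reflect e 0 D"
proof -
  have "((\<lambda>y. W (reflect e t y)) has_derivative (\<lambda>h. (reflect e 0 h) \<bullet> D)) (at y)"
    by (rule has_derivative_compose[OF reflect_has_derivative]) (use assms in \<open>simp add: gderiv_def\<close>)
  then show ?thesis by (simp add: gderiv_def reflect0_adjoint)
qed

text \<open>The Hessian is conjugated by the involution \<open>reflect e 0\<close>, which keeps the
  trace. In the expansion the three correction terms are multiples -2, -2 and 4 of
  \<open>H e \<bullet> e\<close> and cancel.\<close>

lemma lap_at_reflect:
  fixes W :: "'a::euclidean_space \<Rightarrow> real"
  assumes e: "norm e = 1" and "lap_at W (reflect e t p) l"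
  shows "lap_at (\<lambda>y. W (reflect e t y)) p l"
proof -
  obtain G H where 1: "\<forall>\<^sub>F y in nhds (reflect e t p). GDERIV W y :> G y" "(G has_derivative H) (at (reflect e t p))"
    "l = (\<Sum>i\<in>Basis. H i \<bullet> i)"
    using assms(2) unfolding lap_at_def by blast
  interpret H: bounded_linear H using 1(2) by (rule has_derivative_bounded_linear)
  have "((\<lambda>y. reflect e t y) \<longlongrightarrow> reflect e t p) (nhds p)"
    by (intro tendsto_intros filterlim_ident)
  then have "\<forall>\<^sub>F y in nhds p. GDERIV W (reflect e t y) :> G (reflect e t y)"
    using 1(1) by (auto simp: filterlim_iff)
  then have a: "\<forall>\<^sub>F y in nhds p. GDERIV (\<lambda>y. W (reflect e t y)) y :> reflect e 0 (G (reflect e t y))"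
    by eventually_elim (rule gderiv_reflect)
  have "((\<lambda>y. G (reflect e t y)) has_derivative (\<lambda>h. H (reflect e 0 h))) (at p)"
    by (rule has_derivative_compose[OF reflect_has_derivative 1(2)])
  then have b: "((\<lambda>y. reflect e 0 (G (reflect e t y))) has_derivative (\<lambda>h. reflect e 0 (H (reflect e 0 h)))) (at p)"
    by (rule bounded_linear.has_derivative[OF reflect0_linear])
  have lin: "H (reflect e 0 i) = H i - (2 * (i \<bullet> e)) *\<^sub>R H e" for i
    by (simp add: reflect_def H.diff H.scaleR)
  have s1: "(\<Sum>i\<in>Basis. (i \<bullet> e) * (H i \<bullet> e)) = H e \<bullet> e"
  proof -
    have "H e \<bullet> e = H (\<Sum>i\<in>Basis. (e \<bullet> i) *\<^sub>R i) \<bullet> e" by (simp add: euclidean_representation)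
    also have "\<dots> = (\<Sum>i\<in>Basis. (i \<bullet> e) * (H i \<bullet> e))"
      unfolding H.sum H.scaleR inner_sum_left by (simp add: inner_commute)
    finally show ?thesis ..
  qed
  have s2: "(\<Sum>i\<in>Basis. (i \<bullet> e) * (H e \<bullet> i)) = H e \<bullet> e"
    by (subst euclidean_inner) (simp add: inner_commute mult.commute)
  have s3: "(\<Sum>i\<in>Basis. (i \<bullet> e) * (i \<bullet> e)) = 1"
    using e by (metis (no_types, lifting) euclidean_inner inner_commute norm_eq_1 sum.cong)
  have "(\<Sum>i\<in>Basis. reflect e 0 (H (reflect e 0 i)) \<bullet> i) =
     (\<Sum>i\<in>Basis. H i \<bullet> i - 2 * ((i \<bullet> e) * (H e \<bullet> i)) - 2 * ((i \<bullet> e) * (H i \<bullet> e))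
        + 4 * (H e \<bullet> e) * ((i \<bullet> e) * (i \<bullet> e)))"
    by (rule sum.cong)
      (simp_all add: lin, simp add: reflect_def inner_diff_left inner_diff_right inner_commute algebra_simps)
  also have "\<dots> = l"
    by (simp add: sum.distrib sum_subtractf sum_distrib_left[symmetric] s1 s2 s3 1(3))
  finally show ?thesis
    unfolding lap_at_def using a b by metis
qed

text \<open>A negative minimum would be interior, where the Laplacian cannot be negative. The
  differential inequality is asked only where \<open>m\<close> is negative; there a zero-order term
  \<open>L * m\<close> with nonnegative \<open>L\<close> has the right sign.\<close>

lemma comparison_principle:
  fixes m :: "'a::euclidean_space \<Rightarrow> real"
  assumes "open D" "bounded D" and c: "continuous_on (closure D) m"
    and fr: "\<And>x. x \<in> frontier D \<Longrightarrow> 0 \<le> m x"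
    and lap: "\<And>x. x \<in> D \<Longrightarrow> m x < 0 \<Longrightarrow> \<exists>l<0. lap_at m x l"
    and x: "x \<in> D"
  shows "0 \<le> m x"
proof (rule ccontr)
  assume neg: "\<not> 0 \<le> m x"
  have "compact (closure D)" using assms(2) by simp
  moreover have "closure D \<noteq> {}" using x by auto
  ultimately obtain p where p: "p \<in> closure D" "\<And>y. y \<in> closure D \<Longrightarrow> m p \<le> m y"
    using continuous_attains_inf[OF _ _ c] by blast
  have mp: "m p < 0" using p(2)[of x] neg x closure_subset[of D] by auto
  then have pD: "p \<in> D"
    using fr[of p] p(1) \<open>open D\<close> by (auto simp: frontier_def interior_open)
  obtain l where l: "l < 0" "lap_at m p l" using lap[OF pD mp] by blast
  have "\<forall>\<^sub>F y in nhds p. m p \<le> m y"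
    using eventually_nhds_in_open[OF \<open>open D\<close> pD] by eventually_elim (use p closure_subset in blast)
  with l show False using lap_at_local_min by fastforce
qed

section \<open>Maximum principles\<close>

lemma lap_at_gderiv:
  assumes "lap_at W p l" obtains D where "GDERIV W p :> D"
  using assms unfolding lap_at_def by (meson eventually_nhds_x_imp_x)

lemma lap_at_imp_isCont: "lap_at W p l \<Longrightarrow> isCont W p"
  by (meson gderiv_imp_isCont lap_at_gderiv)

text \<open>Hopf's lemma in quantitative form: one slope serves the whole sphere, and users pick the
  touching point. The Gaussian \<open>exp (- a * r\<^sup>2) - exp (- a * R\<^sup>2)\<close> is
  compared with \<open>W\<close> on an annulus, where its Laplacian exceeds \<open>L\<close> times
  itself.\<close>

lemma hopf_barrier:
  fixes c :: "'a::euclidean_space"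
  assumes R: "0 < R" and L: "0 \<le> L"
    and W: "continuous_on (cball c R) W" "\<And>y. y \<in> ball c R \<Longrightarrow> 0 < W y"
    and lap: "\<And>y. y \<in> ball c R \<Longrightarrow> \<exists>l\<le>L * W y. lap_at W y l"
  obtains \<epsilon> where "0 < \<epsilon>"
    "\<And>y. R / 2 \<le> dist c y \<Longrightarrow> dist c y \<le> R \<Longrightarrow> \<epsilon> * (R - dist c y) \<le> W y"
proof -
  define n where "n = real DIM('a)"
  \<comment> \<open>Large enough that \<open>a * (4 * q) - 2 * n\<close> is at least
    \<open>L + 1\<close> on the annulus, where \<open>q\<close> is at least
    \<open>R\<^sup>2 / 4\<close>; the lower bound 1 allows dropping the other factor
    \<open>a\<close>.\<close>
  define a where "a = max 1 ((2 * n + L + 1) / R\<^sup>2)"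
  have a1: "1 \<le> a" by (simp add: a_def)
  have a2: "2 * n + L + 1 \<le> a * R\<^sup>2"
  proof -
    have "(2 * n + L + 1) / R\<^sup>2 \<le> a" by (simp add: a_def)
    then show ?thesis using R by (simp add: pos_divide_le_eq)
  qed
  define F where "F = (\<lambda>q. exp (- a * q) - exp (- a * R\<^sup>2))"
  define z where "z = (\<lambda>y. F ((y - c) \<bullet> (y - c)))"
  have z_dist: "z y = exp (- a * (dist c y)\<^sup>2) - exp (- a * R\<^sup>2)" for y
    by (simp add: z_def F_def dist_norm norm_minus_commute[of c] flip: power2_norm_eq_inner)
  have lapz: "\<exists>l>L * z p. lap_at z p l" if p: "R / 2 \<le> dist c p" for p
  proof -
    define q where "q = (p - c) \<bullet> (p - c)"
    have q: "q = (dist c p)\<^sup>2" by (simp add: q_def dist_norm norm_minus_commute[of c] flip: power2_norm_eq_inner)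
    have "R\<^sup>2 / 4 \<le> q"
      using power_mono[OF p, of 2] R by (simp add: q power_divide)
    define E where "E = exp (- a * q)"
    have E: "0 < E" by (simp add: E_def)
    have "lap_at z p (4 * q * (a * (a * E)) + 2 * n * (- a * E))"
      unfolding z_def q_def n_def E_def
    proof (rule lap_at_radial[where F' = "\<lambda>q. - a * exp (- a * q)"])
      show "\<forall>\<^sub>F q in nhds ((p - c) \<bullet> (p - c)). (F has_real_derivative - a * exp (- a * q)) (at q)"
        unfolding F_def by (auto intro!: always_eventually derivative_eq_intros)
      show "((\<lambda>q. - a * exp (- a * q)) has_real_derivative a * (a * exp (- a * ((p - c) \<bullet> (p - c))))) (at ((p - c) \<bullet> (p - c)))"
        by (auto intro!: derivative_eq_intros)
    qed
    moreover have "4 * q * (a * (a * E)) + 2 * n * (- a * E) = E * (a * (a * (4 * q) - 2 * n))"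
      by (simp add: algebra_simps)
    moreover have "L * z p < E * (a * (a * (4 * q) - 2 * n))"
    proof -
      have "a * R\<^sup>2 \<le> a * (4 * q)" using a1 \<open>R\<^sup>2 / 4 \<le> q\<close> by simp
      then have 1: "L + 1 \<le> a * (4 * q) - 2 * n" using a2 by linarith
      then have "1 * (L + 1) \<le> a * (a * (4 * q) - 2 * n)" using a1 L by (intro mult_mono) auto
      then have "E * (L + 1) \<le> E * (a * (a * (4 * q) - 2 * n))" using E by simp
      moreover have "L * z p \<le> L * E"
        using L by (intro mult_left_mono) (auto simp: z_def F_def E_def q_def)
      moreover have "L * E < E * (L + 1)" using E by (simp add: algebra_simps)
      ultimately show ?thesis by linarith
    qed
    ultimately show ?thesis by auto
  qed
  have Wge: "0 \<le> W y" if "y \<in> cball c R" for y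
    using continuous_ge_on_closure[of "ball c R" W y 0] W that R less_imp_le by (auto simp: closure_ball)
  have "compact (sphere c (R / 2))" "sphere c (R / 2) \<noteq> {}" "sphere c (R/2) \<subseteq> cball c R"
    using R by auto
  then obtain p0 where p0: "p0 \<in> sphere c (R / 2)" "\<And>y. y \<in> sphere c (R / 2) \<Longrightarrow> W p0 \<le> W y"
    using continuous_attains_inf[of "sphere c (R/2)" W] continuous_on_subset[OF W(1)] by blast
  \<comment> \<open>As \<open>z\<close> is at most 1, this minimum makes \<open>\<mu> * z\<close>
    lie below \<open>W\<close> on the inner sphere; on the outer sphere \<open>z\<close>
    vanishes.\<close>
  define \<mu> where "\<mu> = W p0"
  have mu: "0 < \<mu>" using W(2)[of p0] p0 R by (auto simp: \<mu>_def)
  have zle: "z y \<le> 1" for y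
  proof -
    have "exp (- a * (dist c y)\<^sup>2) \<le> 1" using a1 by simp
    then show ?thesis unfolding z_dist using exp_gt_zero[of "- a * R\<^sup>2"] by linarith
  qed
  define D where "D = ball c R - cball c (R / 2)"
  have oD: "open D" by (auto simp: D_def)
  have "D \<subseteq> {y. R / 2 \<le> dist c y \<and> dist c y \<le> R}" by (auto simp: D_def)
  moreover have "closed {y. R / 2 \<le> dist c y \<and> dist c y \<le> R}"
    by (intro closed_Collect_conj closed_Collect_le continuous_intros)
  ultimately have cD: "closure D \<subseteq> {y. R / 2 \<le> dist c y \<and> dist c y \<le> R}" by (rule closure_minimal)
  have sph: "\<mu> * z y \<le> W y" if "dist c y = R / 2 \<or> dist c y = R" for y
  proof (cases "dist c y = R / 2")
    case True
    then have "\<mu> \<le> W y" using p0 by (auto simp: \<mu>_def)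
    moreover have "\<mu> * z y \<le> \<mu> * 1" using mu zle by (intro mult_left_mono) auto
    ultimately show ?thesis by simp
  next
    case False
    then have "z y = 0" "0 \<le> W y" using that Wge by (auto simp: z_dist)
    then show ?thesis by simp
  qed
  have inD: "0 \<le> W y - \<mu> * z y" if y: "y \<in> D" for y
  proof (rule comparison_principle[OF oD _ _ _ _ y])
    show "bounded D" by (auto simp: D_def intro: bounded_subset[OF bounded_ball])
    have "closure D \<subseteq> cball c R" using cD by auto
    then show "continuous_on (closure D) (\<lambda>y. W y - \<mu> * z y)"
      unfolding z_def F_def by (intro continuous_intros continuous_on_subset[OF W(1)])
    show "0 \<le> W x - \<mu> * z x" if "x \<in> frontier D" for x
    proof -
      have "x \<in> closure D" "x \<notin> D" using that oD by (auto simp: frontier_def interior_open)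
      then have "dist c x = R / 2 \<or> dist c x = R" using cD by (fastforce simp: D_def)
      then show ?thesis using sph by force
    qed
    show "\<exists>l<0. lap_at (\<lambda>y. W y - \<mu> * z y) x l" if x: "x \<in> D" "W x - \<mu> * z x < 0" for x
    proof -
      obtain l where l: "l \<le> L * W x" "lap_at W x l" using lap[of x] x by (auto simp: D_def)
      obtain k where k: "L * z x < k" "lap_at z x k" using lapz[of x] x by (auto simp: D_def)
      have "lap_at (\<lambda>y. W y - \<mu> * z y) x (l - \<mu> * k)"
        by (intro lap_at_diff lap_at_cmult l k)
      moreover have "l - \<mu> * k < 0"
      proof -
        have "\<mu> * (L * z x) < \<mu> * k" using mu k by simp
        then have "l - \<mu> * k < L * (W x - \<mu> * z x)" using l by (simp add: algebra_simps)
        also have "\<dots> \<le> 0" using L x by (simp add: mult_nonneg_nonpos)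
        finally show ?thesis .
      qed
      ultimately show ?thesis by blast
    qed
  qed
  \<comment> \<open>The slope comes from \<open>exp x \<ge> 1 + x\<close> together with
    \<open>R\<^sup>2 - \<rho>\<^sup>2 \<ge> R * (R - \<rho>)\<close>.\<close>
  define \<epsilon> where "\<epsilon> = \<mu> * (exp (- a * R\<^sup>2) * (a * R))"
  show ?thesis
  proof (rule that)
    show "0 < \<epsilon>" using mu a1 R by (simp add: \<epsilon>_def)
    fix y assume y: "R / 2 \<le> dist c y" "dist c y \<le> R"
    have 1: "\<mu> * z y \<le> W y"
    proof (cases "y \<in> D")
      case True then show ?thesis using inD by force
    next
      case False then show ?thesis using sph y by (force simp: D_def)
    qed
    define \<rho> where "\<rho> = dist c y"
    have "a * (R * (R - \<rho>)) \<le> a * (R\<^sup>2 - \<rho>\<^sup>2)"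
    proof -
      have "0 \<le> \<rho> * (R - \<rho>)" using y R by (auto simp: \<rho>_def)
      then show ?thesis using a1 by (intro mult_left_mono) (auto simp: power2_eq_square algebra_simps)
    qed
    also have "\<dots> \<le> exp (a * (R\<^sup>2 - \<rho>\<^sup>2)) - 1"
      using exp_ge_add_one_self[of "a * (R\<^sup>2 - \<rho>\<^sup>2)"] by linarith
    finally have "exp (- a * R\<^sup>2) * (a * (R * (R - \<rho>))) \<le> exp (- a * R\<^sup>2) * (exp (a * (R\<^sup>2 - \<rho>\<^sup>2)) - 1)"
      by (intro mult_left_mono) auto
    also have "\<dots> = z y"
      unfolding z_dist \<rho>_def[symmetric] by (simp add: algebra_simps flip: exp_add)
    finally have "\<mu> * (exp (- a * R\<^sup>2) * (a * (R * (R - \<rho>)))) \<le> \<mu> * z y" using mu by simp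
    then show "\<epsilon> * (R - dist c y) \<le> W y" using 1 by (simp add: \<epsilon>_def \<rho>_def mult_ac)
  qed
qed

text \<open>If \<open>W q\<close> is positive near the zero \<open>p\<close>, take the zero
  \<open>z\<close> closest to \<open>q\<close>. The ball about \<open>q\<close> through
  \<open>z\<close> carries a Hopf barrier, so \<open>W\<close> has positive slope at
  \<open>z\<close>; but \<open>z\<close> is an interior minimum and its gradient vanishes along that
  direction.\<close>

lemma strong_maximum_principle:
  fixes W :: "'a::euclidean_space \<Rightarrow> real"
  assumes L: "0 \<le> L" and D: "open D" and W0: "\<And>y. y \<in> D \<Longrightarrow> 0 \<le> W y"
    and lap: "\<And>y. y \<in> D \<Longrightarrow> \<exists>l\<le>L * W y. lap_at W y l"
    and p: "p \<in> D" "W p = 0"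
  obtains r where "0 < r" "\<And>y. y \<in> ball p r \<Longrightarrow> W y = 0"
proof -
  have cont: "continuous_on D W"
    using lap lap_at_imp_isCont by (blast intro: continuous_at_imp_continuous_on)
  obtain r' where r': "0 < r'" "cball p r' \<subseteq> D" using D p(1) open_contains_cball_eq by blast
  \<comment> \<open>Halved because the closest zero to \<open>q\<close> is less than
    \<open>r\<close> away from \<open>q\<close>, so the whole touching ball stays within
    \<open>2 * r\<close> of \<open>p\<close>.\<close>
  define r where "r = r' / 2"
  have r: "0 < r" "cball p (2 * r) \<subseteq> D" using r' by (auto simp: r_def)
  have "W q = 0" if q: "q \<in> ball p r" for q
  proof (rule ccontr)
    assume "W q \<noteq> 0"
    have "q \<in> D" using q r by (auto simp: subset_iff)
    with \<open>W q \<noteq> 0\<close> have Wq: "0 < W q" using W0[of q] by auto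
    define Z where "Z = {y \<in> cball p (2 * r). W y = 0}"
    have "closed Z"
      unfolding Z_def
      by (rule continuous_closed_preimage_constant) (auto intro: continuous_on_subset[OF cont r(2)])
    moreover have "p \<in> Z" using p r by (auto simp: Z_def)
    ultimately obtain z where z: "z \<in> Z" "\<And>y. y \<in> Z \<Longrightarrow> dist q z \<le> dist q y"
      using distance_attains_inf[of Z q] by blast
    define \<rho> where "\<rho> = dist q z"
    have rho: "\<rho> < r" using z(2)[OF \<open>p \<in> Z\<close>] q by (simp add: \<rho>_def dist_commute)
    have rho0: "0 < \<rho>" using Wq z(1) by (auto simp: \<rho>_def Z_def)
    have sub: "cball q \<rho> \<subseteq> cball p (2 * r)"
    proof
      fix y assume "y \<in> cball q \<rho>"
      then show "y \<in> cball p (2 * r)" using dist_triangle[of p y q] rho q by auto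
    qed
    obtain \<epsilon> where eps: "0 < \<epsilon>"
      "\<And>y. \<rho> / 2 \<le> dist q y \<Longrightarrow> dist q y \<le> \<rho> \<Longrightarrow> \<epsilon> * (\<rho> - dist q y) \<le> W y"
    proof (rule hopf_barrier[OF rho0 L])
      show "continuous_on (cball q \<rho>) W" using cont sub r by (meson continuous_on_subset subset_trans)
      fix y assume y: "y \<in> ball q \<rho>"
      then have yD: "y \<in> cball p (2 * r)" "y \<in> D" using sub r ball_subset_cball by blast+
      then show "\<exists>l\<le>L * W y. lap_at W y l" using lap by blast
      have "y \<notin> Z" using z(2)[of y] y by (auto simp: \<rho>_def)
      then show "0 < W y" using W0[OF yD(2)] yD(1) by (auto simp: Z_def less_le)
    qed blast
    have zD: "z \<in> D" "W z = 0" using z(1) r by (auto simp: Z_def)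
    define v where "v = q - z"
    obtain G where G: "GDERIV W z :> G" using lap[OF zD(1)] lap_at_gderiv by blast
    have d: "((\<lambda>t. W (z + t *\<^sub>R v)) has_real_derivative G \<bullet> v) (at 0)"
      by (rule gderiv_line) (use G in simp)
    obtain s where s: "0 < s" "ball z s \<subseteq> D" using D zD(1) open_contains_ball_eq by blast
    have G0: "G \<bullet> v = 0"
    proof (rule DERIV_local_min[OF d, of "s / \<rho>"])
      show "0 < s / \<rho>" using s rho0 by simp
      show "\<forall>y. \<bar>0 - y\<bar> < s / \<rho> \<longrightarrow> W (z + 0 *\<^sub>R v) \<le> W (z + y *\<^sub>R v)"
      proof (intro allI impI)
        fix t :: real assume "\<bar>0 - t\<bar> < s / \<rho>"
        moreover have "dist z (z + t *\<^sub>R v) = \<bar>t\<bar> * \<rho>"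
          by (simp add: dist_norm v_def \<rho>_def)
        ultimately have "dist z (z + t *\<^sub>R v) < s"
          using rho0 by (simp add: field_simps)
        then show "W (z + 0 *\<^sub>R v) \<le> W (z + t *\<^sub>R v)" using s W0 zD by auto
      qed
    qed
    have dd: "((\<lambda>t. W (z + t *\<^sub>R v) - \<epsilon> * \<rho> * t) has_real_derivative G \<bullet> v - \<epsilon> * \<rho>) (at 0)"
      by (auto intro!: derivative_eq_intros d)
    have neg: "G \<bullet> v - \<epsilon> * \<rho> < 0" using G0 eps rho0 by simp
    obtain d0 where d0: "d0 > 0"
      "\<And>h. 0 < h \<Longrightarrow> h < d0 \<Longrightarrow> W (z + h *\<^sub>R v) - \<epsilon> * \<rho> * h < W z"
      using DERIV_neg_dec_right[OF dd neg] by auto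
    define h where "h = min d0 1 / 2"
    have h: "0 < h" "h < d0" "h \<le> 1/2" using d0 by (auto simp: h_def)
    have "q - (z + h *\<^sub>R v) = (1 - h) *\<^sub>R v" by (simp add: v_def algebra_simps)
    then have dq: "dist q (z + h *\<^sub>R v) = (1 - h) * \<rho>"
      using h by (simp add: dist_norm \<rho>_def v_def)
    have "\<epsilon> * (\<rho> - dist q (z + h *\<^sub>R v)) \<le> W (z + h *\<^sub>R v)"
    proof (rule eps(2))
      show "\<rho> / 2 \<le> dist q (z + h *\<^sub>R v)" unfolding dq using h rho0 by (simp add: field_simps)
      show "dist q (z + h *\<^sub>R v) \<le> \<rho>" unfolding dq using h rho0 by (simp add: field_simps)
    qed
    then show False using d0(2)[OF h(1,2)] zD unfolding dq by (simp add: algebra_simps)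
  qed
  then show ?thesis using that r by blast
qed

text \<open>The supersolution \<open>\<Gamma> = sqrt (- ln \<bar>y - c\<bar>\<^sup>2)\<close> blows up at \<open>c\<close> and satisfies \<open>\<Delta> \<Gamma> < - L \<Gamma>\<close> near \<open>c\<close> in
  every dimension \<open>\<ge> 2\<close>, which the fundamental solution does not. Hence \<open>m / \<Gamma>\<close> attains its maximum,
  and a positive maximum is impossible.\<close>
lemma singular_maximum_principle:
  fixes c :: "'a::euclidean_space" and m :: "'a \<Rightarrow> real"
  assumes dim: "2 \<le> DIM('a)" and L: "0 \<le> L" and r: "0 < r" "r \<le> 1 / (32 * (L + 1))"
    and cont: "continuous_on (cball c r - {c}) m"
    and bound: "\<And>y. y \<in> cball c r - {c} \<Longrightarrow> m y \<le> B"
    and sph: "\<And>y. dist c y = r \<Longrightarrow> m y \<le> 0"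
    and lap: "\<And>y. y \<in> ball c r - {c} \<Longrightarrow> 0 < m y \<Longrightarrow> \<exists>l\<ge>- L * m y. lap_at m y l"
    and y: "y \<in> ball c r - {c}"
  shows "m y \<le> 0"
proof (rule ccontr)
  assume my: "\<not> m y \<le> 0"
  define n where "n = real DIM('a)"
  define F where "F = (\<lambda>q. sqrt (- ln q))"
  define \<Gamma> where "\<Gamma> = (\<lambda>y. F ((y - c) \<bullet> (y - c)))"
  have "1 / (32 * (L + 1)) \<le> 1 / 32" using L by (simp add: field_simps)
  then have r1: "r < 1" using r by linarith
  have rL: "16 * r * L < 1"
  proof -
    have "r * (32 * (L + 1)) \<le> 1" using r L by (simp add: field_simps)
    moreover have "0 \<le> r * L" using r L by simp
    ultimately show ?thesis using r by (simp add: algebra_simps)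
  qed
  have q01: "0 < (y - c) \<bullet> (y - c) \<and> (y - c) \<bullet> (y - c) \<le> r\<^sup>2 \<and> (y - c) \<bullet> (y - c) < 1"
    if "y \<in> cball c r - {c}" for y
  proof -
    have "norm (y - c) \<le> r" using that by (simp add: dist_norm norm_minus_commute)
    then have "(norm (y - c))\<^sup>2 \<le> r\<^sup>2" by (intro power_mono) auto
    moreover have "r\<^sup>2 < 1" using r r1 by (simp add: power_less_one_iff)
    moreover have "0 < norm (y - c)" using that by simp
    ultimately show ?thesis by (auto simp: power2_norm_eq_inner)
  qed
  have Gpos: "0 < \<Gamma> y" if "y \<in> cball c r - {c}" for y
    using q01[OF that] by (simp add: \<Gamma>_def F_def)
  have lapG: "\<exists>l. l < - L * \<Gamma> p \<and> lap_at \<Gamma> p l" if p: "p \<in> ball c r - {c}" for p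
  proof -
    define q where "q = (p - c) \<bullet> (p - c)"
    have q: "0 < q" "q \<le> r\<^sup>2" "q < 1" using q01[of p] p by (auto simp: q_def)
    define s where "s = sqrt (- ln q)"
    have lq: "0 < - ln q" using q by simp
    then have s: "0 < s" "s\<^sup>2 = - ln q" by (auto simp: s_def)
    have root: "((\<lambda>q. sqrt (- ln q)) has_real_derivative - (1 / (2 * q * sqrt (- ln q)))) (at q)"
      if "0 < q" "q < 1" for q :: real
    proof -
      have 1: "((\<lambda>q. - ln q) has_real_derivative - (inverse q)) (at q)"
        using that(1) by (intro DERIV_minus DERIV_ln)
      have 2: "0 < - ln q" using that by simp
      have 3: "((\<lambda>q. sqrt (- ln q)) has_real_derivative inverse (sqrt (- ln q)) / 2 * - (inverse q)) (at q)"
        by (rule DERIV_chain2[where f = sqrt and g = "\<lambda>q. - ln q", OF DERIV_real_sqrt[OF 2] 1])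
      have 4: "inverse x / 2 * - (inverse y) = - (1 / (2 * y * x))" for x y :: real
        by (simp add: inverse_eq_divide)
      show ?thesis using 3 unfolding 4 .
    qed
    have F2: "((\<lambda>q. - (1 / (2 * q * sqrt (- ln q)))) has_real_derivative
        (s - 1 / (2 * s)) / (2 * q\<^sup>2 * s\<^sup>2)) (at q)"
    proof -
      have "((\<lambda>q::real. 2 * q) has_real_derivative 2) (at q)"
        by (auto intro!: derivative_eq_intros)
      then have "((\<lambda>q. 2 * q * sqrt (- ln q)) has_real_derivative
          2 * sqrt (- ln q) + - (1 / (2 * q * sqrt (- ln q))) * (2 * q)) (at q)"
        by (intro DERIV_mult root q)
      moreover have "2 * s + - (1 / (2 * q * s)) * (2 * q) = 2 * s - 1 / s"
        using q by simp
      ultimately have "((\<lambda>q. 2 * q * sqrt (- ln q)) has_real_derivative 2 * s - 1 / s) (at q)"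
        by (simp add: s_def[symmetric])
      moreover have "2 * q * sqrt (- ln q) \<noteq> 0" using q s by (simp add: s_def)
      ultimately have "((\<lambda>q. - (1 / (2 * q * sqrt (- ln q)))) has_real_derivative
          - ((0 * (2 * q * sqrt (- ln q)) - 1 * (2 * s - 1 / s)) / (2 * q * sqrt (- ln q) * (2 * q * sqrt (- ln q))))) (at q)"
        by (intro DERIV_minus DERIV_divide DERIV_const)
      moreover have "- ((0 * (2 * q * s) - 1 * (2 * s - 1 / s)) / (2 * q * s * (2 * q * s)))
          = (s - 1 / (2 * s)) / (2 * q\<^sup>2 * s\<^sup>2)"
        using q s(1) by (simp add: field_simps power2_eq_square)
      ultimately show ?thesis by (simp only: s_def[symmetric])
    qed
    have "\<forall>\<^sub>F q in nhds q. (F has_real_derivative - (1 / (2 * q * sqrt (- ln q)))) (at q)"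
      using eventually_nhds_in_open[of "{0<..<1}" q] q root unfolding F_def by (auto elim!: eventually_mono)
    then have "lap_at \<Gamma> p (4 * q * ((s - 1 / (2 * s)) / (2 * q\<^sup>2 * s\<^sup>2)) + 2 * n * (- (1 / (2 * q * s))))"
      using F2 lap_at_radial[of F "\<lambda>q. - (1 / (2 * q * sqrt (- ln q)))" p c] 
      unfolding \<Gamma>_def[symmetric] q_def[symmetric] n_def[symmetric] s_def[symmetric] by blast
    moreover have "4 * q * ((s - 1 / (2 * s)) / (2 * q\<^sup>2 * s\<^sup>2)) + 2 * n * (- (1 / (2 * q * s)))
       = (2 - n) / (q * s) - 1 / (q * s ^ 3)"
      using q s(1) by (simp add: field_simps power2_eq_square power3_eq_cube)
    moreover have "(2 - n) / (q * s) - 1 / (q * s ^ 3) < - L * s"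
    proof -
      \<comment> \<open>The dimension enters here. The term is zero in dimension two, so the strict
        inequality has to come from the last term alone.\<close>
      have "(2 - n) / (q * s) \<le> 0"
        using dim q s by (simp add: n_def divide_nonpos_pos)
      moreover have "L * s < 1 / (q * s ^ 3)"
      proof -
        \<comment> \<open>With the fourth root, \<open>- ln k \<le> 1 / k\<close> gives
          \<open>s\<^sup>2 \<le> 4 / k\<close>, hence
          \<open>q * s ^ 4 \<le> 16 * k\<^sup>2 \<le> 16 * r\<close>. This is where the bound on
          \<open>r\<close> in terms of \<open>L\<close> comes from.\<close>
        define k where "k = sqrt (sqrt q)"
        have k: "0 < k" "k ^ 4 = q"
        proof -
          show "0 < k" using q by (simp add: k_def)
          have "k\<^sup>2 = sqrt q" using q by (simp add: k_def)
          then have "(k\<^sup>2)\<^sup>2 = q" using q by simp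
          then show "k ^ 4 = q" by simp
        qed
        have "ln q = 4 * ln k" using k by (metis ln_realpow of_nat_numeral)
        moreover have "- ln k \<le> 1 / k"
          using ln_le_minus_one[of "1 / k"] k by (simp add: ln_div)
        ultimately have "s\<^sup>2 \<le> 4 / k" using s by simp
        then have "(s\<^sup>2)\<^sup>2 \<le> (4 / k)\<^sup>2" by (intro power_mono) auto
        then have "s ^ 4 \<le> 16 / k\<^sup>2" by (simp add: power_divide)
        then have "q * s ^ 4 \<le> 16 * k\<^sup>2"
          using k by (simp add: field_simps flip: k(2)) (simp add: power_numeral_reduce mult_ac)
        also have "k\<^sup>2 \<le> r"
          using q r by (simp add: k_def real_le_lsqrt)
        finally have "q * s ^ 4 \<le> 16 * r" by simp
        then have "L * (q * s ^ 4) \<le> L * (16 * r)" using L by (intro mult_left_mono)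
        then have "L * (q * s ^ 4) < 1" using rL by (simp add: algebra_simps)
        then show ?thesis using q(1) s(1) by (simp add: field_simps power_numeral_reduce)
      qed
      ultimately show ?thesis by linarith
    qed
    moreover have "\<Gamma> p = s" by (simp add: \<Gamma>_def F_def s_def q_def)
    ultimately show ?thesis by (metis)
  qed
  \<comment> \<open>The positive ratio at the given point is the level that the maximum of
    \<open>m / \<Gamma>\<close> must reach.\<close>
  define \<tau> where "\<tau> = m y / \<Gamma> y"
  have tau: "0 < \<tau>" using my Gpos[of y] y by (simp add: \<tau>_def)
  have B: "0 < B" using bound[of y] y my by auto
  \<comment> \<open>Chosen so that \<open>\<Gamma>\<close> exceeds \<open>B / \<tau>\<close> within
    distance \<open>\<delta>\<close> of \<open>c\<close>. There the bounded function
    \<open>m\<close> stays below \<open>\<tau> * \<Gamma>\<close>, so the maximum may be sought on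
    the compact annulus \<open>K\<close>.\<close>
  define \<delta> where "\<delta> = sqrt (exp (- ((B / \<tau>)\<^sup>2)))"
  have delta: "0 < \<delta>" by (simp add: \<delta>_def)
  have near: "m x < \<tau> * \<Gamma> x" if x: "x \<in> cball c r - {c}" "dist c x < \<delta>" for x
  proof -
    define q where "q = (x - c) \<bullet> (x - c)"
    have q: "0 < q" "q < 1" using q01[OF x(1)] by (auto simp: q_def)
    have "(dist c x)\<^sup>2 < \<delta>\<^sup>2" using x(2) by (intro power_strict_mono) auto
    then have "q < exp (- ((B / \<tau>)\<^sup>2))"
      by (simp add: \<delta>_def q_def dist_norm norm_minus_commute flip: power2_norm_eq_inner)
    then have "ln q < - ((B / \<tau>)\<^sup>2)" using q by (metis ln_exp ln_less_cancel_iff exp_gt_zero)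
    then have "B / \<tau> < sqrt (- ln q)" using B tau by (intro real_less_rsqrt) auto
    then have "B < \<tau> * \<Gamma> x" using tau by (simp add: \<Gamma>_def F_def q_def field_simps)
    then show ?thesis using bound[OF x(1)] by simp
  qed
  define K where "K = {x. \<delta> \<le> dist c x \<and> dist c x \<le> r}"
  have yK: "y \<in> K"
    using near[of y] y Gpos[of y] by (force simp: K_def \<tau>_def)
  have "closed K" unfolding K_def
    by (intro closed_Collect_conj closed_Collect_le continuous_intros)
  moreover have "bounded K" by (rule bounded_subset[of "cball c r"]) (auto simp: K_def)
  ultimately have "compact K" by (simp add: compact_eq_bounded_closed)
  have Ksub: "K \<subseteq> cball c r - {c}" using delta by (auto simp: K_def)
  have "continuous_on (cball c r - {c}) \<Gamma>"
    unfolding \<Gamma>_def F_def by (intro continuous_intros) (use q01 in auto)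
  then have "continuous_on (cball c r - {c}) (\<lambda>x. m x / \<Gamma> x)"
    by (intro continuous_intros cont) (use Gpos in force)+
  then obtain p where p: "p \<in> K" "\<And>x. x \<in> K \<Longrightarrow> m x / \<Gamma> x \<le> m p / \<Gamma> p"
    using continuous_attains_sup[OF \<open>compact K\<close>, of "\<lambda>x. m x / \<Gamma> x"] yK continuous_on_subset[OF _ Ksub]
    by blast
  define t where "t = m p / \<Gamma> p"
  have t: "\<tau> \<le> t" using p(2)[OF yK] by (simp add: \<tau>_def t_def)
  have pc: "p \<in> cball c r - {c}" using p Ksub by auto
  have mp: "m p = t * \<Gamma> p" using Gpos[OF pc] by (simp add: t_def)
  have mp0: "0 < m p" unfolding mp using Gpos[OF pc] t tau by simp
  have all: "m x \<le> t * \<Gamma> x" if x: "x \<in> cball c r - {c}" for x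
  proof (cases "x \<in> K")
    case True
    then have "m x / \<Gamma> x \<le> t" using p(2) by (simp add: t_def)
    then show ?thesis using Gpos[OF x] by (simp add: field_simps)
  next
    case False
    then have "m x < \<tau> * \<Gamma> x" using near[OF x] x by (auto simp: K_def)
    also have "\<dots> \<le> t * \<Gamma> x" using t Gpos[OF x] by simp
    finally show ?thesis by simp
  qed
  have pb: "p \<in> ball c r - {c}" using pc sph[of p] mp0 by force
  obtain l where l: "- L * m p \<le> l" "lap_at m p l" using lap[OF pb mp0] by blast
  obtain k where k: "k < - L * \<Gamma> p" "lap_at \<Gamma> p k" using lapG[OF pb] by blast
  \<comment> \<open>At the point of maximal ratio this difference has an interior minimum with value
    zero, but \<open>\<Gamma>\<close> is strictly more superharmonic than the inequality for
    \<open>m\<close> allows.\<close>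
  have "lap_at (\<lambda>x. t * \<Gamma> x - m x) p (t * k - l)" by (intro lap_at_diff lap_at_cmult l k)
  moreover have "\<forall>\<^sub>F x in nhds p. t * \<Gamma> p - m p \<le> t * \<Gamma> x - m x"
  proof -
    have "open (ball c r - {c})" by (simp add: open_delete)
    from eventually_nhds_in_open[OF this pb] show ?thesis
      by eventually_elim (use all mp in auto)
  qed
  ultimately have "0 \<le> t * k - l" by (rule lap_at_local_min)
  moreover have "t * k < t * (- L * \<Gamma> p)" using t tau k by (intro mult_strict_left_mono) auto
  ultimately show False using l unfolding mp by (simp add: mult_ac)
qed

section \<open>Boundary geometry\<close>

lemma gderiv_lipschitz_cball:
  fixes \<phi> :: "'a::euclidean_space \<Rightarrow> real"
  assumes "\<And>x. x \<in> cball a r \<Longrightarrow> GDERIV \<phi> x :> h x" "continuous_on (cball a r) h"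
  obtains M where "0 \<le> M" "\<And>y z. y \<in> cball a r \<Longrightarrow> z \<in> cball a r \<Longrightarrow> \<bar>\<phi> y - \<phi> z\<bar> \<le> M * norm (y - z)"
proof -
  have "compact (h ` cball a r)" by (intro compact_continuous_image assms) simp
  then obtain M0 where M0: "\<And>x. x \<in> cball a r \<Longrightarrow> norm (h x) \<le> M0"
    using compact_imp_bounded bounded_iff by (metis imageI)
  show ?thesis
  proof (rule that[of "max 0 M0"])
    fix y z assume yz: "y \<in> cball a r" "z \<in> cball a r"
    have seg: "z + s *\<^sub>R (y - z) \<in> cball a r" if "0 \<le> s" "s \<le> 1" for s
    proof -
      have "(1 - s) *\<^sub>R z + s *\<^sub>R y \<in> cball a r"
        using convexD_alt[OF convex_cball yz(2,1) that] .
      then show ?thesis by (simp add: algebra_simps)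
    qed
    have "continuous_on {0..1} (\<lambda>s. \<phi> (z + s *\<^sub>R (y - z)))"
    proof (rule continuous_on_compose2[of "cball a r" \<phi>])
      show "continuous_on (cball a r) \<phi>"
        using assms(1) gderiv_imp_isCont continuous_at_imp_continuous_on by blast
      show "(\<lambda>s. z + s *\<^sub>R (y - z)) ` {0..1} \<subseteq> cball a r" using seg by auto
    qed (intro continuous_intros)
    then obtain s where s: "0 < s" "s < 1"
      "\<phi> (z + (y - z)) - \<phi> z = h (z + s *\<^sub>R (y - z)) \<bullet> (y - z)"
      using gderiv_mvt[of \<phi> z "y - z" h] assms(1) seg by (metis less_imp_le)
    then have "\<bar>\<phi> y - \<phi> z\<bar> \<le> norm (h (z + s *\<^sub>R (y - z))) * norm (y - z)"
      using Cauchy_Schwarz_ineq2 by simp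
    also have "\<dots> \<le> max 0 M0 * norm (y - z)"
      using M0[OF seg[of s]] s by (intro mult_right_mono) auto
    finally show "\<bar>\<phi> y - \<phi> z\<bar> \<le> max 0 M0 * norm (y - z)" .
  qed simp
qed

lemma continuous_on_componentwise_inner:
  fixes h :: "'b::t2_space \<Rightarrow> 'a::euclidean_space"
  assumes "\<And>i. i \<in> Basis \<Longrightarrow> continuous_on S (\<lambda>x. h x \<bullet> i)"
  shows "continuous_on S h"
  using assms continuous_on_componentwise[of S h] by blast

text \<open>The components of the gradient are Lipschitz on the ball, and the mean value theorem
  turns this into a quadratic Taylor remainder. The constant is the sum of the componentwise ones,
  by the \<open>l1\<close> bound on the norm.\<close>

lemma C2_second_order_estimate:
  fixes \<gamma> :: "'a::euclidean_space \<Rightarrow> real"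
  assumes "Ck_upto 2 UNIV UNIV \<gamma>"
  obtains g M where "\<And>x. GDERIV \<gamma> x :> g x" "0 \<le> M"
    "\<And>y. y \<in> cball a r \<Longrightarrow> \<bar>\<gamma> y - \<gamma> a - g a \<bullet> (y - a)\<bar> \<le> M * (norm (y - a))\<^sup>2"
proof -
  obtain g where g: "\<And>x. GDERIV \<gamma> x :> g x"
    "\<And>i. i \<in> Basis \<Longrightarrow> Ck_upto (Suc 0) UNIV UNIV (\<lambda>x. g x \<bullet> i)"
    using assms by (auto simp: numeral_2_eq_2)
  have "\<exists>M\<ge>0. \<forall>y\<in>cball a r. \<forall>z\<in>cball a r. \<bar>g y \<bullet> i - g z \<bullet> i\<bar> \<le> M * norm (y - z)"
    if i: "i \<in> Basis" for i
  proof -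
    obtain h where h: "\<And>x. GDERIV (\<lambda>x. g x \<bullet> i) x :> h x"
      "\<And>j. j \<in> Basis \<Longrightarrow> continuous_on UNIV (\<lambda>x. h x \<bullet> j)"
      using g(2)[OF i] by auto
    have "continuous_on (cball a r) h"
      by (rule continuous_on_subset[of UNIV]) (auto intro: continuous_on_componentwise_inner h)
    then show ?thesis
      using gderiv_lipschitz_cball[of a r "\<lambda>x. g x \<bullet> i" h] h(1) by metis
  qed
  then obtain M where M: "\<And>i. i \<in> Basis \<Longrightarrow> 0 \<le> M i"
    "\<And>i y z. i \<in> Basis \<Longrightarrow> y \<in> cball a r \<Longrightarrow> z \<in> cball a r \<Longrightarrow>
        \<bar>g y \<bullet> i - g z \<bullet> i\<bar> \<le> M i * norm (y - z)"
    by metis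
  have lip: "norm (g y - g z) \<le> (\<Sum>i\<in>Basis. M i) * norm (y - z)"
    if "y \<in> cball a r" "z \<in> cball a r" for y z
  proof -
    have "norm (g y - g z) \<le> (\<Sum>i\<in>Basis. \<bar>(g y - g z) \<bullet> i\<bar>)" by (rule norm_le_l1)
    also have "\<dots> \<le> (\<Sum>i\<in>Basis. M i * norm (y - z))"
      by (rule sum_mono) (use M that in \<open>simp add: inner_diff_left\<close>)
    finally show ?thesis by (simp add: sum_distrib_right)
  qed
  show ?thesis
  proof (rule that[OF g(1)])
    show "0 \<le> (\<Sum>i\<in>Basis. M i)" by (simp add: M sum_nonneg)
    fix y assume y: "y \<in> cball a r"
    have r: "a \<in> cball a r" using y zero_le_dist[of a y] by (simp del: zero_le_dist)
    have "continuous_on {0..1} (\<lambda>s. \<gamma> (a + s *\<^sub>R (y - a)))"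
    proof (rule continuous_on_compose2[of UNIV \<gamma>])
      show "continuous_on UNIV \<gamma>"
        using g(1) gderiv_imp_isCont continuous_at_imp_continuous_on by blast
    qed (auto intro!: continuous_intros)
    then obtain s where s: "0 < s" "s < 1"
      "\<gamma> (a + (y - a)) - \<gamma> a = g (a + s *\<^sub>R (y - a)) \<bullet> (y - a)"
      using gderiv_mvt[of \<gamma> a "y - a" g] g(1) by metis
    have "dist a (a + s *\<^sub>R (y - a)) = s * dist a y"
      using s by (simp add: dist_norm norm_minus_commute)
    also have "\<dots> \<le> 1 * dist a y" using s by (intro mult_right_mono) auto
    finally have sy: "norm (s *\<^sub>R (y - a)) \<le> norm (y - a)" "a + s *\<^sub>R (y - a) \<in> cball a r"
      using y by (auto simp: dist_norm norm_minus_commute)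
    have "\<gamma> y - \<gamma> a - g a \<bullet> (y - a) = (g (a + s *\<^sub>R (y - a)) - g a) \<bullet> (y - a)"
      using s(3) by (simp add: inner_diff_left)
    also have "\<bar>\<dots>\<bar> \<le> norm (g (a + s *\<^sub>R (y - a)) - g a) * norm (y - a)"
      by (rule Cauchy_Schwarz_ineq2)
    also have "\<dots> \<le> ((\<Sum>i\<in>Basis. M i) * norm (s *\<^sub>R (y - a))) * norm (y - a)"
      using lip[OF sy(2) r] by (intro mult_right_mono) (auto simp: algebra_simps)
    also have "\<dots> \<le> ((\<Sum>i\<in>Basis. M i) * norm (y - a)) * norm (y - a)"
      using sy(1) by (intro mult_right_mono mult_left_mono) (auto simp: M sum_nonneg)
    finally show "\<bar>\<gamma> y - \<gamma> a - g a \<bullet> (y - a)\<bar> \<le> (\<Sum>i\<in>Basis. M i) * (norm (y - a))\<^sup>2"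
      by (simp add: power2_eq_square mult.assoc)
  qed
qed

text \<open>Replaces the epigraph charts by a condition on \<open>\<nu>\<close> alone, in which the
  locale below states the regularity of the boundary. Curves in the graph show that
  \<open>\<nu>\<close> is parallel to the chart normal \<open>N\<close>, the inward side fixes the
  sign, and the Taylor remainder supplies \<open>M\<close>.\<close>

lemma two_sided_paraboloid:
  fixes \<Omega> :: "'a::euclidean_space set"
  assumes \<Omega>: "open \<Omega>" "C2_boundary \<Omega>" and x: "x \<in> frontier \<Omega>" and \<nu>: "outward_unit_normal \<Omega> x \<nu>"
  obtains M r where "0 < M" "0 < r"
    "\<And>z. dist x z < r \<Longrightarrow> (z - x) \<bullet> \<nu> < - M * (norm (z - x))\<^sup>2 \<Longrightarrow> z \<in> \<Omega>"
    "\<And>z. dist x z < r \<Longrightarrow> M * (norm (z - x))\<^sup>2 < (z - x) \<bullet> \<nu> \<Longrightarrow> z \<notin> \<Omega>"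
proof -
  obtain \<rho> e \<gamma> where \<rho>: "0 < \<rho>" and e: "norm e = 1" and \<gamma>: "Ck_upto 2 UNIV UNIV \<gamma>"
    and epi: "\<Omega> \<inter> ball x \<rho> = {z \<in> ball x \<rho>. \<gamma> (z - (z \<bullet> e) *\<^sub>R e) < z \<bullet> e}"
    using \<Omega>(2) x unfolding C2_boundary_def by blast
  define hor where "hor = (\<lambda>z. z - (z \<bullet> e) *\<^sub>R e)"
  have epi': "z \<in> \<Omega> \<longleftrightarrow> \<gamma> (hor z) < z \<bullet> e" if "dist x z < \<rho>" for z
  proof -
    have "z \<in> \<Omega> \<inter> ball x \<rho> \<longleftrightarrow> z \<in> {z \<in> ball x \<rho>. \<gamma> (z - (z \<bullet> e) *\<^sub>R e) < z \<bullet> e}"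
      unfolding epi ..
    then show ?thesis using that by (simp add: hor_def)
  qed
  have ee: "e \<bullet> e = 1" using e by (simp add: norm_eq_1)
  obtain g M0 where g: "\<And>x. GDERIV \<gamma> x :> g x" and M0: "0 \<le> M0"
    "\<And>y. y \<in> cball (hor x) \<rho> \<Longrightarrow> \<bar>\<gamma> y - \<gamma> (hor x) - g (hor x) \<bullet> (y - hor x)\<bar> \<le> M0 * (norm (y - hor x))\<^sup>2"
    using C2_second_order_estimate[OF \<gamma>, of "hor x" \<rho>] by metis
  define G where "G = g (hor x)"
  \<comment> \<open>Since \<open>\<gamma>\<close> is evaluated on the hyperplane only, just the
    horizontal part of its gradient counts. Thus \<open>N\<close> is the gradient at
    \<open>x\<close> of the height above the graph.\<close>
  define a where "a = G - (G \<bullet> e) *\<^sub>R e"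
  define N where "N = e - a"
  have ae: "a \<bullet> e = 0" by (simp add: a_def inner_diff_left ee)
  have hor_diff: "hor z - hor w = hor (z - w)" for z w
    by (simp add: hor_def inner_diff_left algebra_simps)
  have hor_e: "hor z \<bullet> e = 0" for z by (simp add: hor_def inner_diff_left ee)
  have hor_norm: "norm (hor z) \<le> norm z" for z
  proof -
    have "(norm (hor z))\<^sup>2 = (norm z)\<^sup>2 - (z \<bullet> e)\<^sup>2"
      unfolding power2_norm_eq_inner hor_def
      by (simp add: inner_diff_left inner_diff_right ee inner_commute power2_eq_square)
    then have "(norm (hor z))\<^sup>2 \<le> (norm z)\<^sup>2" by simp
    then show ?thesis by (rule power2_le_imp_le) simp
  qed
  have Ghor: "G \<bullet> hor z = z \<bullet> a" for z
    by (simp add: hor_def a_def inner_diff_left inner_diff_right inner_commute)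
  have err: "\<bar>\<gamma> (hor z) - \<gamma> (hor x) - (z - x) \<bullet> a\<bar> \<le> M0 * (norm (z - x))\<^sup>2" if "dist x z < \<rho>" for z
  proof -
    have "norm (hor z - hor x) \<le> norm (z - x)" using hor_norm by (simp add: hor_diff)
    moreover from this have "hor z \<in> cball (hor x) \<rho>"
      using that by (simp add: dist_norm norm_minus_commute)
    ultimately have "\<bar>\<gamma> (hor z) - \<gamma> (hor x) - G \<bullet> (hor z - hor x)\<bar> \<le> M0 * (norm (hor z - hor x))\<^sup>2"
      using M0(2) by (simp add: G_def)
    also have "\<dots> \<le> M0 * (norm (z - x))\<^sup>2"
      using M0(1) \<open>norm (hor z - hor x) \<le> norm (z - x)\<close> by (intro mult_left_mono power_mono) auto
    finally show ?thesis by (simp add: hor_diff Ghor)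
  qed
  have cg: "continuous_on UNIV \<gamma>"
    using g gderiv_imp_isCont continuous_at_imp_continuous_on by blast
  have chor: "continuous_on UNIV (\<lambda>z. \<gamma> (hor z))"
    unfolding hor_def by (rule continuous_on_compose2[OF cg]) (auto intro!: continuous_intros)
  \<comment> \<open>A frontier point lies on the graph: strictly below it a whole neighbourhood
    would miss \<open>\<Omega>\<close>, and strictly above it the point would belong to
    \<open>\<Omega>\<close>.\<close>
  have xx: "\<gamma> (hor x) = x \<bullet> e"
  proof (rule antisym)
    show "\<gamma> (hor x) \<le> x \<bullet> e"
    proof (rule ccontr)
      assume "\<not> \<gamma> (hor x) \<le> x \<bullet> e"
      define S where "S = ball x \<rho> \<inter> {z. z \<bullet> e < \<gamma> (hor z)}"
      have "open S" unfolding S_def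
        by (intro open_Int open_ball open_Collect_less continuous_intros chor)
      moreover have "x \<in> S" using \<open>\<not> \<gamma> (hor x) \<le> x \<bullet> e\<close> \<rho> by (simp add: S_def)
      moreover have "S \<inter> \<Omega> = {}" using epi' by (auto simp: S_def)
      moreover have "x \<in> closure \<Omega>" using x by (simp add: frontier_def)
      ultimately show False using open_Int_closure_eq_empty by blast
    qed
    have "x \<notin> \<Omega>" using x \<Omega>(1) by (simp add: frontier_def interior_open)
    then show "x \<bullet> e \<le> \<gamma> (hor x)" using epi'[of x] \<rho> by auto
  qed
  have inside: "z \<in> \<Omega>" if "dist x z < \<rho>" "M0 * (norm (z - x))\<^sup>2 < (z - x) \<bullet> N" for z
    using err[OF that(1)] that(2) epi'[OF that(1)] xx by (auto simp: N_def inner_diff_left inner_diff_right)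
  have outside: "z \<notin> \<Omega>" if "dist x z < \<rho>" "(z - x) \<bullet> N < - M0 * (norm (z - x))\<^sup>2" for z
    using err[OF that(1)] that(2) epi'[OF that(1)] xx by (auto simp: N_def inner_diff_left inner_diff_right)
  have "N \<bullet> e = 1" by (simp add: N_def inner_diff_left ee ae)
  moreover have "N \<bullet> e \<le> norm N * norm e" by (rule norm_cauchy_schwarz)
  ultimately have N1: "1 \<le> norm N" using e by simp
  have tang: "\<nu> \<bullet> v = 0" if v: "v \<bullet> N = 0" for v
  proof -
    \<comment> \<open>A curve in the graph over the horizontal part of \<open>v\<close>; for
      \<open>v\<close> orthogonal to \<open>N\<close> its velocity is exactly \<open>v\<close>, so
      \<open>v\<close> is a tangent vector.\<close>
    define c where "c = (\<lambda>t. x + t *\<^sub>R hor v + (\<gamma> (hor x + t *\<^sub>R hor v) - \<gamma> (hor x)) *\<^sub>R e)"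
    have "((\<lambda>t. \<gamma> (hor x + t *\<^sub>R hor v)) has_real_derivative G \<bullet> hor v) (at 0)"
      by (rule gderiv_line) (simp add: G_def g)
    then have gv: "((\<lambda>t. \<gamma> (hor x + t *\<^sub>R hor v)) has_vector_derivative G \<bullet> hor v) (at 0)"
      by (simp add: has_real_derivative_iff_has_vector_derivative)
    have "(c has_vector_derivative hor v + (G \<bullet> hor v) *\<^sub>R e) (at 0)"
      unfolding c_def
      by (auto intro!: derivative_eq_intros gv has_vector_derivative_scaleR[where g = "\<lambda>_. e" and g' = 0]
           has_vector_derivative_real_field simp: has_real_derivative_iff_has_vector_derivative)
    moreover have "hor v + (G \<bullet> hor v) *\<^sub>R e = v"
      using v unfolding Ghor by (simp add: N_def hor_def inner_diff_right)
    ultimately have dc: "(c has_vector_derivative v) (at 0)" by simp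
    have c0: "c 0 = x" by (simp add: c_def)
    have "(c \<longlongrightarrow> x) (at 0)"
      using dc c0 has_vector_derivative_continuous isCont_def by (metis continuous_within)
    then have "\<forall>\<^sub>F t in at 0. dist (c t) x < \<rho>" using \<rho> by (rule tendstoD)
    then have "\<forall>\<^sub>F t in at 0. c t \<in> frontier \<Omega>"
    proof eventually_elim
      case (elim t)
      have hc: "hor (c t) = hor x + t *\<^sub>R hor v"
        by (simp add: c_def hor_def inner_add_left inner_diff_left ee algebra_simps)
      have ce: "c t \<bullet> e = \<gamma> (hor (c t))"
        unfolding hc by (simp add: c_def inner_add_left ee hor_e xx)
      have "c t \<notin> \<Omega>" using epi'[of "c t"] elim ce by (simp add: dist_commute)
      moreover have "c t \<in> closure \<Omega>"
        unfolding closure_approachable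
      proof (intro allI impI)
        fix \<epsilon> :: real assume "0 < \<epsilon>"
        define s where "s = min \<epsilon> (\<rho> - dist (c t) x) / 2"
        have s: "0 < s" "s < \<epsilon>" "s < \<rho> - dist (c t) x"
          using \<open>0 < \<epsilon>\<close> elim by (auto simp: s_def)
        have "dist (c t + s *\<^sub>R e) (c t) = s" using s e by (simp add: dist_norm)
        moreover have "dist x (c t + s *\<^sub>R e) < \<rho>"
          using dist_triangle[of x "c t + s *\<^sub>R e" "c t"] s calculation by (simp add: dist_commute)
        moreover have "hor (c t + s *\<^sub>R e) = hor (c t)"
          by (simp add: hor_def inner_add_left ee algebra_simps)
        then have "\<gamma> (hor (c t + s *\<^sub>R e)) < (c t + s *\<^sub>R e) \<bullet> e"
          using s ce by (simp add: inner_add_left ee)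
        ultimately show "\<exists>y\<in>\<Omega>. dist y (c t) < \<epsilon>" using epi' s by metis
      qed
      ultimately show ?case using \<Omega>(1) by (simp add: frontier_def interior_open)
    qed
    then have "tangent_vector (frontier \<Omega>) x v"
      unfolding tangent_vector_def using dc c0 by blast
    then show ?thesis using \<nu> unfolding outward_unit_normal_def by blast
  qed
  define c where "c = (\<nu> \<bullet> N) / (N \<bullet> N)"
  have NN: "0 < N \<bullet> N" using N1 by (metis inner_gt_zero_iff norm_zero not_one_le_zero)
  have nuN: "\<nu> = c *\<^sub>R N"
  proof -
    define v where "v = \<nu> - c *\<^sub>R N"
    have vN: "v \<bullet> N = 0" using NN by (simp add: v_def inner_diff_left c_def)
    have "v \<bullet> v = \<nu> \<bullet> v - c * (N \<bullet> v)" unfolding v_def by (simp add: inner_diff_left)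
    also have "\<dots> = 0" using tang[OF vN] vN by (simp add: inner_commute)
    finally show ?thesis by (simp add: v_def)
  qed
  have n1: "norm \<nu> = 1" using \<nu> by (simp add: outward_unit_normal_def)
  then have cN: "\<bar>c\<bar> * norm N = 1" by (simp add: nuN)
  \<comment> \<open>For positive \<open>c\<close> the points \<open>x - t *\<^sub>R \<nu>\<close>
    would be outside for small \<open>t\<close>. The bound \<open>1 / (M0 + 1)\<close> on
    \<open>t\<close> makes the linear term beat the quadratic one, as \<open>N\<close> has norm at
    least 1.\<close>
  have "\<not> 0 < c"
  proof
    assume "0 < c"
    have "\<forall>\<^sub>F t in at_right 0. x - t *\<^sub>R \<nu> \<in> \<Omega>"
      using \<nu> unfolding outward_unit_normal_def by (auto elim: eventually_mono)
    then obtain b where b: "0 < b" "\<And>t. 0 < t \<Longrightarrow> t < b \<Longrightarrow> x - t *\<^sub>R \<nu> \<in> \<Omega>"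
      unfolding eventually_at_right_field by auto
    define m where "m = Min {b, \<rho>, 1 / (M0 + 1)}"
    define t where "t = m / 2"
    have "0 < m" using b \<rho> M0 by (simp add: m_def)
    moreover have "m \<le> b" "m \<le> \<rho>" "m \<le> 1 / (M0 + 1)" by (simp_all add: m_def)
    ultimately have t: "0 < t" "t < b" "t < \<rho>" "t < 1 / (M0 + 1)" by (auto simp: t_def)
    have "x - t *\<^sub>R \<nu> \<notin> \<Omega>"
    proof (rule outside)
      show "dist x (x - t *\<^sub>R \<nu>) < \<rho>" using t n1 by (simp add: dist_norm)
      have "(x - t *\<^sub>R \<nu> - x) \<bullet> N = - t * (c * (N \<bullet> N))" by (simp add: nuN)
      also have "c * (N \<bullet> N) = norm N"
        using cN \<open>0 < c\<close> by (simp add: power2_norm_eq_inner[symmetric] power2_eq_square)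
      also have "- t * norm N < - M0 * (norm (x - t *\<^sub>R \<nu> - x))\<^sup>2"
      proof -
        have "M0 * t < 1" using t M0 by (simp add: field_simps)
        then have "(M0 * t) * t < norm N * t" using t N1 by (intro mult_strict_right_mono) auto
        then show ?thesis using n1 t by (simp add: power2_eq_square mult_ac)
      qed
      finally show "(x - t *\<^sub>R \<nu> - x) \<bullet> N < - M0 * (norm (x - t *\<^sub>R \<nu> - x))\<^sup>2" .
    qed
    then show False using b(2)[OF t(1,2)] by simp
  qed
  then have Neq: "N = - norm N *\<^sub>R \<nu>"
    using cN by (simp add: nuN abs_if mult.commute split: if_splits)
  have Nz: "w \<bullet> N = - (norm N * (w \<bullet> \<nu>))" for w by (subst Neq) simp
  show ?thesis
  proof (rule that[of "M0 + 1" \<rho>])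
    show "0 < M0 + 1" using M0 by simp
    fix z assume z: "dist x z < \<rho>"
    \<comment> \<open>Passing from \<open>N\<close> to the unit vector costs nothing since
      \<open>norm N\<close> is at least 1; the constant becomes \<open>M0 + 1\<close> to be
      positive.\<close>
    have key: "M0 * (norm (z - x))\<^sup>2 < norm N * k" if "(M0 + 1) * (norm (z - x))\<^sup>2 < k" for k
    proof -
      have "0 \<le> (M0 + 1) * (norm (z - x))\<^sup>2" using M0 by simp
      with that have "0 \<le> k" by linarith
      then have "k \<le> norm N * k" using N1 by (simp add: mult_le_cancel_right1)
      moreover have "M0 * (norm (z - x))\<^sup>2 \<le> (M0 + 1) * (norm (z - x))\<^sup>2"
        by (intro mult_right_mono) auto
      ultimately show ?thesis using that by linarith
    qed
    show "z \<in> \<Omega>" if "(z - x) \<bullet> \<nu> < - (M0 + 1) * (norm (z - x))\<^sup>2"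
      by (rule inside[OF z]) (use key[of "- ((z - x) \<bullet> \<nu>)"] that in \<open>simp add: Nz\<close>)
    show "z \<notin> \<Omega>" if "(M0 + 1) * (norm (z - x))\<^sup>2 < (z - x) \<bullet> \<nu>"
      by (rule outside[OF z]) (use key[of "(z - x) \<bullet> \<nu>"] that in \<open>simp add: Nz\<close>)
  qed (use \<rho> in auto)
qed

lemma first_exit:
  fixes \<Omega> :: "'a::real_normed_vector set"
  assumes \<Omega>: "open \<Omega>" and q: "q \<in> \<Omega>" "q + d \<notin> \<Omega>"
  obtains s where "0 < s" "s \<le> 1" "q + s *\<^sub>R d \<in> frontier \<Omega>"
    "\<And>t. 0 \<le> t \<Longrightarrow> t < s \<Longrightarrow> q + t *\<^sub>R d \<in> \<Omega>"
proof -
  define T where "T = {0..1} \<inter> (\<lambda>t. q + t *\<^sub>R d) -` (- \<Omega>)"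
  have "closed T"
    unfolding T_def by (rule continuous_closed_preimage) (auto intro!: continuous_intros simp: \<Omega>)
  moreover have "bounded T"
    by (rule bounded_subset[of "{0..1}"]) (auto simp: T_def)
  ultimately have "compact T" by (simp add: compact_eq_bounded_closed)
  moreover have "1 \<in> T" using q by (simp add: T_def)
  ultimately obtain s where s: "s \<in> T" "\<And>t. t \<in> T \<Longrightarrow> s \<le> t"
    using compact_attains_inf[of T] by blast
  have s01: "0 \<le> s" "s \<le> 1" "q + s *\<^sub>R d \<notin> \<Omega>" using s(1) by (auto simp: T_def)
  have s0: "0 < s" using s01 q by (cases "s = 0") auto
  have before: "q + t *\<^sub>R d \<in> \<Omega>" if "0 \<le> t" "t < s" for t
    using s(2)[of t] that s01 by (auto simp: T_def)
  have "q + s *\<^sub>R d \<in> closure \<Omega>"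
  proof (rule Lim_in_closed_set[of "closure \<Omega>" "\<lambda>t. q + t *\<^sub>R d" "at_left s"])
    show "\<forall>\<^sub>F t in at_left s. q + t *\<^sub>R d \<in> closure \<Omega>"
      using eventually_at_left_real[OF s0] 
      by eventually_elim (use before closure_subset[of \<Omega>] in force)
    show "((\<lambda>t. q + t *\<^sub>R d) \<longlongrightarrow> q + s *\<^sub>R d) (at_left s)" by (intro tendsto_intros)
  qed auto
  then have "q + s *\<^sub>R d \<in> frontier \<Omega>" using s01 \<Omega> by (simp add: frontier_def interior_open)
  then show ?thesis using that s0 s01 before by blast
qed

text \<open>Compare \<open>F x\<close> with its value at a boundary point at distance \<open>O(t\<^sup>2)\<close> from \<open>x + t v\<close>, along two
  segments inside \<open>\<Omega>\<close>.\<close>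
lemma tangential_gradient_zero:
  fixes \<Omega> :: "'a::euclidean_space set" and F :: "'a \<Rightarrow> real"
  assumes \<Omega>: "open \<Omega>" and x: "x \<in> frontier \<Omega>" and \<nu>: "norm \<nu> = 1" and r: "0 < M" "0 < r"
    and inside: "\<And>z. dist x z < r \<Longrightarrow> (z - x) \<bullet> \<nu> < - M * (norm (z - x))\<^sup>2 \<Longrightarrow> z \<in> \<Omega>"
    and outside: "\<And>z. dist x z < r \<Longrightarrow> M * (norm (z - x))\<^sup>2 < (z - x) \<bullet> \<nu> \<Longrightarrow> z \<notin> \<Omega>"
    and F: "continuous_on (closure \<Omega> \<inter> ball x r) F"
    and dF: "\<And>y. y \<in> \<Omega> \<inter> ball x r \<Longrightarrow> GDERIV F y :> K y"
    and K: "continuous_on (closure \<Omega> \<inter> ball x r) K"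
    and const: "\<And>y. y \<in> frontier \<Omega> \<inter> ball x r \<Longrightarrow> F y = F x"
    and v: "v \<bullet> \<nu> = 0"
  shows "K x \<bullet> v = 0"
proof (rule ccontr)
  assume nz: "K x \<bullet> v \<noteq> 0"
  define \<eta> where "\<eta> = \<bar>K x \<bullet> v\<bar>"
  have eta: "0 < \<eta>" using nz by (simp add: \<eta>_def)
  define V where "V = norm v"
  \<comment> \<open>A shift by \<open>C * t\<^sup>2\<close> along the normal has to beat the
    paraboloid at \<open>t *\<^sub>R v\<close>: the first summand pays for
    \<open>t *\<^sub>R v\<close>, and the 1 for the square of the shift itself once \<open>t\<close>
    is small.\<close>
  define C where "C = M * V\<^sup>2 + 1"
  define B where "B = norm (K x) + 1"
  have V: "0 \<le> V" and C: "1 \<le> C" and B: "1 \<le> B" using r by (auto simp: V_def C_def B_def)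
  \<comment> \<open>The 1 keeps \<open>norm (K y)\<close> below \<open>B\<close>; the quotient keeps
    the variation of \<open>K\<close> along \<open>v\<close> within half of
    \<open>\<eta>\<close>.\<close>
  define \<epsilon> where "\<epsilon> = min 1 (\<eta> / (2 * (V + 1)))"
  have eps: "0 < \<epsilon>" "\<epsilon> \<le> 1" "\<epsilon> * (V + 1) \<le> \<eta> / 2"
  proof -
    show "0 < \<epsilon>" "\<epsilon> \<le> 1" using eta V by (auto simp: \<epsilon>_def)
    have "\<epsilon> \<le> \<eta> / (2 * (V + 1))" by (simp add: \<epsilon>_def)
    then show "\<epsilon> * (V + 1) \<le> \<eta> / 2" using V by (simp add: field_simps)
  qed
  have xc: "x \<in> closure \<Omega> \<inter> ball x r" using x r by (simp add: frontier_def)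
  obtain \<delta> where \<delta>: "0 < \<delta>"
    "\<And>y. y \<in> closure \<Omega> \<inter> ball x r \<Longrightarrow> dist y x < \<delta> \<Longrightarrow> dist (K y) (K x) < \<epsilon>"
    using K xc eps(1) unfolding continuous_on_iff by meson
  define \<delta>' where "\<delta>' = min \<delta> r"
  have d': "0 < \<delta>'" using \<delta> r by (simp add: \<delta>'_def)
  have Kn: "norm (K y - K x) < \<epsilon>" "norm (K y) \<le> B"
    if "y \<in> closure \<Omega>" "dist x y < \<delta>'" for y
  proof -
    show *: "norm (K y - K x) < \<epsilon>" using \<delta>(2)[of y] that by (simp add: \<delta>'_def dist_norm dist_commute norm_minus_commute)
    have "norm (K y) \<le> norm (K x) + norm (K y - K x)" using norm_triangle_ineq[of "K x" "K y - K x"] by simp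
    then show "norm (K y) \<le> B" using * eps by (simp add: B_def)
  qed
  \<comment> \<open>In order: \<open>t < 1\<close>, staying within \<open>\<delta>'\<close> of
    \<open>x\<close>, making the square of the shift negligible, and pushing the normal
    contributions \<open>3 * C * B * t\<close> below \<open>\<eta> / 2\<close>.\<close>
  define m where "m = Min {1, \<delta>' / (V + C), 1 / (M * C\<^sup>2), \<eta> / (6 * C * B)}"
  define t where "t = m / 2"
  have t: "0 < t" "t < 1" "t * (V + C) < \<delta>'" "t * (M * C\<^sup>2) < 1" "3 * C * B * t < \<eta> / 2"
  proof -
    have "0 < \<delta>' / (V + C)" "0 < 1 / (M * C\<^sup>2)" "0 < \<eta> / (6 * C * B)"
      using d' V C B r eta by (simp_all add: add_nonneg_pos)
    then have pos: "0 < m" by (simp add: m_def)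
    then show t0: "0 < t" by (simp add: t_def)
    have tm: "t < m" using pos by (simp add: t_def)
    have "m \<le> 1" "m \<le> \<delta>' / (V + C)" "m \<le> 1 / (M * C\<^sup>2)" "m \<le> \<eta> / (6 * C * B)"
      by (simp_all add: m_def)
    with tm have *: "t < 1" "t < \<delta>' / (V + C)" "t < 1 / (M * C\<^sup>2)" "t < \<eta> / (6 * C * B)" by linarith+
    show "t < 1" by fact
    show "t * (V + C) < \<delta>'" using *(2) V C by (simp add: pos_less_divide_eq)
    show "t * (M * C\<^sup>2) < 1" using *(3) r C by (simp add: pos_less_divide_eq)
    have "t * (6 * C * B) < \<eta>" using *(4) B C by (simp add: pos_less_divide_eq)
    then show "3 * C * B * t < \<eta> / 2" by (simp add: mult_ac)
  qed
  have vn: "\<nu> \<bullet> v = 0" "\<nu> \<bullet> \<nu> = 1" using v \<nu> by (auto simp: inner_commute norm_eq_1)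
  have pt_norm: "(norm (t *\<^sub>R v + k *\<^sub>R \<nu>))\<^sup>2 = t\<^sup>2 * V\<^sup>2 + k\<^sup>2" for k
    unfolding power2_norm_eq_inner V_def
    by (simp add: inner_add_left inner_add_right v vn power2_norm_eq_inner power2_eq_square inner_commute)
  have pt_dist: "norm (t *\<^sub>R v + k *\<^sub>R \<nu>) < \<delta>'" if "\<bar>k\<bar> \<le> C * t\<^sup>2" for k
  proof -
    have "norm (t *\<^sub>R v + k *\<^sub>R \<nu>) \<le> t * V + \<bar>k\<bar>"
      using norm_triangle_ineq[of "t *\<^sub>R v" "k *\<^sub>R \<nu>"] t \<nu> by (simp add: V_def)
    also have "\<dots> \<le> t * V + C * t" 
    proof -
      have "C * t\<^sup>2 \<le> C * t" using C t by (intro mult_left_mono) (auto simp: power2_eq_square)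
      then show ?thesis using that by simp
    qed
    also have "\<dots> < \<delta>'" using t by (simp add: algebra_simps)
    finally show ?thesis .
  qed
  have small: "M * (t\<^sup>2 * V\<^sup>2 + (C * t\<^sup>2)\<^sup>2) < C * t\<^sup>2"
  proof -
    have "t * (t * (M * C\<^sup>2)) < 1 * 1" using t r C by (intro mult_strict_mono) auto
    then have "t\<^sup>2 * (M * V\<^sup>2 + t * (t * (M * C\<^sup>2))) < t\<^sup>2 * C"
      using t by (intro mult_strict_left_mono) (auto simp: C_def)
    then show ?thesis by (simp add: power2_eq_square algebra_simps)
  qed
  \<comment> \<open>\<open>d1\<close> ends at \<open>q\<close>, just inside the inner paraboloid;
    \<open>d2\<close> runs from there along the normal to a point in the outer one, so it crosses
    the frontier.\<close>
  define d1 where "d1 = t *\<^sub>R v + (- (C * t\<^sup>2)) *\<^sub>R \<nu>"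
  define d2 where "d2 = (2 * (C * t\<^sup>2)) *\<^sub>R \<nu>"
  have d1n: "d1 \<bullet> \<nu> = - (C * t\<^sup>2)" by (simp add: d1_def inner_add_left inner_diff_left v vn)
  have d1norm: "norm d1 < \<delta>'" unfolding d1_def by (rule pt_dist) (use C in auto)
  have seg1: "x + s *\<^sub>R d1 \<in> \<Omega>" "dist x (x + s *\<^sub>R d1) < \<delta>'" if s: "0 < s" "s \<le> 1" for s
  proof -
    have "s * norm d1 \<le> 1 * norm d1" using s by (intro mult_right_mono) auto
    then show *: "dist x (x + s *\<^sub>R d1) < \<delta>'" using s d1norm by (simp add: dist_norm)
    show "x + s *\<^sub>R d1 \<in> \<Omega>"
    proof (rule inside)
      show "dist x (x + s *\<^sub>R d1) < r" using * by (simp add: \<delta>'_def)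
      have "M * (norm (s *\<^sub>R d1))\<^sup>2 = (s * s) * (M * (norm d1)\<^sup>2)" using s by (simp add: power2_eq_square mult_ac)
      also have "\<dots> \<le> s * (M * (norm d1)\<^sup>2)"
        using s r by (intro mult_right_mono) (auto simp: mult_le_one)
      also have "\<dots> < s * (C * t\<^sup>2)"
        using s small unfolding d1_def pt_norm by (intro mult_strict_left_mono) auto
      finally show "(x + s *\<^sub>R d1 - x) \<bullet> \<nu> < - M * (norm (x + s *\<^sub>R d1 - x))\<^sup>2"
        by (simp add: d1n)
    qed
  qed
  define q where "q = x + d1"
  have qO: "q \<in> \<Omega>" using seg1(1)[of 1] by (simp add: q_def)
  have qd: "q + k *\<^sub>R d2 = x + (t *\<^sub>R v + ((2 * k - 1) * (C * t\<^sup>2)) *\<^sub>R \<nu>)" for k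
    by (simp add: q_def d1_def d2_def algebra_simps)
  have near2: "dist x (q + k *\<^sub>R d2) < \<delta>'" if "0 \<le> k" "k \<le> 1" for k
  proof -
    have "\<bar>(2 * k - 1) * (C * t\<^sup>2)\<bar> \<le> 1 * (C * t\<^sup>2)"
      unfolding abs_mult using that C by (intro mult_mono) auto
    then show ?thesis unfolding qd dist_norm
      using pt_dist[of "(2 * k - 1) * (C * t\<^sup>2)"] by (simp add: norm_minus_commute del: norm_minus_cancel) (metis norm_minus_cancel minus_add_distrib diff_conv_add_uminus)
  qed
  have "q + d2 \<notin> \<Omega>"
  proof (rule outside)
    show "dist x (q + d2) < r" using near2[of 1] by (simp add: \<delta>'_def)
    show "M * (norm (q + d2 - x))\<^sup>2 < (q + d2 - x) \<bullet> \<nu>"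
      using qd[of 1] small pt_norm[of "C * t\<^sup>2"] by (simp add: inner_add_left v vn)
  qed
  then obtain \<sigma> where \<sigma>: "0 < \<sigma>" "\<sigma> \<le> 1" "q + \<sigma> *\<^sub>R d2 \<in> frontier \<Omega>"
    "\<And>t. 0 \<le> t \<Longrightarrow> t < \<sigma> \<Longrightarrow> q + t *\<^sub>R d2 \<in> \<Omega>"
    using first_exit[OF \<Omega> qO] by metis
  have contF: "continuous_on {0..1} (\<lambda>s. F (z + s *\<^sub>R d))"
    if "\<And>s. 0 \<le> s \<Longrightarrow> s \<le> 1 \<Longrightarrow> z + s *\<^sub>R d \<in> closure \<Omega> \<and> dist x (z + s *\<^sub>R d) < \<delta>'" for z d
    by (rule continuous_on_compose2[OF F]) (use that in \<open>auto intro!: continuous_intros simp: \<delta>'_def\<close>)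
  have subc: "\<Omega> \<subseteq> closure \<Omega>" by (rule closure_subset)
  obtain s1 where s1: "0 < s1" "s1 < 1" "F (x + d1) - F x = K (x + s1 *\<^sub>R d1) \<bullet> d1"
  proof (rule gderiv_mvt[of F x d1 K])
    show "continuous_on {0..1} (\<lambda>s. F (x + s *\<^sub>R d1))"
    proof (rule contF)
      fix s :: real assume "0 \<le> s" "s \<le> 1"
      then show "x + s *\<^sub>R d1 \<in> closure \<Omega> \<and> dist x (x + s *\<^sub>R d1) < \<delta>'"
        using seg1[of s] subc xc d' by (cases "s = 0") auto
    qed
    show "GDERIV F (x + s *\<^sub>R d1) :> K (x + s *\<^sub>R d1)" if "0 < s" "s < 1" for s
      using seg1[of s] that by (intro dF) (auto simp: \<delta>'_def)
  qed blast
  have pc: "q + s *\<^sub>R (\<sigma> *\<^sub>R d2) = q + (s * \<sigma>) *\<^sub>R d2" for s by simp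
  obtain s2 where s2: "0 < s2" "s2 < 1" "F (q + \<sigma> *\<^sub>R d2) - F q = K (q + s2 *\<^sub>R (\<sigma> *\<^sub>R d2)) \<bullet> (\<sigma> *\<^sub>R d2)"
  proof (rule gderiv_mvt[of F q "\<sigma> *\<^sub>R d2" K])
    show "continuous_on {0..1} (\<lambda>s. F (q + s *\<^sub>R (\<sigma> *\<^sub>R d2)))"
    proof (rule contF)
      fix s :: real assume s: "0 \<le> s" "s \<le> 1"
      have "q + (s * \<sigma>) *\<^sub>R d2 \<in> closure \<Omega>"
      proof (cases "s = 1")
        case True then show ?thesis using \<sigma>(3) by (simp add: frontier_def)
      next
        case False
        then have "s * \<sigma> < 1 * \<sigma>" using s \<sigma> by (intro mult_strict_right_mono) auto
        then show ?thesis using \<sigma>(4)[of "s * \<sigma>"] s \<sigma> subc by auto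
      qed
      moreover have "s * \<sigma> \<le> 1" using s \<sigma> by (simp add: mult_le_one)
      ultimately show "q + s *\<^sub>R (\<sigma> *\<^sub>R d2) \<in> closure \<Omega> \<and> dist x (q + s *\<^sub>R (\<sigma> *\<^sub>R d2)) < \<delta>'"
        using near2[of "s * \<sigma>"] s \<sigma> unfolding pc by simp
    qed
    show "GDERIV F (q + s *\<^sub>R (\<sigma> *\<^sub>R d2)) :> K (q + s *\<^sub>R (\<sigma> *\<^sub>R d2))" if s: "0 < s" "s < 1" for s
    proof -
      have "s * \<sigma> < 1 * \<sigma>" using s \<sigma> by (intro mult_strict_right_mono) auto
      moreover from this have "s * \<sigma> \<le> 1" using \<sigma>(2) by linarith
      ultimately show ?thesis unfolding pc using near2[of "s * \<sigma>"] \<sigma>(4)[of "s * \<sigma>"] s \<sigma>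
        by (intro dF) (auto simp: \<delta>'_def)
    qed
  qed blast
  define \<xi> where "\<xi> = x + s1 *\<^sub>R d1"
  define \<zeta> where "\<zeta> = q + s2 *\<^sub>R (\<sigma> *\<^sub>R d2)"
  have "s2 * \<sigma> < 1 * \<sigma>" using s2 \<sigma> by (intro mult_strict_right_mono) auto
  moreover from this have "s2 * \<sigma> \<le> 1" using \<sigma>(2) by linarith
  ultimately have zeta: "\<zeta> \<in> closure \<Omega>" "dist x \<zeta> < \<delta>'"
    using \<sigma>(1,2) s2 \<sigma>(4)[of "s2 * \<sigma>"] near2[of "s2 * \<sigma>"] subc unfolding \<zeta>_def pc by auto
  have xi: "\<xi> \<in> closure \<Omega>" "dist x \<xi> < \<delta>'" using seg1[of s1] s1 subc by (auto simp: \<xi>_def)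
  have "q + \<sigma> *\<^sub>R d2 \<in> ball x r" using near2[of \<sigma>] \<sigma> by (simp add: \<delta>'_def)
  then have "F (q + \<sigma> *\<^sub>R d2) = F x" using const \<sigma>(3) by blast
  then have "K \<xi> \<bullet> d1 + \<sigma> * (K \<zeta> \<bullet> d2) = 0"
    using s1(3) s2(3) by (simp add: q_def \<xi>_def \<zeta>_def)
  then have eq: "t * (K \<xi> \<bullet> v) = C * t\<^sup>2 * (K \<xi> \<bullet> \<nu>) - \<sigma> * (2 * (C * t\<^sup>2)) * (K \<zeta> \<bullet> \<nu>)"
    by (simp add: d1_def d2_def inner_add_right algebra_simps)
  have b1: "\<bar>K \<xi> \<bullet> \<nu>\<bar> \<le> B" using Kn(2)[OF xi] Cauchy_Schwarz_ineq2[of "K \<xi>" \<nu>] \<nu> by simp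
  have b2: "\<bar>K \<zeta> \<bullet> \<nu>\<bar> \<le> B" using Kn(2)[OF zeta] Cauchy_Schwarz_ineq2[of "K \<zeta>" \<nu>] \<nu> by simp
  have "t * \<bar>K \<xi> \<bullet> v\<bar> = \<bar>t * (K \<xi> \<bullet> v)\<bar>" using t by (simp add: abs_mult)
  also have "\<dots> \<le> \<bar>C * t\<^sup>2 * (K \<xi> \<bullet> \<nu>)\<bar> + \<bar>\<sigma> * (2 * (C * t\<^sup>2)) * (K \<zeta> \<bullet> \<nu>)\<bar>"
    unfolding eq by (rule abs_triangle_ineq4)
  also have "\<dots> \<le> C * t\<^sup>2 * B + 1 * (2 * (C * t\<^sup>2)) * B"
    unfolding abs_mult using b1 b2 \<sigma> C B by (intro add_mono mult_mono) auto
  also have "\<dots> = t * (3 * C * B * t)" by (simp add: power2_eq_square algebra_simps)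
  finally have "\<bar>K \<xi> \<bullet> v\<bar> \<le> 3 * C * B * t" using t(1) by simp
  moreover have "\<bar>K \<xi> \<bullet> v - K x \<bullet> v\<bar> \<le> \<epsilon> * V"
  proof -
    have "\<bar>(K \<xi> - K x) \<bullet> v\<bar> \<le> norm (K \<xi> - K x) * V" unfolding V_def by (rule Cauchy_Schwarz_ineq2)
    also have "\<dots> \<le> \<epsilon> * V" using Kn(1)[OF xi] V by (intro mult_right_mono) auto
    finally show ?thesis by (simp add: inner_diff_left)
  qed
  moreover have "\<epsilon> * V \<le> \<eta> / 2" using eps by (simp add: algebra_simps)
  ultimately show False using t(5) unfolding \<eta>_def by linarith
qed

section \<open>Removable singularities\<close>

text \<open>The difference quotients have integral zero by translation invariance of Lebesgue
  measure, and dominated convergence passes to the derivative.\<close>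

lemma integral_directional_derivative_zero:
  fixes F :: "'a::euclidean_space \<Rightarrow> real"
  assumes dF: "\<And>x. GDERIV F x :> K x" and K: "continuous_on UNIV K"
    and supp: "bounded C" "\<And>x. x \<notin> C \<Longrightarrow> F x = 0"
  shows "(LINT x|lborel. K x \<bullet> v) = 0"
proof -
  have cF: "continuous_on UNIV F"
    using dF gderiv_imp_isCont continuous_at_imp_continuous_on by blast
  then have mF: "F \<in> borel_measurable borel" by (rule borel_measurable_continuous_onI)
  obtain R where R: "\<And>x. x \<in> C \<Longrightarrow> norm x \<le> R" using supp(1) bounded_iff by metis
  \<comment> \<open>One \<open>norm v\<close> beyond \<open>R\<close>: outside this ball neither
    \<open>x\<close> nor the shifted point lies in \<open>C\<close>, as the steps \<open>t n\<close>
    are at most 1. The bound on \<open>K\<close> is taken on a ball larger by another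
    \<open>norm v\<close>, which contains the mean value points.\<close>
  define R' where "R' = R + norm v"
  define t where "t = (\<lambda>n. inverse (real (Suc n)))"
  have t: "0 < t n" "t n \<le> 1" for n by (auto simp: t_def inverse_le_1_iff)
  define s where "s = (\<lambda>n x. (F (x + t n *\<^sub>R v) - F x) / t n)"
  have "compact (K ` cball 0 (R' + norm v))"
    by (intro compact_continuous_image continuous_on_subset[OF K]) auto
  then obtain B where "\<forall>y\<in>K ` cball 0 (R' + norm v). norm y \<le> B"
    using compact_imp_bounded bounded_iff by metis
  then have B: "norm (K x) \<le> B" if "norm x \<le> R' + norm v" for x
    using that by (simp add: image_iff)
  define w where "w = (\<lambda>x::'a. indicator (cball 0 R') x *\<^sub>R (B * norm v))"
  have s_le: "norm (s n x) \<le> w x" for n x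
  proof (cases "norm x \<le> R'")
    case True
    have "continuous_on {0..1} (\<lambda>k. F (x + k *\<^sub>R (t n *\<^sub>R v)))"
      by (rule continuous_on_compose2[OF cF]) (auto intro!: continuous_intros)
    then obtain k where k: "0 < k" "k < 1"
      "F (x + t n *\<^sub>R v) - F x = K (x + k *\<^sub>R (t n *\<^sub>R v)) \<bullet> (t n *\<^sub>R v)"
      using gderiv_mvt[of F x "t n *\<^sub>R v" K] dF by metis
    have sn: "s n x = K (x + k *\<^sub>R (t n *\<^sub>R v)) \<bullet> v"
      using t[of n] by (simp add: s_def k(3))
    have "k * t n \<le> 1" using k t[of n] by (simp add: mult_le_one)
    then have "(k * t n) * norm v \<le> 1 * norm v" by (intro mult_right_mono) auto
    then have "norm (x + k *\<^sub>R (t n *\<^sub>R v)) \<le> R' + norm v"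
      using norm_triangle_ineq[of x "k *\<^sub>R (t n *\<^sub>R v)"] True k t[of n] by simp
    then have "norm (K (x + k *\<^sub>R (t n *\<^sub>R v))) * norm v \<le> B * norm v"
      using B by (intro mult_right_mono) auto
    then have "norm (s n x) \<le> B * norm v"
      unfolding sn using Cauchy_Schwarz_ineq2[of "K (x + k *\<^sub>R (t n *\<^sub>R v))" v] by simp
    then show ?thesis using True by (simp add: w_def)
  next
    case False
    then have "x \<notin> C" using R[of x] norm_ge_zero[of v] by (auto simp: R'_def)
    moreover have "x + t n *\<^sub>R v \<notin> C"
    proof
      assume "x + t n *\<^sub>R v \<in> C"
      then have 1: "norm (x + t n *\<^sub>R v) \<le> R" using R by blast
      have "t n * norm v \<le> 1 * norm v" using t[of n] by (intro mult_right_mono) auto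
      then have "norm x \<le> norm (x + t n *\<^sub>R v) + norm v"
        using norm_triangle_ineq4[of "x + t n *\<^sub>R v" "t n *\<^sub>R v"] t[of n] by simp
      then show False using 1 False by (simp add: R'_def)
    qed
    ultimately have "s n x = 0" using supp by (simp add: s_def)
    then show ?thesis using False by (simp add: w_def)
  qed
  have intF: "integrable lborel F"
  proof -
    have "integrable lborel (\<lambda>x. indicator (cball 0 R) x *\<^sub>R F x)"
      by (rule borel_integrable_compact) (auto intro: continuous_on_subset[OF cF])
    moreover have "(\<lambda>x. indicator (cball 0 R) x *\<^sub>R F x) = F"
      using R supp(2) by (fastforce simp: fun_eq_iff indicator_def)
    ultimately show ?thesis by simp
  qed
  have shift: "integrable lborel (\<lambda>x. F (x + c)) \<and> (LINT x|lborel. F (x + c)) = (LINT x|lborel. F x)" for c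
  proof -
    have m: "(+) c \<in> measurable lborel borel" by simp
    have "integrable (distr lborel borel ((+) c)) F" using intF by (simp add: lborel_distr_plus)
    then have "integrable lborel (\<lambda>x. F (c + x))" using integrable_distr_eq[OF m mF] by simp
    moreover have "integral\<^sup>L (distr lborel borel ((+) c)) F = (LINT x|lborel. F (c + x))"
      by (rule integral_distr[OF m mF])
    ultimately show ?thesis by (simp add: lborel_distr_plus add.commute)
  qed
  have ints: "(LINT x|lborel. s n x) = 0" for n
  proof -
    have "(LINT x|lborel. F (x + t n *\<^sub>R v) - F x) = 0"
      using shift[of "t n *\<^sub>R v"] intF by (subst Bochner_Integration.integral_diff) auto
    then show ?thesis unfolding s_def by simp
  qed
  have "(\<lambda>n. LINT x|lborel. s n x) \<longlonglongrightarrow> (LINT x|lborel. K x \<bullet> v)"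
  proof (rule integral_dominated_convergence[where w = w])
    show "(\<lambda>x. K x \<bullet> v) \<in> borel_measurable lborel"
      using K by (auto intro!: borel_measurable_continuous_onI continuous_intros)
    show "s n \<in> borel_measurable lborel" for n
    proof -
      have "continuous_on UNIV (\<lambda>x. F (x + t n *\<^sub>R v))"
        by (rule continuous_on_compose2[OF cF]) (auto intro!: continuous_intros)
      then have "continuous_on UNIV (s n)"
        unfolding s_def by (intro continuous_intros cF) (use t[of n] in auto)
      then show ?thesis by (auto intro!: borel_measurable_continuous_onI)
    qed
    show "integrable lborel w" unfolding w_def by (rule borel_integrable_compact) auto
    show "AE x in lborel. norm (s n x) \<le> w x" for n using s_le by simp
    have "(\<lambda>n. s n x) \<longlonglongrightarrow> K x \<bullet> v" for x
    proof -
      have "((\<lambda>h. F (x + h *\<^sub>R v)) has_real_derivative K x \<bullet> v) (at 0)"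
        by (rule gderiv_line) (simp add: dF)
      then have "((\<lambda>h. (F (x + h *\<^sub>R v) - F x) / h) \<longlongrightarrow> K x \<bullet> v) (at 0)"
        by (simp add: DERIV_def)
      moreover have "filterlim t (at 0) sequentially"
        using LIMSEQ_inverse_real_of_nat t(1) unfolding t_def
        by (intro filterlim_atI) (auto simp: less_imp_neq)
      ultimately show ?thesis unfolding s_def by (rule filterlim_compose)
    qed
    then show "AE x in lborel. (\<lambda>n. s n x) \<longlonglongrightarrow> K x \<bullet> v" by simp
  qed
  then have "(\<lambda>n. 0::real) \<longlonglongrightarrow> (LINT x|lborel. K x \<bullet> v)" by (simp add: ints)
  then show ?thesis by (simp add: LIMSEQ_const_iff)
qed

lemma GDERIV_unique:
  assumes "GDERIV W x :> D" "GDERIV W x :> E" shows "D = E"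
proof -
  have "(\<lambda>h. h \<bullet> D) = (\<lambda>h. h \<bullet> E)"
    using assms unfolding gderiv_def by (rule has_derivative_unique)
  then have "(D - E) \<bullet> D = (D - E) \<bullet> E" by metis
  then have "(D - E) \<bullet> (D - E) = 0" by (simp add: inner_diff_right)
  then show ?thesis by simp
qed

lemma gderiv_transform_open:
  assumes "GDERIV W x :> D" "open S" "x \<in> S" "\<And>y. y \<in> S \<Longrightarrow> W y = V y"
  shows "GDERIV V x :> D"
  using assms has_derivative_transform_within_open[of W _ x UNIV S V] unfolding gderiv_def by auto

text \<open>The classical gradient is a weak one: integration by parts against \<open>\<phi>\<close>
  says that the derivative of \<open>v * \<phi>\<close> has integral zero. Boundedness on a set of
  finite measure gives square integrability.\<close>

lemma C1_imp_in_H1: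
  fixes v :: "'a::euclidean_space \<Rightarrow> real"
  assumes \<Omega>: "open \<Omega>" "bounded \<Omega>"
    and dv: "\<And>x. x \<in> \<Omega> \<Longrightarrow> GDERIV v x :> g x" and g: "continuous_on \<Omega> g"
    and bd: "\<And>x. x \<in> \<Omega> \<Longrightarrow> \<bar>v x\<bar> \<le> B" "\<And>x. x \<in> \<Omega> \<Longrightarrow> norm (g x) \<le> B"
  shows "in_H1 \<Omega> v"
proof -
  have \<Omega>m: "\<Omega> \<in> sets lebesgue" using \<Omega>(1) by auto
  have "\<Omega> \<in> lmeasurable" using \<Omega> by (simp add: bounded_set_imp_lmeasurable)
  then interpret finite_measure "lebesgue_on \<Omega>" by (rule finite_measure_lebesgue_on)
  have cv: "continuous_on \<Omega> v"
    using dv gderiv_imp_isCont continuous_at_imp_continuous_on by blast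
  have sq: "square_integrable_on \<Omega> f" if f: "continuous_on \<Omega> f" "\<And>x. x \<in> \<Omega> \<Longrightarrow> \<bar>f x\<bar> \<le> B" for f :: "'a \<Rightarrow> real"
    unfolding square_integrable_on_def
  proof
    show m: "f \<in> borel_measurable (lebesgue_on \<Omega>)"
      by (rule continuous_imp_measurable_on_sets_lebesgue[OF f(1) \<Omega>m])
    have "(f x)\<^sup>2 \<le> B\<^sup>2" if "x \<in> \<Omega>" for x
      using power_mono[OF f(2)[OF that], of 2] by simp
    then show "integrable (lebesgue_on \<Omega>) (\<lambda>x. (f x)\<^sup>2)"
      using m by (intro integrable_const_bound[where B = "B\<^sup>2"]) (auto intro!: AE_I2)
  qed
  show ?thesis
    unfolding in_H1_def
  proof (intro conjI ballI exI)
    show "square_integrable_on \<Omega> v" by (rule sq[OF cv bd(1)])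
    fix i :: 'a assume i: "i \<in> Basis"
    show "square_integrable_on \<Omega> (\<lambda>x. g x \<bullet> i)"
    proof (rule sq)
      show "continuous_on \<Omega> (\<lambda>x. g x \<bullet> i)" using g by (intro continuous_intros)
      show "\<bar>g x \<bullet> i\<bar> \<le> B" if "x \<in> \<Omega>" for x
        using Basis_le_norm[OF i, of "g x"] bd(2)[OF that] by linarith
    qed
    show "weak_partial_deriv \<Omega> i v (\<lambda>x. g x \<bullet> i)"
      unfolding weak_partial_deriv_def
    proof (intro allI impI)
      fix \<phi> :: "'a \<Rightarrow> real" assume \<phi>: "test_function \<Omega> \<phi>"
      then have "Ck_upto (Suc 0) UNIV UNIV \<phi>" by (auto simp: test_function_def)
      then obtain k where k: "\<And>x. GDERIV \<phi> x :> k x" "\<And>j. j \<in> Basis \<Longrightarrow> continuous_on UNIV (\<lambda>x. k x \<bullet> j)"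
        by auto
      have ck: "continuous_on UNIV k"
        using k(2) continuous_on_componentwise[of UNIV k] by blast
      have c\<phi>: "continuous_on UNIV \<phi>" 
        using k(1) gderiv_imp_isCont continuous_at_imp_continuous_on by blast
      have pd: "partial_deriv i \<phi> x = k x \<bullet> i" for x
      proof -
        have "((\<lambda>t. \<phi> (x + t *\<^sub>R i)) has_real_derivative k x \<bullet> i) (at 0)"
          by (rule gderiv_line) (simp add: k)
        then show ?thesis unfolding partial_deriv_def by (rule DERIV_imp_deriv)
      qed
      define Z where "Z = closure {x. \<phi> x \<noteq> 0}"
      have Z: "compact Z" "Z \<subseteq> \<Omega>" using \<phi> by (auto simp: test_function_def Z_def)
      have oZ: "open (- Z)" by (simp add: Z_def open_Compl)
      have Zout: "\<phi> x = 0" "k x = 0" if "x \<in> - Z" for x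
      proof -
        have z: "\<phi> y = 0" if "y \<in> - Z" for y
          using that closure_subset[of "{x. \<phi> x \<noteq> 0}"] unfolding Z_def by blast
        then show "\<phi> x = 0" using that .
        have "GDERIV \<phi> x :> 0"
          by (rule gderiv_transform_open[OF GDERIV_const[of 0] oZ that]) (simp add: z)
        then show "k x = 0" using GDERIV_unique k(1) by blast
      qed
      \<comment> \<open>Cut off outside \<open>\<Omega>\<close>, the product is continuously
        differentiable everywhere, since \<open>\<Omega>\<close> and the complement of the support
        of \<open>\<phi>\<close> are open and cover the space.\<close>
      define F where "F = (\<lambda>x. if x \<in> \<Omega> then v x * \<phi> x else 0)"
      define K where "K = (\<lambda>x. if x \<in> \<Omega> then v x *\<^sub>R k x + \<phi> x *\<^sub>R g x else 0)"
      have F0: "F x = 0" "K x = 0" if "x \<in> - Z" for x using Zout[OF that] by (auto simp: F_def K_def)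
      have U: "\<Omega> \<union> - Z = UNIV" using Z by auto
      have dF: "GDERIV F x :> K x" for x
      proof (cases "x \<in> \<Omega>")
        case True
        have "GDERIV F x :> v x *\<^sub>R k x + \<phi> x *\<^sub>R g x"
          by (rule gderiv_transform_open[OF GDERIV_mult[OF dv[OF True] k(1)] \<Omega>(1) True]) (simp add: F_def)
        then show ?thesis using True by (simp add: K_def)
      next
        case False
        then have "x \<in> - Z" using Z by auto
        then have "GDERIV F x :> 0"
          by (rule gderiv_transform_open[OF GDERIV_const[of 0] oZ]) (simp add: F0)
        then show ?thesis using False by (simp add: K_def)
      qed
      have cK: "continuous_on UNIV K"
        unfolding U[symmetric]
      proof (rule continuous_on_open_Un[OF \<Omega>(1) oZ])
        have "continuous_on \<Omega> (\<lambda>x. v x *\<^sub>R k x + \<phi> x *\<^sub>R g x)"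
          by (intro continuous_intros cv g continuous_on_subset[OF ck] continuous_on_subset[OF c\<phi>]) auto
        then show "continuous_on \<Omega> K" by (rule continuous_on_eq) (simp add: K_def)
        show "continuous_on (- Z) K" by (rule continuous_on_eq[of _ "\<lambda>_. 0"]) (auto simp: F0)
      qed
      have "(LINT x|lborel. K x \<bullet> i) = 0"
        by (rule integral_directional_derivative_zero[OF dF cK compact_imp_bounded[OF Z(1)]]) (simp add: F0)
      moreover have "(\<lambda>x. K x \<bullet> i) \<in> borel_measurable lborel"
        using cK by (auto intro!: borel_measurable_continuous_onI continuous_intros)
      ultimately have "(LINT x|lebesgue. K x \<bullet> i) = 0" by (simp add: integral_completion)
      moreover have "(\<lambda>x. K x \<bullet> i) = (\<lambda>x. if x \<in> \<Omega> then v x * (k x \<bullet> i) + \<phi> x * (g x \<bullet> i) else 0)"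
        by (auto simp: K_def inner_add_left)
      ultimately have z: "(LINT x|lebesgue_on \<Omega>. v x * (k x \<bullet> i) + \<phi> x * (g x \<bullet> i)) = 0"
        using Lebesgue_Measure.integral_restrict_UNIV[OF \<Omega>m, of "\<lambda>x. v x * (k x \<bullet> i) + \<phi> x * (g x \<bullet> i)"] by simp
      have bdZ: "\<exists>M. \<forall>x. norm (h x) \<le> M" if "continuous_on UNIV h" "\<And>x. x \<in> - Z \<Longrightarrow> h x = 0" for h :: "'a \<Rightarrow> 'b::real_normed_vector"
      proof -
        have "compact (h ` Z)"
          by (rule compact_continuous_image[OF continuous_on_subset[OF that(1)] Z(1)]) simp
        then obtain M where M: "\<forall>y\<in>h ` Z. norm y \<le> M"
          using compact_imp_bounded bounded_iff by metis
        have "norm (h x) \<le> max M 0" for x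
        proof (cases "x \<in> Z")
          case True then show ?thesis using M by (simp add: le_max_iff_disj)
        next
          case False then show ?thesis using that(2)[of x] by simp
        qed
        then show ?thesis by blast
      qed
      have integ: "integrable (lebesgue_on \<Omega>) (\<lambda>x. f x * h x)"
        if f: "continuous_on \<Omega> f" "\<And>x. x \<in> \<Omega> \<Longrightarrow> \<bar>f x\<bar> \<le> B"
          and h: "continuous_on UNIV h" "\<And>x. x \<in> - Z \<Longrightarrow> h x = 0" for f h :: "'a \<Rightarrow> real"
      proof -
        obtain M where M: "\<And>x. norm (h x) \<le> M" using bdZ[OF h] by blast
        have "continuous_on \<Omega> (\<lambda>x. f x * h x)"
          by (intro continuous_intros f continuous_on_subset[OF h(1)]) auto
        then have m: "(\<lambda>x. f x * h x) \<in> borel_measurable (lebesgue_on \<Omega>)"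
          by (rule continuous_imp_measurable_on_sets_lebesgue[OF _ \<Omega>m])
        have "norm (f x * h x) \<le> B * M" if "x \<in> \<Omega>" for x
          unfolding norm_mult using f(2)[OF that] M[of x] by (intro mult_mono) auto
        then show ?thesis
          using m by (intro integrable_const_bound[where B = "B * M"]) (auto intro!: AE_I2)
      qed
      have i1: "integrable (lebesgue_on \<Omega>) (\<lambda>x. v x * (k x \<bullet> i))"
        by (rule integ[OF cv bd(1)]) (auto intro!: continuous_intros ck simp: Zout)
      have i2: "integrable (lebesgue_on \<Omega>) (\<lambda>x. (g x \<bullet> i) * \<phi> x)"
      proof (rule integ)
        show "continuous_on \<Omega> (\<lambda>x. g x \<bullet> i)" using g by (intro continuous_intros)
        show "\<bar>g x \<bullet> i\<bar> \<le> B" if "x \<in> \<Omega>" for x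
          using Basis_le_norm[OF i, of "g x"] bd(2)[OF that] by linarith
      qed (auto simp: c\<phi> Zout)
      have "(LINT x|lebesgue_on \<Omega>. v x * (k x \<bullet> i)) + (LINT x|lebesgue_on \<Omega>. (g x \<bullet> i) * \<phi> x) = 0"
        using z i1 i2 by (subst Bochner_Integration.integral_add[symmetric]) (auto simp: mult.commute)
      then show "(LINT x|lebesgue_on \<Omega>. v x * partial_deriv i \<phi> x) = - (LINT x|lebesgue_on \<Omega>. (g x \<bullet> i) * \<phi> x)"
        unfolding pd by linarith
    qed
  qed
qed

text \<open>It suffices that \<open>u\<close> agree near the origin with some continuously
  differentiable function; in the moving plane argument this function is a reflected copy of
  \<open>u\<close>. Correcting the value at the origin then gives an element of
  \<open>H1\<close>.\<close>

lemma C1_extension_imp_removable: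
  fixes u :: "'a::euclidean_space \<Rightarrow> real"
  assumes \<Omega>: "open \<Omega>" "bounded \<Omega>" "0 \<in> \<Omega>"
    and u: "continuous_on (closure \<Omega> - {0}) u" and du: "\<And>x. x \<in> \<Omega> - {0} \<Longrightarrow> GDERIV u x :> g x"
    and g: "continuous_on (closure \<Omega> - {0}) g"
    and r: "0 < r" and U: "\<And>x. x \<in> ball 0 r \<Longrightarrow> GDERIV U x :> G x" "continuous_on (ball 0 r) G"
    and eq: "\<And>x. x \<in> ball 0 r - {0} \<Longrightarrow> u x = U x"
  shows "removable_singularity \<Omega> u"
proof -
  obtain r1 where r1: "0 < r1" "ball 0 r1 \<subseteq> \<Omega>" using \<Omega> open_contains_ball_eq by blast
  define \<rho> where "\<rho> = min r r1"
  have rho: "0 < \<rho>" "ball 0 \<rho> \<subseteq> \<Omega>" "ball 0 \<rho> \<subseteq> ball (0::'a) r"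
    using r r1 by (auto simp: \<rho>_def)
  define v where "v = (\<lambda>x. if x = 0 then U 0 else u x)"
  define h where "h = (\<lambda>x. if x = 0 then G 0 else g x)"
  have vU: "v x = U x" if "x \<in> ball 0 \<rho>" for x using eq[of x] that rho by (auto simp: v_def)
  have dvU: "GDERIV v x :> G x" if "x \<in> ball 0 \<rho>" for x
    by (rule gderiv_transform_open[OF U(1) open_ball that]) (use that rho vU in auto)
  have o: "open (\<Omega> - {0})" using \<Omega> by (simp add: open_delete)
  have dvu: "GDERIV v x :> g x" if "x \<in> \<Omega> - {0}" for x
    by (rule gderiv_transform_open[OF du[OF that] o that]) (simp add: v_def)
  have hG: "h x = G x" if "x \<in> ball 0 \<rho>" for x
  proof (cases "x = 0")
    case False
    then show ?thesis using GDERIV_unique[OF dvU[OF that] dvu[of x]] that rho by (auto simp: h_def)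
  qed (simp add: h_def)
  have dv: "GDERIV v x :> h x" if "x \<in> \<Omega>" for x
    using dvU[of x] dvu[of x] hG[of x] that rho(1) by (cases "x = 0") (auto simp: h_def)
  have Un: "\<Omega> = (\<Omega> - {0}) \<union> ball 0 \<rho>" using rho \<Omega> by auto
  have ch1: "continuous_on (closure \<Omega> - {0}) h" using g by (rule continuous_on_eq) (auto simp: h_def)
  have ch2: "continuous_on (ball 0 \<rho>) h"
    by (rule continuous_on_eq[OF continuous_on_subset[OF U(2) rho(3)]]) (simp add: hG)
  have cv1: "continuous_on (closure \<Omega> - {0}) v" using u by (rule continuous_on_eq) (auto simp: v_def)
  have cv2: "continuous_on (ball 0 \<rho>) v"
    using dvU gderiv_imp_isCont continuous_at_imp_continuous_on by blast
  have sub: "\<Omega> - {0} \<subseteq> closure \<Omega> - {0}" using closure_subset[of \<Omega>] by auto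
  have "continuous_on ((\<Omega> - {0}) \<union> ball 0 \<rho>) h"
    by (rule continuous_on_open_Un[OF o open_ball continuous_on_subset[OF ch1 sub] ch2])
  then have ch: "continuous_on \<Omega> h" using Un by simp
  \<comment> \<open>Two compact pieces cover the domain: one avoids the origin, the other lies in
    the ball where the extension is continuous.\<close>
  have bounded_image: "\<exists>M. \<forall>x\<in>\<Omega>. norm (f x) \<le> M"
    if f: "continuous_on (closure \<Omega> - {0}) f" "continuous_on (ball 0 \<rho>) f" for f :: "'a \<Rightarrow> 'b::real_normed_vector"
  proof -
    have "compact (closure \<Omega> - ball 0 (\<rho> / 2))" "compact (cball (0::'a) (\<rho> / 2))"
      using \<Omega> by (auto intro!: compact_diff)
    moreover have "continuous_on (closure \<Omega> - ball 0 (\<rho> / 2)) f"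
      by (rule continuous_on_subset[OF f(1)]) (use rho in auto)
    moreover have "continuous_on (cball 0 (\<rho> / 2)) f"
      by (rule continuous_on_subset[OF f(2)]) (use rho in auto)
    ultimately have "compact (f ` (closure \<Omega> - ball 0 (\<rho> / 2)) \<union> f ` cball 0 (\<rho> / 2))"
      by (intro compact_Un compact_continuous_image)
    then obtain M where M: "\<forall>y\<in>f ` (closure \<Omega> - ball 0 (\<rho> / 2)) \<union> f ` cball 0 (\<rho> / 2). norm y \<le> M"
      using compact_imp_bounded bounded_iff by metis
    have "norm (f x) \<le> M" if "x \<in> \<Omega>" for x
    proof (cases "x \<in> cball 0 (\<rho> / 2)")
      case True then show ?thesis using M by blast
    next
      case False
      then have "x \<in> closure \<Omega> - ball 0 (\<rho> / 2)" using that closure_subset[of \<Omega>] by auto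
      then show ?thesis using M by blast
    qed
    then show ?thesis by blast
  qed
  obtain M1 M2 where M: "\<And>x. x \<in> \<Omega> \<Longrightarrow> norm (v x) \<le> M1" "\<And>x. x \<in> \<Omega> \<Longrightarrow> norm (h x) \<le> M2"
    using bounded_image[OF cv1 cv2] bounded_image[OF ch1 ch2] by metis
  have "in_H1 \<Omega> v"
  proof (rule C1_imp_in_H1[OF \<Omega>(1,2) dv ch])
    show "\<bar>v x\<bar> \<le> max M1 M2" if "x \<in> \<Omega>" for x using M(1)[OF that] by auto
    show "norm (h x) \<le> max M1 M2" if "x \<in> \<Omega>" for x using M(2)[OF that] by auto
  qed
  moreover have "AE x in lebesgue_on \<Omega>. u x = v x"
  proof -
    have "AE x in lborel. x \<noteq> (0::'a)" by (rule AE_lborel_singleton)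
    then have "AE x in lebesgue. x \<noteq> (0::'a)" by (rule AE_completion)
    then have "AE x in lebesgue_on \<Omega>. x \<noteq> 0"
      using \<Omega>(1) by (subst AE_restrict_space_iff) (auto elim: eventually_mono)
    then show ?thesis by eventually_elim (simp add: v_def)
  qed
  ultimately show ?thesis unfolding removable_singularity_def by blast
qed

section \<open>The moving plane setting\<close>

text \<open>Here \<open>u\<close> is the solution extended by zero outside \<open>\<Omega>\<close>, so that domination of \<open>u\<close> by its
  reflection also encodes that the reflected cap lies in \<open>\<Omega>\<close>. The gradient \<open>g\<close> and the Hessian \<open>H\<close>
  are extended continuously to the boundary, and \<open>\<beta> = - \<alpha>\<close>.\<close>
locale singular_serrin =
  fixes \<Omega> :: "'a::euclidean_space set" and u :: "'a \<Rightarrow> real" and g :: "'a \<Rightarrow> 'a"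
    and H :: "'a \<Rightarrow> 'a \<Rightarrow> 'a" and \<nu> :: "'a \<Rightarrow> 'a" and f :: "real \<Rightarrow> real" and \<beta> :: real
  assumes dim: "2 \<le> DIM('a)"
    and dom: "open \<Omega>" "connected \<Omega>" "bounded \<Omega>" "0 \<in> \<Omega>"
    and normal: "\<And>x. x \<in> frontier \<Omega> \<Longrightarrow> norm (\<nu> x) = 1"
    and paraboloid: "\<And>x. x \<in> frontier \<Omega> \<Longrightarrow> \<exists>M>0. \<exists>r>0. \<forall>z. dist x z < r \<longrightarrow>
          ((z - x) \<bullet> \<nu> x < - M * (norm (z - x))\<^sup>2 \<longrightarrow> z \<in> \<Omega>) \<and>
          (M * (norm (z - x))\<^sup>2 < (z - x) \<bullet> \<nu> x \<longrightarrow> z \<notin> \<Omega>)"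
    and u_cont: "continuous_on (- {0}) u"
    and u_out: "\<And>x. x \<notin> \<Omega> \<Longrightarrow> u x = 0"
    and u_pos: "\<And>x. x \<in> \<Omega> - {0} \<Longrightarrow> 0 < u x"
    and du: "\<And>x. x \<in> \<Omega> - {0} \<Longrightarrow> GDERIV u x :> g x"
    and dg: "\<And>x. x \<in> \<Omega> - {0} \<Longrightarrow> (g has_derivative H x) (at x)"
    and g_cont: "continuous_on (closure \<Omega> - {0}) g"
    and H_cont: "\<And>v. continuous_on (closure \<Omega> - {0}) (\<lambda>x. H x v)"
    and H_lin: "\<And>x. x \<in> closure \<Omega> - {0} \<Longrightarrow> linear (H x)"
    and H_sym: "\<And>x v w. x \<in> closure \<Omega> - {0} \<Longrightarrow> H x v \<bullet> w = v \<bullet> H x w"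
    and eqn: "\<And>x. x \<in> \<Omega> - {0} \<Longrightarrow> (\<Sum>i\<in>Basis. H x i \<bullet> i) = - f (u x)"
    and lip: "\<And>B. \<exists>L\<ge>0. \<forall>s\<in>{0..B}. \<forall>t\<in>{0..B}. \<bar>f s - f t\<bar> \<le> L * \<bar>s - t\<bar>"
    and beta: "0 < \<beta>"
    and g_frontier: "\<And>x. x \<in> frontier \<Omega> \<Longrightarrow> g x = - \<beta> *\<^sub>R \<nu> x"
    and nonremovable: "\<And>r U G. 0 < r \<Longrightarrow> (\<And>x. x \<in> ball 0 r \<Longrightarrow> GDERIV U x :> G x) \<Longrightarrow>
          continuous_on (ball 0 r) G \<Longrightarrow> (\<And>x. x \<in> ball 0 r - {0} \<Longrightarrow> u x = U x) \<Longrightarrow> False"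
begin

section \<open>Elementary properties of the extended solution\<close>

lemma frontier_notin: "x \<in> frontier \<Omega> \<Longrightarrow> x \<notin> \<Omega>"
  using dom(1) by (simp add: frontier_def interior_open)

lemma frontier_closure: "x \<in> frontier \<Omega> \<Longrightarrow> x \<in> closure \<Omega>"
  by (simp add: frontier_def)

lemma frontierI: "x \<in> closure \<Omega> \<Longrightarrow> x \<notin> \<Omega> \<Longrightarrow> x \<in> frontier \<Omega>"
  using dom(1) by (simp add: frontier_def interior_open)

lemma frontier_nonzero: "x \<in> frontier \<Omega> \<Longrightarrow> x \<noteq> 0"
  using frontier_notin dom(4) by blast

lemma frontier_u: "x \<in> frontier \<Omega> \<Longrightarrow> u x = 0"
  using frontier_notin u_out by blast

lemma open_punctured: "open (\<Omega> - {0})"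
  using dom(1) by (rule open_delete)

lemma u_nonneg: "x \<noteq> 0 \<Longrightarrow> 0 \<le> u x"
  using u_pos[of x] u_out[of x] by (cases "x \<in> \<Omega>") auto

lemma u_pos_imp_in: "0 < u x \<Longrightarrow> x \<in> \<Omega>"
  using u_out[of x] by fastforce

lemma u_isCont: "x \<noteq> 0 \<Longrightarrow> isCont u x"
  using u_cont continuous_on_eq_continuous_at[of "- {0}" u] by (simp add: open_Compl)

text \<open>Away from the singularity \<open>u\<close> is bounded; such a bound fixes the range on
  which \<open>f\<close> has a Lipschitz constant.\<close>

lemma u_bounded:
  assumes "0 < \<delta>"
  obtains B where "0 < B" "\<And>x. \<delta> \<le> norm x \<Longrightarrow> u x \<le> B"
proof -
  have "compact (closure \<Omega> - ball 0 \<delta>)" using dom by (intro compact_diff) auto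
  moreover have "continuous_on (closure \<Omega> - ball 0 \<delta>) u"
    by (rule continuous_on_subset[OF u_cont]) (use assms in auto)
  ultimately have "compact (u ` (closure \<Omega> - ball 0 \<delta>))" by (intro compact_continuous_image)
  then obtain M where M: "\<forall>y\<in>u ` (closure \<Omega> - ball 0 \<delta>). norm y \<le> M"
    using compact_imp_bounded bounded_iff by metis
  have "u x \<le> max M 1" if "\<delta> \<le> norm x" for x
  proof (cases "x \<in> \<Omega>")
    case True
    then have "x \<in> closure \<Omega> - ball 0 \<delta>" using that closure_subset[of \<Omega>] by auto
    then have "norm (u x) \<le> M" using M by blast
    then show ?thesis by auto
  next
    case False then show ?thesis using u_out[of x] by simp
  qed
  then show ?thesis using that[of "max M 1"] by auto
qed

lemma lap_u: "x \<in> \<Omega> - {0} \<Longrightarrow> lap_at u x (- f (u x))"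
  unfolding lap_at_def
proof (intro exI conjI)
  assume x: "x \<in> \<Omega> - {0}"
  show "\<forall>\<^sub>F y in nhds x. GDERIV u y :> g y"
    using eventually_nhds_in_open[OF open_punctured x] by eventually_elim (rule du)
  show "(g has_derivative H x) (at x)" by (rule dg[OF x])
  show "- f (u x) = (\<Sum>i\<in>Basis. H x i \<bullet> i)" using eqn[OF x] by simp
qed

text \<open>The constant depends only on the bound \<open>B\<close>, hence is uniform in the plane.
  Both signs of the difference are provided: the strong maximum principle and Hopf barriers use one,
  the singular maximum principle the other.\<close>

lemma lap_comparison:
  obtains L where "0 \<le> L"
    "\<And>e t y. norm e = 1 \<Longrightarrow> y \<in> \<Omega> - {0} \<Longrightarrow> reflect e t y \<in> \<Omega> - {0} \<Longrightarrow> u y \<le> B \<Longrightarrow> u (reflect e t y) \<le> B \<Longrightarrow>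
       \<exists>l. \<bar>l\<bar> \<le> L * \<bar>u (reflect e t y) - u y\<bar> \<and> lap_at (\<lambda>y. u (reflect e t y) - u y) y l \<and>
           lap_at (\<lambda>y. u y - u (reflect e t y)) y (- l)"
proof -
  obtain L where L: "0 \<le> L" "\<And>s t. s \<in> {0..B} \<Longrightarrow> t \<in> {0..B} \<Longrightarrow> \<bar>f s - f t\<bar> \<le> L * \<bar>s - t\<bar>"
    using lip[of B] by blast
  show ?thesis
  proof (rule that[OF L(1)])
    fix e t y
    assume e: "norm e = 1" and y: "y \<in> \<Omega> - {0}" "reflect e t y \<in> \<Omega> - {0}" "u y \<le> B" "u (reflect e t y) \<le> B"
    have l1: "lap_at u y (- f (u y))" by (rule lap_u[OF y(1)])
    have l2: "lap_at (\<lambda>y. u (reflect e t y)) y (- f (u (reflect e t y)))"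
      by (rule lap_at_reflect[OF e lap_u[OF y(2)]])
    let ?l = "- f (u (reflect e t y)) - - f (u y)"
    have "lap_at (\<lambda>y. u (reflect e t y) - u y) y ?l" by (rule lap_at_diff[OF l2 l1])
    moreover have "lap_at (\<lambda>y. u y - u (reflect e t y)) y (- ?l)"
      using lap_at_diff[OF l1 l2] by (simp add: algebra_simps)
    moreover have "\<bar>?l\<bar> \<le> L * \<bar>u (reflect e t y) - u y\<bar>"
      using L(2)[of "u (reflect e t y)" "u y"] y u_pos[OF y(1)] u_pos[OF y(2)]
      by (simp add: abs_minus_commute)
    ultimately show "\<exists>l. \<bar>l\<bar> \<le> L * \<bar>u (reflect e t y) - u y\<bar> \<and> lap_at (\<lambda>y. u (reflect e t y) - u y) y l \<and>
           lap_at (\<lambda>y. u y - u (reflect e t y)) y (- l)" by blast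
  qed
qed

text \<open>The excluded point is the reflection of the singularity.\<close>
definition dominated :: "'a \<Rightarrow> real \<Rightarrow> bool" where
  "dominated e t \<longleftrightarrow> (\<forall>y. t < y \<bullet> e \<longrightarrow> y \<noteq> (2 * t) *\<^sub>R e \<longrightarrow> u y \<le> u (reflect e t y))"

lemma reflect_eq_0_iff: "norm e = 1 \<Longrightarrow> reflect e t y = 0 \<longleftrightarrow> y = (2 * t) *\<^sub>R e"
proof
  assume e: "norm e = 1" and "reflect e t y = 0"
  then have "y = reflect e t 0" by (metis reflect_reflect)
  then show "y = (2 * t) *\<^sub>R e" by (simp add: reflect_def)
next
  assume "norm e = 1" "y = (2 * t) *\<^sub>R e"
  moreover from this have "e \<bullet> e = 1" by (simp add: norm_eq_1)
  ultimately show "reflect e t y = 0" by (simp add: reflect_def)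
qed

text \<open>The segment cannot leave \<open>\<Omega>\<close>: at a first exit point \<open>u\<close> would vanish although it has
  increased from a positive value.\<close>
lemma increasing_along_segment:
  assumes B: "0 \<notin> ball x r" and p: "p \<in> \<Omega>" "p \<in> ball x r" "p + d \<in> ball x r"
    and inc: "\<And>y. y \<in> closure \<Omega> \<inter> ball x r \<Longrightarrow> 0 < g y \<bullet> d"
  shows "u p < u (p + d)"
proof -
  have seg: "p + s *\<^sub>R d \<in> ball x r" if "0 \<le> s" "s \<le> 1" for s
  proof -
    have "(1 - s) *\<^sub>R p + s *\<^sub>R (p + d) \<in> ball x r"
      using convexD_alt[OF convex_ball p(2,3) that] .
    then show ?thesis by (simp add: algebra_simps)
  qed
  have cont: "continuous_on {0..1} (\<lambda>s. u (p + s *\<^sub>R (k *\<^sub>R d)))" if "0 < k" "k \<le> 1" for k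
  proof (rule continuous_on_compose2[OF u_cont])
    show "continuous_on {0..1} (\<lambda>s. p + s *\<^sub>R k *\<^sub>R d)" by (intro continuous_intros)
    show "(\<lambda>s. p + s *\<^sub>R k *\<^sub>R d) ` {0..1} \<subseteq> - {0}"
    proof clarsimp
      fix s :: real assume s: "0 \<le> s" "s \<le> 1" "p + (s * k) *\<^sub>R d = 0"
      have "s * k \<le> 1" "0 \<le> s * k" using s that by (auto simp: mult_le_one)
      then show False using seg[of "s * k"] s(3) B by simp
    qed
  qed
  \<comment> \<open>Stated for initial pieces of the segment that stay in \<open>\<Omega>\<close>:
    with \<open>k\<close> a first exit time it gives the contradiction, with \<open>k = 1\<close>
    the claim.\<close>
  have grow: "u p < u (p + k *\<^sub>R d)" if k: "0 < k" "k \<le> 1" and ins: "\<And>s. 0 \<le> s \<Longrightarrow> s < k \<Longrightarrow> p + s *\<^sub>R d \<in> \<Omega>" for k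
  proof -
    have pt: "p + s *\<^sub>R (k *\<^sub>R d) \<in> \<Omega> \<inter> ball x r" if s: "0 < s" "s < 1" for s
    proof -
      have "s * k < 1 * k" using s k by (intro mult_strict_right_mono) auto
      moreover from this have "s * k \<le> 1" using k by linarith
      ultimately show ?thesis using ins[of "s * k"] seg[of "s * k"] s k by simp
    qed
    obtain s where s: "0 < s" "s < 1" "u (p + k *\<^sub>R d) - u p = g (p + s *\<^sub>R (k *\<^sub>R d)) \<bullet> (k *\<^sub>R d)"
    proof (rule gderiv_mvt[OF cont[OF k]])
      show "GDERIV u (p + s *\<^sub>R (k *\<^sub>R d)) :> g (p + s *\<^sub>R (k *\<^sub>R d))" if "0 < s" "s < 1" for s
        using pt[OF that] B by (intro du) auto
    qed blast
    have "0 < g (p + s *\<^sub>R (k *\<^sub>R d)) \<bullet> d"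
      using pt[OF s(1,2)] closure_subset[of \<Omega>] by (intro inc) auto
    then have "0 < k * (g (p + s *\<^sub>R (k *\<^sub>R d)) \<bullet> d)" using k by simp
    then show ?thesis using s(3) by simp
  qed
  have p0: "0 < u p" using p B by (intro u_pos) auto
  have stay: "p + k *\<^sub>R d \<in> \<Omega>" if k: "0 \<le> k" "k \<le> 1" for k
  proof (rule ccontr)
    assume out: "p + k *\<^sub>R d \<notin> \<Omega>"
    then obtain s where s: "0 < s" "s \<le> 1" "p + s *\<^sub>R (k *\<^sub>R d) \<in> frontier \<Omega>"
      "\<And>t. 0 \<le> t \<Longrightarrow> t < s \<Longrightarrow> p + t *\<^sub>R (k *\<^sub>R d) \<in> \<Omega>"
      using first_exit[OF dom(1) p(1)] by metis
    have "k \<noteq> 0" using out p by auto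
    then have k0: "0 < k" using k by simp
    have "u p < u (p + (s * k) *\<^sub>R d)"
    proof (rule grow)
      show "0 < s * k" "s * k \<le> 1" using s k k0 by (auto simp: mult_le_one)
      show "p + t *\<^sub>R d \<in> \<Omega>" if "0 \<le> t" "t < s * k" for t
        using s(4)[of "t / k"] that k0 by (simp add: field_simps)
    qed
    then show False using frontier_u[OF s(3)] p0 by simp
  qed
  show ?thesis using grow[of 1] stay by simp
qed

text \<open>For \<open>z\<close> in the ball, expanding the square of
  \<open>z - x + R *\<^sub>R \<nu> x\<close> gives \<open>2 * R * ((z - x) \<bullet> \<nu> x) \<le>
  - (norm (z - x))\<^sup>2\<close>, which lies inside the inner paraboloid as soon as
  \<open>2 * R * M < 1\<close>.\<close>

lemma interior_ball:
  assumes x: "x \<in> frontier \<Omega>" and S: "open S" "x \<in> S"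
  obtains R where "0 < R" "cball (x - R *\<^sub>R \<nu> x) R \<subseteq> S" "cball (x - R *\<^sub>R \<nu> x) R - {x} \<subseteq> \<Omega>"
proof -
  obtain M r where M: "0 < M" "0 < r"
    "\<And>z. dist x z < r \<Longrightarrow> (z - x) \<bullet> \<nu> x < - M * (norm (z - x))\<^sup>2 \<Longrightarrow> z \<in> \<Omega>"
    using paraboloid[OF x] by blast
  obtain s where s: "0 < s" "ball x s \<subseteq> S" using S open_contains_ball_eq by blast
  define m where "m = Min {r, s, 1 / M}"
  \<comment> \<open>The divisor 4 puts the diameter \<open>2 * R\<close> strictly below each of the
    three bounds.\<close>
  define R where "R = m / 4"
  have "0 < m" "m \<le> r" "m \<le> s" "m \<le> 1 / M" using M s by (auto simp: m_def)
  then have R: "0 < R" "2 * R < r" "2 * R < s" "2 * R < 1 / M" by (auto simp: R_def)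
  have nn: "\<nu> x \<bullet> \<nu> x = 1" using normal[OF x] by (simp add: norm_eq_1)
  have near: "dist x z \<le> 2 * R" if "z \<in> cball (x - R *\<^sub>R \<nu> x) R" for z
  proof -
    have "dist x (x - R *\<^sub>R \<nu> x) = R" using R normal[OF x] by (simp add: dist_norm)
    then show ?thesis using dist_triangle[of x z "x - R *\<^sub>R \<nu> x"] that by simp
  qed
  have "z \<in> \<Omega>" if z: "z \<in> cball (x - R *\<^sub>R \<nu> x) R" "z \<noteq> x" for z
  proof (rule M(3))
    show "dist x z < r" using near[OF z(1)] R by simp
    have "(norm (z - x + R *\<^sub>R \<nu> x))\<^sup>2 \<le> R\<^sup>2"
      using z(1) by (intro power_mono) (auto simp: dist_norm norm_minus_commute algebra_simps)
    moreover have "(norm (z - x + R *\<^sub>R \<nu> x))\<^sup>2 = (norm (z - x))\<^sup>2 + 2 * R * ((z - x) \<bullet> \<nu> x) + R\<^sup>2"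
      unfolding power2_norm_eq_inner inner_add_left inner_add_right
      by (simp add: nn inner_commute power2_eq_square)
    ultimately have 1: "2 * R * ((z - x) \<bullet> \<nu> x) \<le> - (norm (z - x))\<^sup>2" by linarith
    have "2 * R * M < 1" using R M by (simp add: pos_less_divide_eq)
    moreover have "0 < (norm (z - x))\<^sup>2" using z by simp
    ultimately have "(2 * R * M) * (norm (z - x))\<^sup>2 < 1 * (norm (z - x))\<^sup>2"
      by (intro mult_strict_right_mono)
    moreover have "2 * R * (- M * (norm (z - x))\<^sup>2) = - ((2 * R * M) * (norm (z - x))\<^sup>2)" by simp
    ultimately have "2 * R * ((z - x) \<bullet> \<nu> x) < 2 * R * (- M * (norm (z - x))\<^sup>2)" using 1 by linarith
    then show "(z - x) \<bullet> \<nu> x < - M * (norm (z - x))\<^sup>2"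
      by (rule mult_left_less_imp_less) (use R in simp)
  qed
  moreover have "cball (x - R *\<^sub>R \<nu> x) R \<subseteq> S"
  proof
    fix z assume "z \<in> cball (x - R *\<^sub>R \<nu> x) R"
    then have "z \<in> ball x s" using near[of z] R by simp
    then show "z \<in> S" using s by blast
  qed
  ultimately show ?thesis using that R by blast
qed

text \<open>The outer paraboloid provides points off the domain arbitrarily close to
  \<open>x\<close>. This later forces the reflected singularity into \<open>\<Omega>\<close> once a
  punctured neighbourhood of it is known to lie there.\<close>

lemma frontier_not_isolated:
  assumes x: "x \<in> frontier \<Omega>" and "0 < r"
  shows "\<not> ball x r - {x} \<subseteq> \<Omega>"
proof
  assume sub: "ball x r - {x} \<subseteq> \<Omega>"
  obtain M \<rho> where M: "0 < M" "0 < \<rho>"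
    "\<And>z. dist x z < \<rho> \<Longrightarrow> M * (norm (z - x))\<^sup>2 < (z - x) \<bullet> \<nu> x \<Longrightarrow> z \<notin> \<Omega>"
    using paraboloid[OF x] by blast
  define m where "m = Min {r, \<rho>, 1 / M}"
  define s where "s = m / 2"
  have "0 < m" "m \<le> r" "m \<le> \<rho>" "m \<le> 1 / M" using M assms(2) by (auto simp: m_def)
  then have s: "0 < s" "s < r" "s < \<rho>" "s < 1 / M" by (auto simp: s_def)
  have n1: "norm (\<nu> x) = 1" by (rule normal[OF x])
  have "x + s *\<^sub>R \<nu> x \<notin> \<Omega>"
  proof (rule M(3))
    show "dist x (x + s *\<^sub>R \<nu> x) < \<rho>" using s n1 by (simp add: dist_norm)
    have "M * s < 1" using s M by (simp add: pos_less_divide_eq mult.commute)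
    then have "(M * s) * s < 1 * s" using s by (intro mult_strict_right_mono)
    moreover have "\<nu> x \<bullet> \<nu> x = 1" using n1 by (simp add: norm_eq_1)
    ultimately show "M * (norm (x + s *\<^sub>R \<nu> x - x))\<^sup>2 < (x + s *\<^sub>R \<nu> x - x) \<bullet> \<nu> x"
      using n1 by (simp add: power2_eq_square)
  qed
  moreover have "x + s *\<^sub>R \<nu> x \<in> ball x r - {x}"
  proof -
    have "\<nu> x \<noteq> 0" using n1 by auto
    then show ?thesis using s n1 by (simp add: dist_norm)
  qed
  ultimately show False using sub by blast
qed

end

section \<open>Strict positivity in the cap\<close>

lemma isCont_reflect: "isCont (reflect e t) x"
  unfolding reflect_def by (intro continuous_intros)

lemma isCont_tendsto_nhds: "isCont h x \<Longrightarrow> (h \<longlongrightarrow> h x) (nhds x)"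
  by (simp add: isCont_def tendsto_at_iff_tendsto_nhds)

lemma half_min:
  fixes a b :: real
  assumes "0 < a" "0 < b"
  shows "0 < min a b / 2" "min a b / 2 < a" "min a b / 2 < b"
  using assms by (auto simp: min_def)

lemma open_eventually_nhds:
  assumes "\<And>x. x \<in> S \<Longrightarrow> \<forall>\<^sub>F y in nhds x. y \<in> S"
  shows "open S"
  unfolding open_subopen[of S]
proof
  fix x assume "x \<in> S"
  then obtain T where "open T" "x \<in> T" "\<forall>y\<in>T. y \<in> S"
    using assms unfolding eventually_nhds by blast
  then show "\<exists>T. open T \<and> x \<in> T \<and> T \<subseteq> S" by blast
qed

context singular_serrin
begin

lemma isCont_reflected:
  assumes "norm e = 1" "y \<noteq> (2 * t) *\<^sub>R e"
  shows "isCont (\<lambda>y. u (reflect e t y)) y"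
proof (rule isCont_o2[OF isCont_reflect])
  show "isCont u (reflect e t y)"
    using assms reflect_eq_0_iff by (intro u_isCont) auto
qed

lemma isCont_difference:
  assumes "norm e = 1" "y \<noteq> (2 * t) *\<^sub>R e" "y \<noteq> 0"
  shows "isCont (\<lambda>y. u (reflect e t y) - u y) y"
  by (intro continuous_diff isCont_reflected u_isCont assms)

text \<open>If the reflected difference vanished somewhere in the cap, a clopen argument in the connected
  set \<open>\<Omega> - {0, q}\<close>, with \<open>q\<close> the reflection of \<open>0\<close>, would make \<open>u\<close> symmetric about the plane; near \<open>0\<close> the solution would then be a
  smooth reflected copy of itself, contradicting nonremovability.\<close>
lemma strict_in_cap:
  assumes e: "norm e = 1" and t: "0 < t" and P: "dominated e t"
    and y0: "y0 \<in> \<Omega>" "t < y0 \<bullet> e" "y0 \<noteq> (2 * t) *\<^sub>R e"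
  shows "u y0 < u (reflect e t y0)"
proof (rule ccontr)
  assume contra: "\<not> u y0 < u (reflect e t y0)"
  define R where "R = reflect e t"
  define q where "q = (2 * t) *\<^sub>R e"
  define w where "w = (\<lambda>y. u (R y) - u y)"
  have ee: "e \<bullet> e = 1" using e by (simp add: norm_eq_1)
  have RR: "R (R y) = y" for y using e by (simp add: R_def)
  have Re: "R y \<bullet> e = 2 * t - y \<bullet> e" for y using e by (simp add: R_def reflect_inner)
  have R0: "R y = 0 \<longleftrightarrow> y = q" for y using e by (simp add: R_def q_def reflect_eq_0_iff)
  have Rd: "dist (R y) (R z) = dist y z" for y z using e by (simp add: R_def)
  have qe: "q \<bullet> e = 2 * t" by (simp add: q_def ee)
  \<comment> \<open>The open cap without the reflected singularity. Domination and positivity of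
    \<open>u\<close> put its mirror image into the punctured domain, so the equation holds on both
    sides.\<close>
  define A where "A = {y \<in> \<Omega>. t < y \<bullet> e \<and> y \<noteq> q}"
  have oA: "open A"
  proof -
    have "A = \<Omega> \<inter> {y. t < y \<bullet> e} \<inter> - {q}" by (auto simp: A_def)
    then show ?thesis
      using dom(1) by (auto intro!: open_Int open_Collect_less continuous_intros simp: open_Compl)
  qed
  have A: "y \<in> \<Omega> - {0} \<and> R y \<in> \<Omega> - {0} \<and> 0 \<le> w y" if "y \<in> A" for y
  proof -
    have y: "y \<in> \<Omega>" "t < y \<bullet> e" "y \<noteq> q" using that by (auto simp: A_def)
    then have "y \<noteq> 0" using t by auto
    moreover have le: "u y \<le> u (R y)" using P y unfolding dominated_def R_def q_def by blast
    moreover have "0 < u (R y)" using u_pos[of y] y calculation by simp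
    then have "R y \<in> \<Omega>" by (rule u_pos_imp_in)
    moreover have "R y \<noteq> 0" using R0 y by blast
    ultimately show ?thesis using y by (simp add: w_def)
  qed
  have wcont: "(w \<longlongrightarrow> w y) (nhds y)" if "y \<noteq> 0" "y \<noteq> q" for y
    unfolding w_def R_def using that e by (intro isCont_tendsto_nhds isCont_difference) (auto simp: q_def)
  define Z where "Z = {y \<in> A. w y = 0}"
  have Zloc: "\<exists>r>0. \<forall>z\<in>ball y r. z \<in> Z" if "y \<in> Z" for y
  proof -
    have y: "y \<in> A" "w y = 0" using that by (auto simp: Z_def)
    \<comment> \<open>Half of the smaller norm: near \<open>y\<close> both a point and its mirror
      image keep distance \<open>\<delta>\<close> from the singularity, where \<open>u\<close> is
      bounded and a Lipschitz constant is available.\<close>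
    define \<delta> where "\<delta> = min (norm y) (norm (R y)) / 2"
    have "0 < norm y" "0 < norm (R y)" using A[OF y(1)] by auto
    then have \<delta>: "0 < \<delta>" "\<delta> < norm y" "\<delta> < norm (R y)"
      unfolding \<delta>_def by (rule half_min)+
    obtain B where B: "0 < B" "\<And>x. \<delta> \<le> norm x \<Longrightarrow> u x \<le> B" using u_bounded[OF \<delta>(1)] by blast
    obtain L where L: "0 \<le> L"
      "\<And>e t y. norm e = 1 \<Longrightarrow> y \<in> \<Omega> - {0} \<Longrightarrow> reflect e t y \<in> \<Omega> - {0} \<Longrightarrow> u y \<le> B \<Longrightarrow> u (reflect e t y) \<le> B \<Longrightarrow>
       \<exists>l. \<bar>l\<bar> \<le> L * \<bar>u (reflect e t y) - u y\<bar> \<and> lap_at (\<lambda>y. u (reflect e t y) - u y) y l \<and>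
           lap_at (\<lambda>y. u y - u (reflect e t y)) y (- l)"
      using lap_comparison[of B] by blast
    define D where "D = A \<inter> {z. \<delta> < norm z} \<inter> {z. \<delta> < norm (R z)}"
    have oD: "open D" unfolding D_def R_def
      by (intro open_Int oA open_Collect_less continuous_intros)
    have yD: "y \<in> D" using y \<delta> by (simp add: D_def)
    obtain r where r: "0 < r" "\<And>z. z \<in> ball y r \<Longrightarrow> w z = 0"
    proof (rule strong_maximum_principle[where L = L and D = D and W = w and p = y])
      show "0 \<le> L" "open D" "y \<in> D" "w y = 0" by fact+
      show "0 \<le> w z" if "z \<in> D" for z using A that by (auto simp: D_def)
      show "\<exists>l\<le>L * w z. lap_at w z l" if "z \<in> D" for z
      proof -
        have z: "z \<in> A" "\<delta> \<le> norm z" "\<delta> \<le> norm (R z)" using that by (auto simp: D_def)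
        then obtain l where "\<bar>l\<bar> \<le> L * \<bar>w z\<bar>" "lap_at w z l"
          using L(2)[OF e, of z t] A[OF z(1)] B(2) unfolding w_def R_def by blast
        moreover have "\<bar>w z\<bar> = w z" using A[OF z(1)] by simp
        ultimately show ?thesis by (auto intro!: exI[of _ l])
      qed
    qed blast
    obtain r2 where r2: "0 < r2" "ball y r2 \<subseteq> A" using oA y(1) open_contains_ball_eq by blast
    have "\<forall>z\<in>ball y (min r r2). z \<in> Z" using r r2 by (auto simp: Z_def)
    then show ?thesis using r r2 by (intro exI[of _ "min r r2"]) auto
  qed
  \<comment> \<open>Deleting finitely many points keeps an open connected set connected because the
    dimension is at least two.\<close>
  define \<Omega>' where "\<Omega>' = \<Omega> - {0, q}"
  have o': "open \<Omega>'" unfolding \<Omega>'_def using dom(1) by (intro open_Diff) auto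
  have c': "connected \<Omega>'" unfolding \<Omega>'_def
    using connected_open_delete_finite[OF dom(1,2) dim, of "{0, q}"] by simp
  \<comment> \<open>\<open>K\<close> collects the zeros of \<open>w\<close> in the cap, their mirror
    images, and plane points that have zeros on their cap side. The plane needs this separate
    condition because \<open>w\<close> vanishes on it anyway.\<close>
  define K1 where "K1 = {y. R y \<in> Z}"
  define K2 where "K2 = {y \<in> \<Omega>'. y \<bullet> e = t \<and> (\<exists>r>0. \<forall>z\<in>ball y r. t < z \<bullet> e \<longrightarrow> z \<in> Z)}"
  define K where "K = Z \<union> K1 \<union> K2"
  have oZ: "open Z" unfolding open_contains_ball subset_iff using Zloc by blast
  have oK1: "open K1"
    unfolding open_contains_ball
  proof
    fix y assume "y \<in> K1"
    then obtain r where r: "0 < r" "\<forall>z\<in>ball (R y) r. z \<in> Z" using Zloc by (auto simp: K1_def)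
    have "ball y r \<subseteq> K1"
    proof
      fix z assume "z \<in> ball y r"
      then have "R z \<in> ball (R y) r" by (simp add: Rd)
      then show "z \<in> K1" using r by (simp add: K1_def)
    qed
    then show "\<exists>r>0. ball y r \<subseteq> K1" using r by blast
  qed
  have K2ball: "\<exists>r>0. ball y r \<subseteq> K" if yK2: "y \<in> K2" for y
  proof -
    obtain r where r: "0 < r" "\<And>z. z \<in> ball y r \<Longrightarrow> t < z \<bullet> e \<Longrightarrow> z \<in> Z" and y: "y \<in> \<Omega>'" "y \<bullet> e = t"
      using yK2 by (auto simp: K2_def)
    obtain r' where r': "0 < r'" "ball y r' \<subseteq> \<Omega>'" using o' y open_contains_ball_eq by blast
    define \<rho> where "\<rho> = min r r'"
    have Ry: "R y = y" using y(2) by (simp add: R_def reflect_fixed)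
    have "ball y \<rho> \<subseteq> K"
    proof
      fix z assume z: "z \<in> ball y \<rho>"
      consider "t < z \<bullet> e" | "z \<bullet> e < t" | "z \<bullet> e = t" by linarith
      then show "z \<in> K"
      proof cases
        case 1 then show ?thesis using r(2)[of z] z by (simp add: K_def \<rho>_def)
      next
        case 2
        have "R z \<in> ball y \<rho>" using z Rd[of y z] by (simp add: Ry)
        then have "R z \<in> Z" using r(2)[of "R z"] 2 by (simp add: \<rho>_def Re)
        then show ?thesis by (simp add: K_def K1_def)
      next
        case 3
        have "x \<in> Z" if "x \<in> ball z (\<rho> - dist y z)" "t < x \<bullet> e" for x
        proof -
          have "dist y x < \<rho>" using that dist_triangle[of y x z] by simp
          then show ?thesis using r(2)[of x] that by (simp add: \<rho>_def)
        qed
        moreover have "0 < \<rho> - dist y z" using z by simp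
        moreover have "z \<in> \<Omega>'" using z r' by (auto simp: \<rho>_def)
        ultimately have "z \<in> K2" using 3 unfolding K2_def by blast
        then show ?thesis by (simp add: K_def)
      qed
    qed
    moreover have "0 < \<rho>" using r r' by (simp add: \<rho>_def)
    ultimately show ?thesis by blast
  qed
  have oK: "open K"
    unfolding open_contains_ball
  proof
    fix y assume "y \<in> K"
    then consider "y \<in> Z" | "y \<in> K1" | "y \<in> K2" by (auto simp: K_def)
    then show "\<exists>r>0. ball y r \<subseteq> K"
    proof cases
      case 1 then show ?thesis using oZ unfolding open_contains_ball K_def by blast
    next
      case 2 then show ?thesis using oK1 unfolding open_contains_ball K_def by blast
    next
      case 3 then show ?thesis by (rule K2ball)
    qed
  qed
  define V where "V = {y \<in> A. w y \<noteq> 0}"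
  have oV: "open V"
  proof (rule open_eventually_nhds)
    fix y assume "y \<in> V"
    then have y: "y \<in> A" "w y \<noteq> 0" by (auto simp: V_def)
    have "y \<noteq> 0" "y \<noteq> q" using A[OF y(1)] y(1) by (auto simp: A_def)
    then have "\<forall>\<^sub>F z in nhds y. w z \<noteq> 0" using wcont y(2) tendsto_imp_eventually_ne by blast
    with eventually_nhds_in_open[OF oA y(1)] show "\<forall>\<^sub>F z in nhds y. z \<in> V"
      by eventually_elim (simp add: V_def)
  qed
  have oK': "open (\<Omega>' - K)"
  proof (rule open_eventually_nhds)
    fix y assume "y \<in> \<Omega>' - K"
    then have y: "y \<in> \<Omega>'" "y \<notin> K" "y \<in> \<Omega>" "y \<noteq> 0" "y \<noteq> q" by (auto simp: \<Omega>'_def)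
    have in': "\<forall>\<^sub>F z in nhds y. z \<in> \<Omega>'" by (rule eventually_nhds_in_open[OF o' y(1)])
    consider "t < y \<bullet> e" | "y \<bullet> e < t" | "y \<bullet> e = t" by linarith
    then show "\<forall>\<^sub>F z in nhds y. z \<in> \<Omega>' - K"
    proof cases
      case 1
      then have "y \<in> V" using y by (auto simp: V_def A_def K_def Z_def)
      from in' eventually_nhds_in_open[OF oV this] show ?thesis
      proof eventually_elim
        case (elim z)
        then have z: "t < z \<bullet> e" "w z \<noteq> 0" by (auto simp: V_def A_def)
        then have "z \<notin> Z" "z \<notin> K2" by (auto simp: Z_def K2_def)
        moreover have "z \<notin> K1" using z by (auto simp: K1_def Z_def A_def Re)
        ultimately show ?case using elim by (simp add: K_def)
      qed
    next
      case 2
      have Ry: "t < R y \<bullet> e" "R y \<noteq> q" using 2 R0[of "R y"] y by (auto simp: Re RR)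
      \<comment> \<open>Below the plane domination is read at the mirror image and gives
        \<open>w y \<le> 0\<close>; equality would place \<open>R y\<close> in \<open>Z\<close> and
        hence \<open>y\<close> in \<open>K1\<close>.\<close>
      have le: "u (R y) \<le> u y"
        using P Ry e unfolding dominated_def R_def q_def by (metis reflect_reflect)
      have "w y < 0"
      proof (rule ccontr)
        assume "\<not> w y < 0"
        then have eq: "u (R y) = u y" using le by (simp add: w_def)
        moreover have "0 < u y" using u_pos y by blast
        ultimately have "R y \<in> \<Omega>" using u_pos_imp_in by metis
        then have "R y \<in> Z" using Ry eq by (simp add: Z_def A_def w_def RR)
        then show False using y(2) by (simp add: K_def K1_def)
      qed
      then have "\<forall>\<^sub>F z in nhds y. w z < 0" using order_tendstoD(2)[OF wcont[OF y(4,5)]] by blast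
      moreover have "open {z. z \<bullet> e < t}" by (intro open_Collect_less continuous_intros)
      then have "\<forall>\<^sub>F z in nhds y. z \<in> {z. z \<bullet> e < t}" using 2 by (intro eventually_nhds_in_open) auto
      ultimately show ?thesis using in'
      proof eventually_elim
        case (elim z)
        then have "z \<notin> Z" "z \<notin> K2" by (auto simp: Z_def K2_def A_def)
        moreover have "z \<notin> K1" using elim by (auto simp: K1_def Z_def w_def RR)
        ultimately show ?case using elim by (simp add: K_def)
      qed
    next
      case 3
      obtain r where r: "0 < r" "ball y r \<subseteq> \<Omega>'" using o' y open_contains_ball_eq by blast
      \<comment> \<open>The half ball is connected and split by the open sets \<open>Z\<close> and
        \<open>V\<close>, so it lies in one of them. It cannot lie in \<open>Z\<close>, for then
        \<open>y\<close> would be in \<open>K2\<close>.\<close>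
      define HB where "HB = ball y r \<inter> {z. t < z \<bullet> e}"
      have "convex {z. t < z \<bullet> e}" using convex_halfspace_gt[of t e] by (simp add: inner_commute)
      then have "connected HB" unfolding HB_def by (intro convex_connected convex_Int convex_ball)
      moreover have "HB \<subseteq> A" using r by (auto simp: HB_def A_def \<Omega>'_def)
      then have "HB \<subseteq> Z \<union> V" by (auto simp: Z_def V_def)
      moreover have "Z \<inter> V \<inter> HB = {}" by (auto simp: Z_def V_def)
      ultimately have "Z \<inter> HB = {} \<or> V \<inter> HB = {}" using oZ oV connectedD by blast
      moreover have "V \<inter> HB \<noteq> {}"
      proof
        assume "V \<inter> HB = {}"
        then have "HB \<subseteq> Z" using \<open>HB \<subseteq> Z \<union> V\<close> by blast
        then have "y \<in> K2" using y 3 r unfolding K2_def HB_def by blast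
        then show False using y by (simp add: K_def)
      qed
      ultimately have ZHB: "Z \<inter> HB = {}" by blast
      have Ry: "R y = y" using 3 by (simp add: R_def reflect_fixed)
      have "z \<in> \<Omega>' - K" if z: "z \<in> ball y r" for z
      proof -
        have nZ: "x \<notin> Z" if "x \<in> ball y r" for x
          using ZHB that by (auto simp: HB_def Z_def A_def)
        have "R z \<in> ball y r" using z Rd[of y z] by (simp add: Ry)
        then have "z \<notin> K1" using nZ by (simp add: K1_def)
        moreover have "z \<notin> K2"
        proof
          assume "z \<in> K2"
          then obtain r2 where r2: "0 < r2" "\<And>x. x \<in> ball z r2 \<Longrightarrow> t < x \<bullet> e \<Longrightarrow> x \<in> Z" "z \<bullet> e = t"
            by (auto simp: K2_def)
          \<comment> \<open>A plane point of \<open>K2\<close> near \<open>y\<close> would, moved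
            slightly along \<open>e\<close>, yield a zero inside the half ball.\<close>
          define s where "s = min r2 (r - dist y z) / 2"
          have s: "0 < s" "s < r2" "s < r - dist y z" using r2 z by (auto simp: s_def)
          have ds: "dist z (z + s *\<^sub>R e) = s" using s e by (simp add: dist_norm)
          then have "z + s *\<^sub>R e \<in> Z" using s r2 by (intro r2(2)) (auto simp: inner_add_left ee)
          moreover have "z + s *\<^sub>R e \<in> ball y r"
            using dist_triangle[of y "z + s *\<^sub>R e" z] ds s by simp
          ultimately show False using nZ by blast
        qed
        ultimately show ?thesis using nZ[OF z] z r by (auto simp: K_def)
      qed
      then have "\<forall>z\<in>ball y r. z \<in> \<Omega>' - K" by blast
      then show ?thesis using r(1) unfolding eventually_nhds
        by (intro exI[of _ "ball y r"]) auto
    qed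
  qed
  have y0Z: "y0 \<in> Z"
  proof -
    have "y0 \<in> A" using y0 by (simp add: A_def q_def)
    then show ?thesis using A[of y0] contra by (simp add: Z_def w_def R_def)
  qed
  have "y0 \<in> K \<inter> \<Omega>'" using y0Z A[of y0] y0(3) by (auto simp: K_def \<Omega>'_def Z_def q_def)
  moreover have "K \<inter> \<Omega>' = {} \<or> (\<Omega>' - K) \<inter> \<Omega>' = {}"
    by (rule connectedD[OF c' oK oK']) auto
  ultimately have sub: "\<Omega>' \<subseteq> K" by auto
  obtain r where r: "0 < r" "ball 0 r \<subseteq> \<Omega> \<inter> {z. z \<bullet> e < t}"
  proof -
    have "open (\<Omega> \<inter> {z. z \<bullet> e < t})" using dom(1) by (intro open_Int open_Collect_less continuous_intros)
    moreover have "0 \<in> \<Omega> \<inter> {z. z \<bullet> e < t}" using dom(4) t by simp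
    ultimately show ?thesis using that open_contains_ball_eq by blast
  qed
  have sym: "R z \<in> Z" if "z \<in> ball 0 r - {0}" for z
  proof -
    have ze: "z \<in> \<Omega>" "z \<bullet> e < t" using that r by auto
    then have "z \<in> \<Omega>'" using that qe t by (auto simp: \<Omega>'_def)
    then have "z \<in> K" using sub by blast
    then show ?thesis using ze by (auto simp: K_def K1_def K2_def Z_def A_def)
  qed
  have Rq: "R 0 = q" using R0[of "R 0"] by (simp add: RR)
  have ballq: "ball q r - {q} \<subseteq> \<Omega>"
  proof
    fix z assume z: "z \<in> ball q r - {q}"
    have "R z \<in> ball 0 r" using z Rd[of 0 "R z"] by (simp add: RR Rq dist_commute)
    moreover have "R z \<noteq> 0" using z R0 by blast
    ultimately have "R (R z) \<in> Z" using sym by blast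
    then show "z \<in> \<Omega>" by (simp add: RR Z_def A_def)
  qed
  \<comment> \<open>Otherwise \<open>q\<close> would be an isolated frontier point.\<close>
  have q\<Omega>: "q \<in> \<Omega>"
  proof (rule ccontr)
    assume nq: "q \<notin> \<Omega>"
    have "q \<in> closure \<Omega>"
      unfolding closure_approachable
    proof (intro allI impI)
      fix \<epsilon> :: real assume "0 < \<epsilon>"
      define s where "s = min \<epsilon> r / 2"
      have s: "0 < s" "s < \<epsilon>" "s < r" using \<open>0 < \<epsilon>\<close> r by (auto simp: s_def)
      have "e \<noteq> 0" using e by auto
      then have "q + s *\<^sub>R e \<in> ball q r - {q}" using s e by (simp add: dist_norm)
      then have "q + s *\<^sub>R e \<in> \<Omega>" using ballq by blast
      then show "\<exists>y\<in>\<Omega>. dist y q < \<epsilon>" using s e by (intro bexI[of _ "q + s *\<^sub>R e"]) (auto simp: dist_norm)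
    qed
    then have "q \<in> frontier \<Omega>" using nq by (rule frontierI)
    then show False using frontier_not_isolated[OF _ r(1)] ballq by blast
  qed
  have Rball: "R z \<in> \<Omega> - {0}" if "z \<in> ball 0 r" for z
  proof -
    have "R z \<in> ball q r" using that Rd[of 0 z] by (simp add: Rq)
    then have "R z \<in> \<Omega>" using ballq q\<Omega> by blast
    moreover have "R z \<noteq> 0"
    proof
      assume "R z = 0"
      then have "z = q" using R0 by blast
      then show False using that r qe t by auto
    qed
    ultimately show ?thesis by simp
  qed
  \<comment> \<open>Near the origin \<open>u\<close> equals \<open>u\<close> composed with the
    reflection, which only sees values near \<open>q\<close>, where \<open>u\<close> is
    differentiable with continuous gradient.\<close>
  show False
  proof (rule nonremovable[OF r(1)])
    show "GDERIV (\<lambda>z. u (R z)) z :> reflect e 0 (g (R z))" if "z \<in> ball 0 r" for z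
      unfolding R_def by (rule gderiv_reflect) (use Rball[OF that] in \<open>auto intro!: du simp: R_def\<close>)
    show "continuous_on (ball 0 r) (\<lambda>z. reflect e 0 (g (R z)))"
    proof (rule continuous_on_reflect, rule continuous_on_compose2[OF g_cont])
      show "continuous_on (ball 0 r) R" unfolding R_def by (intro continuous_intros)
      show "R ` ball 0 r \<subseteq> closure \<Omega> - {0}"
      proof (rule image_subsetI)
        fix z :: 'a assume "z \<in> ball 0 r"
        then have "R z \<in> \<Omega> - {0}" by (rule Rball)
        then show "R z \<in> closure \<Omega> - {0}" using closure_subset[of \<Omega>] by auto
      qed
    qed
    show "u z = u (R z)" if "z \<in> ball 0 r - {0}" for z
      using sym[OF that] by (simp add: Z_def w_def RR)
  qed
qed

end

text \<open>Two uses of the mean value theorem. At 0 only continuity is assumed, because in the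
  corner expansion this parameter is a frontier point.\<close>

lemma small_second_derivative_imp_small:
  fixes \<psi> \<psi>' \<psi>'' :: "real \<Rightarrow> real"
  assumes c: "continuous_on {0..d} \<psi>" "continuous_on {0..d} \<psi>'"
    and d1: "\<And>s. 0 < s \<Longrightarrow> s < d \<Longrightarrow> (\<psi> has_real_derivative \<psi>' s) (at s)"
    and d2: "\<And>s. 0 < s \<Longrightarrow> s < d \<Longrightarrow> (\<psi>' has_real_derivative \<psi>'' s) (at s)"
    and z: "\<psi> 0 = 0" "\<psi>' 0 = 0"
    and b: "\<And>s. 0 < s \<Longrightarrow> s < d \<Longrightarrow> \<bar>\<psi>'' s\<bar> \<le> \<epsilon>"
    and s: "0 < s" "s < d"
  shows "\<bar>\<psi> s\<bar> \<le> \<epsilon> * s\<^sup>2"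
proof -
  have mv: "\<exists>z. 0 < z \<and> z < x \<and> h x - h 0 = x * h' z"
    if "0 < x" "x < d" "continuous_on {0..d} h"
      and hd: "\<And>s. 0 < s \<Longrightarrow> s < d \<Longrightarrow> (h has_real_derivative h' s) (at s)" for x h h'
  proof -
    have "\<exists>l z. 0 < z \<and> z < x \<and> (h has_real_derivative l) (at z) \<and> h x - h 0 = (x - 0) * l"
    proof (rule MVT)
      show "continuous_on {0..x} h" by (rule continuous_on_subset[OF \<open>continuous_on {0..d} h\<close>]) (use \<open>x < d\<close> in auto)
      show "h differentiable (at y)" if "0 < y" "y < x" for y
        using that \<open>x < d\<close> hd[of y] unfolding real_differentiable_def by auto
    qed (rule \<open>0 < x\<close>)
    then obtain l z where z: "0 < z" "z < x" "(h has_real_derivative l) (at z)" "h x - h 0 = (x - 0) * l"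
      by blast
    moreover have "l = h' z" by (rule DERIV_unique[OF z(3)]) (use z \<open>x < d\<close> hd[of z] in auto)
    ultimately show ?thesis by auto
  qed
  obtain z1 where z1: "0 < z1" "z1 < s" "\<psi> s - \<psi> 0 = s * \<psi>' z1"
    using mv[OF s c(1) d1] by blast
  obtain z2 where z2: "0 < z2" "z2 < z1" "\<psi>' z1 - \<psi>' 0 = z1 * \<psi>'' z2"
    using mv[OF z1(1) less_trans[OF z1(2) s(2)] c(2) d2] by blast
  have e0: "0 \<le> \<epsilon>" using b[OF s] by linarith
  have "\<bar>\<psi> s\<bar> = s * (z1 * \<bar>\<psi>'' z2\<bar>)" using z1 z2 z s by (simp add: abs_mult)
  also have "\<dots> \<le> s * (s * \<epsilon>)"
    using z1 z2 s b[of z2] e0 by (intro mult_left_mono mult_mono) auto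
  finally show ?thesis by (simp add: power2_eq_square mult_ac)
qed

section \<open>Hopf arguments on the frontier and on the plane\<close>

context singular_serrin
begin

lemma g_close:
  assumes "x \<in> closure \<Omega> - {0}" "0 < \<epsilon>"
  obtains d where "0 < d" "\<And>z. z \<in> closure \<Omega> - {0} \<Longrightarrow> dist z x < d \<Longrightarrow> norm (g z - g x) < \<epsilon>"
  using g_cont assms unfolding continuous_on_iff dist_norm by meson

text \<open>On a closed set missing the reflected singularity both functions are bounded in the cap,
  so a single \<open>L\<close> works for all barriers there. Strict positivity removes the absolute
  values from the Lipschitz estimate.\<close>

lemma cap_supersolution:
  assumes e: "norm e = 1" and t: "0 < t" and P: "dominated e t"
    and C: "closed C" "(2 * t) *\<^sub>R e \<notin> C"
  obtains L where "0 \<le> L" "\<And>z. z \<in> C \<Longrightarrow> z \<in> \<Omega> \<Longrightarrow> t < z \<bullet> e \<Longrightarrow>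
      \<exists>l\<le>L * (u (reflect e t z) - u z). lap_at (\<lambda>y. u (reflect e t y) - u y) z l"
proof -
  define q where "q = (2 * t) *\<^sub>R e"
  obtain d where d: "0 < d" "ball q d \<subseteq> - C" 
    using C open_contains_ball_eq[of "- C" q] by (auto simp: q_def)
  \<comment> \<open>In the cap a point has norm above \<open>t\<close>; and the norm of its mirror
    image is its distance to \<open>q\<close>, at least \<open>d\<close> on
    \<open>C\<close>.\<close>
  define \<delta> where "\<delta> = min t d"
  have \<delta>: "0 < \<delta>" using t d by (simp add: \<delta>_def)
  obtain B where B: "0 < B" "\<And>x. \<delta> \<le> norm x \<Longrightarrow> u x \<le> B" using u_bounded[OF \<delta>] by blast
  obtain L where L: "0 \<le> L"
      "\<And>e t y. norm e = 1 \<Longrightarrow> y \<in> \<Omega> - {0} \<Longrightarrow> reflect e t y \<in> \<Omega> - {0} \<Longrightarrow> u y \<le> B \<Longrightarrow> u (reflect e t y) \<le> B \<Longrightarrow>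
       \<exists>l. \<bar>l\<bar> \<le> L * \<bar>u (reflect e t y) - u y\<bar> \<and> lap_at (\<lambda>y. u (reflect e t y) - u y) y l \<and>
           lap_at (\<lambda>y. u y - u (reflect e t y)) y (- l)"
    using lap_comparison[of B] by blast
  show ?thesis
  proof (rule that[OF L(1)])
    fix z assume z: "z \<in> C" "z \<in> \<Omega>" "t < z \<bullet> e"
    have zq: "z \<noteq> q" using z C by (auto simp: q_def)
    have z0: "z \<noteq> 0" using z t by auto
    have lt: "u z < u (reflect e t z)" using strict_in_cap[OF e t P z(2,3)] zq by (simp add: q_def)
    have "0 < u z" using u_pos z z0 by blast
    then have R: "reflect e t z \<in> \<Omega> - {0}"
      using lt u_pos_imp_in[of "reflect e t z"] reflect_eq_0_iff[OF e, of t z] zq by (simp add: q_def)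
    have "z \<bullet> e \<le> norm z * norm e" by (rule norm_cauchy_schwarz)
    then have n1: "\<delta> \<le> norm z" using z e by (simp add: \<delta>_def)
    have "reflect e t q = 0" using reflect_eq_0_iff[OF e] by (simp add: q_def)
    then have "norm (reflect e t z) = dist z q"
      using dist_reflect[OF e, of t z q] by (simp add: dist_norm)
    moreover have "d \<le> dist z q" using d z by (force simp: dist_commute)
    ultimately have n2: "\<delta> \<le> norm (reflect e t z)" by (simp add: \<delta>_def)
    obtain l where "\<bar>l\<bar> \<le> L * \<bar>u (reflect e t z) - u z\<bar>" "lap_at (\<lambda>y. u (reflect e t y) - u y) z l"
      using L(2)[OF e, of z t] z z0 R B(2)[OF n1] B(2)[OF n2] by blast
    then show "\<exists>l\<le>L * (u (reflect e t z) - u z). lap_at (\<lambda>y. u (reflect e t y) - u y) z l"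
      using lt by (intro exI[of _ l]) auto
  qed
qed

text \<open>By Hopf's lemma the normal slopes of \<open>u\<close> and of its reflection at a common boundary zero
  would differ, although both gradients have norm \<open>\<beta>\<close> there.\<close>
lemma strict_on_frontier:
  assumes e: "norm e = 1" and t: "0 < t" and P: "dominated e t"
    and y: "y \<in> frontier \<Omega>" "t < y \<bullet> e" "y \<noteq> (2 * t) *\<^sub>R e"
  shows "0 < u (reflect e t y)"
proof (rule ccontr)
  assume "\<not> 0 < u (reflect e t y)"
  define R where "R = reflect e t"
  define q where "q = (2 * t) *\<^sub>R e"
  have RR: "R (R y) = y" for y using e by (simp add: R_def)
  have R0: "R y = 0 \<longleftrightarrow> y = q" for y using e by (simp add: R_def q_def reflect_eq_0_iff)
  have Rd: "dist (R y) (R z) = dist y z" for y z using e by (simp add: R_def)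
  define n where "n = \<nu> y"
  have n1: "norm n = 1" "n \<bullet> n = 1" using normal[OF y(1)] by (auto simp: n_def norm_eq_1)
  have Ry0: "R y \<noteq> 0" using R0 y by (simp add: q_def)
  have uRy: "u (R y) = 0"
    using \<open>\<not> 0 < u (reflect e t y)\<close> u_nonneg[OF Ry0] by (simp add: R_def)
  have Ryout: "R y \<notin> \<Omega>" using u_pos[of "R y"] uRy Ry0 by auto
  define S where "S = {z. t < z \<bullet> e} \<inter> - {q}"
  have oS: "open S" unfolding S_def by (intro open_Int open_Collect_less continuous_intros)
  have yS: "y \<in> S" using y by (simp add: S_def q_def)
  obtain \<rho> where \<rho>: "0 < \<rho>" "cball (y - \<rho> *\<^sub>R n) \<rho> \<subseteq> S" "cball (y - \<rho> *\<^sub>R n) \<rho> - {y} \<subseteq> \<Omega>"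
    using interior_ball[OF y(1) oS yS] unfolding n_def by metis
  define c where "c = y - \<rho> *\<^sub>R n"
  define w where "w = (\<lambda>y. u (R y) - u y)"
  have dcy: "dist c y = \<rho>" using \<rho> n1 by (simp add: c_def dist_norm)
  have S0: "z \<noteq> 0 \<and> z \<noteq> q \<and> t < z \<bullet> e" if "z \<in> S" for z using that t by (auto simp: S_def)
  have in\<Omega>: "z \<in> \<Omega> \<and> z \<in> S" if "z \<in> ball c \<rho>" for z
  proof -
    have "z \<in> cball c \<rho>" "z \<noteq> y" using that dcy by auto
    then show ?thesis using \<rho> unfolding c_def[symmetric] by blast
  qed
  have wpos: "0 < w z" if "z \<in> ball c \<rho>" for z
    using strict_in_cap[OF e t P, of z] in\<Omega>[OF that] S0[of z] by (simp add: w_def R_def q_def)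
  have qC: "(2 * t) *\<^sub>R e \<notin> cball c \<rho>" using \<rho>(2) by (auto simp: S_def q_def c_def)
  obtain L where L: "0 \<le> L" "\<And>z. z \<in> cball c \<rho> \<Longrightarrow> z \<in> \<Omega> \<Longrightarrow> t < z \<bullet> e \<Longrightarrow> \<exists>l\<le>L * w z. lap_at w z l"
    using cap_supersolution[OF e t P closed_cball qC] unfolding w_def R_def by metis
  obtain \<epsilon> where eps: "0 < \<epsilon>"
    "\<And>z. \<rho> / 2 \<le> dist c z \<Longrightarrow> dist c z \<le> \<rho> \<Longrightarrow> \<epsilon> * (\<rho> - dist c z) \<le> w z"
  proof (rule hopf_barrier[where c = c and R = \<rho> and L = L and W = w])
    show "0 < \<rho>" "0 \<le> L" by fact+
    show "continuous_on (cball c \<rho>) w"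
    proof (rule continuous_at_imp_continuous_on, rule ballI)
      fix z assume "z \<in> cball c \<rho>"
      then have "z \<in> S" using \<rho>(2) by (auto simp: c_def)
      then show "isCont w z" unfolding w_def R_def
        using S0[of z] by (intro isCont_difference e) (auto simp: q_def)
    qed
    show "0 < w z" if "z \<in> ball c \<rho>" for z using wpos[OF that] .
    show "\<exists>l\<le>L * w z. lap_at w z l" if "z \<in> ball c \<rho>" for z
      using L(2)[of z] in\<Omega>[OF that] S0[of z] that by auto
  qed blast
  define p where "p = (\<lambda>s. y + s *\<^sub>R (- n))"
  have dcp: "dist c (p s) = \<rho> - s" if "0 \<le> s" "s \<le> \<rho>" for s
  proof -
    have "c - p s = (s - \<rho>) *\<^sub>R n" by (simp add: c_def p_def algebra_simps)
    then show ?thesis using n1 that by (simp add: dist_norm)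
  qed
  have pin: "p s \<in> ball c \<rho>" if "0 < s" "s \<le> \<rho>" for s using dcp[of s] that by simp
  have Rin: "R z \<in> \<Omega> - {0}" if "z \<in> ball c \<rho>" for z
  proof -
    have "0 < u z" using in\<Omega>[OF that] S0[of z] u_pos[of z] by blast
    then have "0 < u (R z)" using wpos[OF that] by (simp add: w_def)
    then show ?thesis using u_pos_imp_in R0[of z] in\<Omega>[OF that] S0[of z] by blast
  qed
  define n' where "n' = reflect e 0 n"
  have Rp: "R (p s) = R y + s *\<^sub>R (- n')" for s
    by (simp add: R_def p_def n'_def reflect_def inner_diff_left algebra_simps)
  have nn': "norm n' = 1" using n1 e by (simp add: n'_def)
  have "R y \<in> closure \<Omega>"
    unfolding closure_approachable
  proof (intro allI impI)
    fix d :: real assume "0 < d"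
    define s where "s = min d \<rho> / 2"
    have s: "0 < s" "s < d" "s < \<rho>" unfolding s_def by (rule half_min; fact)+
    have "R (p s) \<in> \<Omega>" using Rin[OF pin[of s]] s by simp
    moreover have "dist (R (p s)) (R y) < d" using s nn' by (simp add: Rp dist_norm)
    ultimately show "\<exists>z\<in>\<Omega>. dist z (R y) < d" by blast
  qed
  then have Ryf: "R y \<in> frontier \<Omega>" using Ryout by (rule frontierI)
  have y0: "y \<noteq> 0" using y t by auto
  have gR: "norm (g (R y)) = \<beta>" using g_frontier[OF Ryf] normal[OF Ryf] beta by simp
  have gy: "g y \<bullet> (- n) = \<beta>" using g_frontier[OF y(1)] n1 by (simp add: n_def)
  \<comment> \<open>A third of the Hopf slope for the gradient error at each of \<open>y\<close> and
    \<open>R y\<close> leaves the last third for the contradiction.\<close>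
  have e3: "0 < \<epsilon> / 3" using eps by simp
  obtain d1 where d1: "0 < d1" "\<And>z. z \<in> closure \<Omega> - {0} \<Longrightarrow> dist z y < d1 \<Longrightarrow> norm (g z - g y) < \<epsilon> / 3"
    using g_close[OF _ e3, of y] frontier_closure[OF y(1)] y0 by auto
  obtain d2 where d2: "0 < d2" "\<And>z. z \<in> closure \<Omega> - {0} \<Longrightarrow> dist z (R y) < d2 \<Longrightarrow> norm (g z - g (R y)) < \<epsilon> / 3"
    using g_close[OF _ e3, of "R y"] frontier_closure[OF Ryf] Ry0 by auto
  define s where "s = min (min d1 d2) \<rho> / 2"
  have s: "0 < s" "s < d1" "s < d2" "s < \<rho>" "s \<le> \<rho> / 2"
    using half_min[of "min d1 d2" \<rho>] d1 d2 \<rho> by (auto simp: s_def)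
  have pk: "y + k *\<^sub>R (s *\<^sub>R (- n)) = p (k * s)" for k by (simp add: p_def)
  have Rpk: "R y + k *\<^sub>R (s *\<^sub>R (- n')) = R (p (k * s))" for k unfolding Rp by simp
  have ks: "0 < k * s \<and> k * s < s" if "0 < k" "k < 1" for k
    using that s by simp
  have pS: "p k \<in> S" if "0 \<le> k" "k \<le> \<rho>" for k
  proof -
    have "p k \<in> cball c \<rho>" using dcp[OF that] that by simp
    then show ?thesis using \<rho>(2) by (auto simp: c_def)
  qed
  obtain k1 where k1: "0 < k1" "k1 < 1" "u (y + s *\<^sub>R (- n)) - u y = g (y + k1 *\<^sub>R (s *\<^sub>R (- n))) \<bullet> (s *\<^sub>R (- n))"
  proof (rule gderiv_mvt[of u y "s *\<^sub>R (- n)" g])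
    show "continuous_on {0..1} (\<lambda>k. u (y + k *\<^sub>R (s *\<^sub>R (- n))))"
    proof (rule continuous_on_compose2[OF u_cont])
      show "continuous_on {0..1} (\<lambda>k. y + k *\<^sub>R (s *\<^sub>R (- n)))" by (intro continuous_intros)
      have "p (k * s) \<noteq> 0" if "0 \<le> k" "k \<le> 1" for k
      proof -
        have "k * s \<le> 1 * s" using that s by (intro mult_right_mono) auto
        then have "k * s \<le> \<rho>" using s by linarith
        then have "p (k * s) \<in> S" using s that by (intro pS) auto
        then show ?thesis using S0 by blast
      qed
      then show "(\<lambda>k. y + k *\<^sub>R (s *\<^sub>R (- n))) ` {0..1} \<subseteq> - {0}" unfolding pk by auto
    qed
    show "GDERIV u (y + k *\<^sub>R (s *\<^sub>R (- n))) :> g (y + k *\<^sub>R (s *\<^sub>R (- n)))" if "0 < k" "k < 1" for k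
      unfolding pk using in\<Omega>[OF pin[of "k * s"]] ks[OF that] s S0 by (intro du) auto
  qed blast
  obtain k2 where k2: "0 < k2" "k2 < 1"
    "u (R y + s *\<^sub>R (- n')) - u (R y) = g (R y + k2 *\<^sub>R (s *\<^sub>R (- n'))) \<bullet> (s *\<^sub>R (- n'))"
  proof (rule gderiv_mvt[of u "R y" "s *\<^sub>R (- n')" g])
    show "continuous_on {0..1} (\<lambda>k. u (R y + k *\<^sub>R (s *\<^sub>R (- n'))))"
    proof (rule continuous_on_compose2[OF u_cont])
      show "continuous_on {0..1} (\<lambda>k. R y + k *\<^sub>R (s *\<^sub>R (- n')))" by (intro continuous_intros)
      have "R (p (k * s)) \<noteq> 0" if "0 \<le> k" "k \<le> 1" for k
      proof -
        have "k * s \<le> 1 * s" using that s by (intro mult_right_mono) auto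
        then have "k * s \<le> \<rho>" using s by linarith
        then have "p (k * s) \<in> S" using s that by (intro pS) auto
        then show ?thesis using S0 R0 by blast
      qed
      then show "(\<lambda>k. R y + k *\<^sub>R (s *\<^sub>R (- n'))) ` {0..1} \<subseteq> - {0}" unfolding Rpk by auto
    qed
    show "GDERIV u (R y + k *\<^sub>R (s *\<^sub>R (- n'))) :> g (R y + k *\<^sub>R (s *\<^sub>R (- n')))" if "0 < k" "k < 1" for k
      unfolding Rpk using Rin[OF pin[of "k * s"]] ks[OF that] s by (intro du) auto
  qed blast
  define \<xi> where "\<xi> = p (k1 * s)"
  define \<zeta> where "\<zeta> = R (p (k2 * s))"
  have "k1 * s \<le> \<rho>" "k2 * s \<le> \<rho>"
    using ks[OF k1(1,2)] ks[OF k2(1,2)] s by linarith+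
  then have "p (k1 * s) \<in> ball c \<rho>" "p (k2 * s) \<in> ball c \<rho>"
    using ks[OF k1(1,2)] ks[OF k2(1,2)] by (blast intro: pin)+
  then have mem: "\<xi> \<in> closure \<Omega> - {0}" "\<zeta> \<in> closure \<Omega> - {0}"
    using in\<Omega>[of \<xi>] S0[of \<xi>] Rin closure_subset[of \<Omega>] by (auto simp: \<xi>_def \<zeta>_def)
  have "dist \<xi> y = k1 * s"
    using n1 k1(1) s(1) by (simp add: \<xi>_def dist_norm p_def)
  moreover have "dist \<zeta> (R y) = k2 * s"
    unfolding \<zeta>_def Rp using nn' k2(1) s(1) by (simp add: dist_norm)
  ultimately have "dist \<xi> y = k1 * s" "dist \<zeta> (R y) = k2 * s" .
  then have "dist \<xi> y < d1" "dist \<zeta> (R y) < d2"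
    using ks[OF k1(1,2)] ks[OF k2(1,2)] s by linarith+
  then have near: "norm (g \<xi> - g y) < \<epsilon> / 3" "norm (g \<zeta> - g (R y)) < \<epsilon> / 3"
    using d1(2)[OF mem(1)] d2(2)[OF mem(2)] by blast+
  have "\<beta> - \<epsilon> / 3 \<le> g \<xi> \<bullet> (- n)"
  proof -
    have "\<bar>(g \<xi> - g y) \<bullet> (- n)\<bar> \<le> norm (g \<xi> - g y) * norm (- n)" by (rule Cauchy_Schwarz_ineq2)
    then have "\<bar>(g \<xi> - g y) \<bullet> (- n)\<bar> \<le> \<epsilon> / 3" using near(1) n1 by simp
    then show ?thesis unfolding inner_diff_left gy by linarith
  qed
  then have "s * (\<beta> - \<epsilon> / 3) \<le> s * (g \<xi> \<bullet> (- n))" using s by (intro mult_left_mono) auto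
  moreover have "u (p s) = s * (g \<xi> \<bullet> (- n))"
  proof -
    have "p s = y + s *\<^sub>R (- n)" by (simp add: p_def)
    then show ?thesis using k1(3) frontier_u[OF y(1)] unfolding pk \<xi>_def by simp
  qed
  ultimately have A1: "s * (\<beta> - \<epsilon> / 3) \<le> u (p s)" by simp
  \<comment> \<open>The angle between \<open>n'\<close> and the normal at \<open>R y\<close> is
    unknown, but Cauchy-Schwarz bounds the slope by the gradient length, which is
    \<open>\<beta>\<close> at \<open>R y\<close>. At \<open>y\<close> the slope along the inward
    normal is exactly \<open>\<beta>\<close>.\<close>
  have "g \<zeta> \<bullet> (- n') \<le> \<beta> + \<epsilon> / 3"
  proof -
    have "g \<zeta> \<bullet> (- n') \<le> norm (g \<zeta>) * norm (- n')" by (rule norm_cauchy_schwarz)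
    moreover have "norm (g \<zeta>) \<le> norm (g (R y)) + norm (g \<zeta> - g (R y))"
      using norm_triangle_ineq[of "g (R y)" "g \<zeta> - g (R y)"] by simp
    ultimately show ?thesis using near(2) nn' gR by simp
  qed
  then have "s * (g \<zeta> \<bullet> (- n')) \<le> s * (\<beta> + \<epsilon> / 3)" using s by (intro mult_left_mono) auto
  moreover have "u (R (p s)) = s * (g \<zeta> \<bullet> (- n'))"
    using k2(3) uRy unfolding Rp[symmetric] Rpk \<zeta>_def by simp
  ultimately have A2: "u (R (p s)) \<le> s * (\<beta> + \<epsilon> / 3)" by simp
  have "\<epsilon> * (\<rho> - dist c (p s)) \<le> w (p s)"
    by (rule eps(2)) (use dcp[of s] s in auto)
  then have "\<epsilon> * s \<le> w (p s)" using dcp[of s] s by simp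
  also have "w (p s) \<le> s * (\<beta> + \<epsilon> / 3) - s * (\<beta> - \<epsilon> / 3)" unfolding w_def by (rule diff_mono[OF A2 A1])
  also have "\<dots> = 2 / 3 * (\<epsilon> * s)" by (simp add: algebra_simps)
  finally show False using mult_pos_pos[OF eps(1) s(1)] by linarith
qed

lemma strict_in_closed_cap:
  assumes "norm e = 1" "0 < t" "dominated e t"
    and "y \<in> closure \<Omega>" "t < y \<bullet> e" "y \<noteq> (2 * t) *\<^sub>R e"
  shows "u y < u (reflect e t y)"
proof (cases "y \<in> \<Omega>")
  case True
  then show ?thesis using strict_in_cap assms by blast
next
  case False
  then have "y \<in> frontier \<Omega>" using assms(4) frontierI by blast
  then show ?thesis using strict_on_frontier[OF assms(1,2,3)] assms frontier_u by simp
qed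

text \<open>Hopf's lemma for \<open>w\<close> in a ball of the cap that touches the plane at
  \<open>x\<close>: the slope of \<open>w\<close> along \<open>e\<close> is
  \<open>- 2 * (g x \<bullet> e)\<close> and must be positive.\<close>

lemma gradient_on_plane_inside:
  assumes e: "norm e = 1" and t: "0 < t" and P: "dominated e t"
    and x: "x \<in> \<Omega>" "x \<bullet> e = t"
  shows "g x \<bullet> e < 0"
proof (rule ccontr)
  assume contra: "\<not> g x \<bullet> e < 0"
  define q where "q = (2 * t) *\<^sub>R e"
  define w where "w = (\<lambda>y. u (reflect e t y) - u y)"
  have ee: "e \<bullet> e = 1" using e by (simp add: norm_eq_1)
  have "q \<bullet> e = 2 * t" by (simp add: q_def ee)
  then have xq: "x \<noteq> q" using x t by auto
  have "open (\<Omega> - {q})" using dom(1) by (rule open_delete)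
  then obtain r where r: "0 < r" "ball x r \<subseteq> \<Omega> - {q}"
    using x xq open_contains_ball_eq[of "\<Omega> - {q}" x] by blast
  \<comment> \<open>The diameter of the touching ball is \<open>r / 2\<close>, so the closed ball
    stays inside \<open>ball x r\<close>.\<close>
  define \<rho> where "\<rho> = r / 4"
  define c where "c = x + \<rho> *\<^sub>R e"
  have \<rho>: "0 < \<rho>" using r by (simp add: \<rho>_def)
  have C: "z \<in> \<Omega> \<and> z \<noteq> q \<and> t \<le> z \<bullet> e \<and> z \<noteq> 0" if "z \<in> cball c \<rho>" for z
  proof -
    have "dist x c = \<rho>" using \<rho> e by (simp add: c_def dist_norm)
    then have "dist x z < r" using that dist_triangle[of x z c] r by (simp add: \<rho>_def)
    then have 1: "z \<in> \<Omega>" "z \<noteq> q" using r by auto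
    have "(c - z) \<bullet> e \<le> norm (c - z) * norm e" by (rule norm_cauchy_schwarz)
    then have "(c - z) \<bullet> e \<le> \<rho>" using that e by (simp add: dist_norm)
    then have "t \<le> z \<bullet> e" by (simp add: c_def inner_diff_left inner_add_left ee x)
    then show ?thesis using 1 t by auto
  qed
  have Cs: "t < z \<bullet> e" if "z \<in> ball c \<rho>" for z
  proof -
    have "(c - z) \<bullet> e \<le> norm (c - z) * norm e" by (rule norm_cauchy_schwarz)
    then have "(c - z) \<bullet> e < \<rho>" using that e by (simp add: dist_norm)
    then show "t < z \<bullet> e" by (simp add: c_def inner_diff_left inner_add_left ee x)
  qed
  have qC: "(2 * t) *\<^sub>R e \<notin> cball c \<rho>" using C unfolding q_def by blast
  obtain L where L: "0 \<le> L" "\<And>z. z \<in> cball c \<rho> \<Longrightarrow> z \<in> \<Omega> \<Longrightarrow> t < z \<bullet> e \<Longrightarrow> \<exists>l\<le>L * w z. lap_at w z l"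
    using cap_supersolution[OF e t P closed_cball qC] unfolding w_def by metis
  obtain \<epsilon> where eps: "0 < \<epsilon>"
    "\<And>z. \<rho> / 2 \<le> dist c z \<Longrightarrow> dist c z \<le> \<rho> \<Longrightarrow> \<epsilon> * (\<rho> - dist c z) \<le> w z"
  proof (rule hopf_barrier[where c = c and R = \<rho> and L = L and W = w])
    show "0 < \<rho>" "0 \<le> L" by fact+
    show "continuous_on (cball c \<rho>) w"
    proof (rule continuous_at_imp_continuous_on, rule ballI)
      fix z assume "z \<in> cball c \<rho>"
      then show "isCont w z" unfolding w_def
        using C[of z] by (intro isCont_difference e) (auto simp: q_def)
    qed
    fix z assume z: "z \<in> ball c \<rho>"
    then have z': "z \<in> cball c \<rho>" by simp
    show "0 < w z"
      using strict_in_cap[OF e t P, of z] C[OF z'] Cs[OF z] by (simp add: w_def q_def)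
    show "\<exists>l\<le>L * w z. lap_at w z l" using L(2)[OF z'] C[OF z'] Cs[OF z] by blast
  qed blast
  have x0: "x \<in> \<Omega> - {0}" using x t by auto
  have D1: "((\<lambda>s. u (x + s *\<^sub>R e)) has_real_derivative g x \<bullet> e) (at 0)"
    by (rule gderiv_line) (use du[OF x0] in simp)
  have D2: "((\<lambda>s. u (x + s *\<^sub>R (- e))) has_real_derivative g x \<bullet> (- e)) (at 0)"
    by (rule gderiv_line) (use du[OF x0] in simp)
  \<comment> \<open>The two points are mirror images, so this is \<open>w\<close> minus the
    barrier's slope; if \<open>g x \<bullet> e\<close> were nonnegative it would decrease from
    0.\<close>
  have dd: "((\<lambda>s. u (x + s *\<^sub>R (- e)) - u (x + s *\<^sub>R e) - \<epsilon> * s) has_real_derivative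
      g x \<bullet> (- e) - g x \<bullet> e - \<epsilon>) (at 0)"
  proof (intro DERIV_diff D1 D2)
    show "((\<lambda>s. \<epsilon> * s) has_real_derivative \<epsilon>) (at 0)" by (auto intro!: derivative_eq_intros)
  qed
  have neg: "g x \<bullet> (- e) - g x \<bullet> e - \<epsilon> < 0" using contra eps by simp
  obtain d0 where d0: "d0 > 0"
    "\<And>h. 0 < h \<Longrightarrow> h < d0 \<Longrightarrow> u (x + h *\<^sub>R (- e)) - u (x + h *\<^sub>R e) - \<epsilon> * h < 0"
    using DERIV_neg_dec_right[OF dd neg] by auto
  define s where "s = min d0 \<rho> / 2"
  have s: "0 < s" "s < d0" "s < \<rho>" "s \<le> \<rho> / 2"
    using half_min[OF d0(1) \<rho>] by (auto simp: s_def)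
  have "c - (x + s *\<^sub>R e) = (\<rho> - s) *\<^sub>R e" by (simp add: c_def algebra_simps)
  then have dc: "dist c (x + s *\<^sub>R e) = \<rho> - s" using e s by (simp add: dist_norm)
  have "\<epsilon> * (\<rho> - dist c (x + s *\<^sub>R e)) \<le> w (x + s *\<^sub>R e)"
    by (rule eps(2)) (use dc s in auto)
  moreover have "reflect e t (x + s *\<^sub>R e) = x + s *\<^sub>R (- e)"
    by (simp add: reflect_def inner_add_left ee x algebra_simps flip: scaleR_add_left)
  ultimately show False using d0(2)[OF s(1,2)] dc by (simp add: w_def)
qed

end

section \<open>The corner lemma\<close>

text \<open>Serrin's barrier: the Hopf function times the distance to the plane through
  \<open>c\<close>, so that it vanishes on the plane and on the sphere and quadratically in the
  corner. The parameter \<open>a\<close> is chosen as for Hopf, with \<open>2 * n\<close> replaced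
  by the coefficient of the product formula.\<close>

lemma serrin_barrier:
  fixes c e :: "'a::euclidean_space"
  assumes R: "0 < R" and L: "0 \<le> L"
  obtains a where "0 < a"
    "\<And>p. R / 2 \<le> dist c p \<Longrightarrow> 0 < (p - c) \<bullet> e \<Longrightarrow>
       \<exists>l. L * (((p - c) \<bullet> e) * (exp (- a * (dist c p)\<^sup>2) - exp (- a * R\<^sup>2))) < l \<and>
           lap_at (\<lambda>y. ((y - c) \<bullet> e) * (exp (- a * (dist c y)\<^sup>2) - exp (- a * R\<^sup>2))) p l"
proof -
  define n where "n = 2 * real DIM('a) + 4"
  define a where "a = max 1 ((n + L + 1) / R\<^sup>2)"
  have a1: "1 \<le> a" by (simp add: a_def)
  have a2: "n + L + 1 \<le> a * R\<^sup>2"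
  proof -
    have "(n + L + 1) / R\<^sup>2 \<le> a" by (simp add: a_def)
    then show ?thesis using R by (simp add: pos_divide_le_eq)
  qed
  define F where "F = (\<lambda>q. exp (- a * q) - exp (- a * R\<^sup>2))"
  have F_dist: "F ((y - c) \<bullet> (y - c)) = exp (- a * (dist c y)\<^sup>2) - exp (- a * R\<^sup>2)" for y
    by (simp add: F_def dist_norm norm_minus_commute[of c] flip: power2_norm_eq_inner)
  show ?thesis
  proof (rule that[of a])
    show "0 < a" using a1 by simp
    fix p assume p: "R / 2 \<le> dist c p" "0 < (p - c) \<bullet> e"
    define q where "q = (p - c) \<bullet> (p - c)"
    define k where "k = (p - c) \<bullet> e"
    have q: "q = (dist c p)\<^sup>2" by (simp add: q_def dist_norm norm_minus_commute[of c] flip: power2_norm_eq_inner)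
    have "R\<^sup>2 / 4 \<le> q"
      using power_mono[OF p(1), of 2] R by (simp add: q power_divide)
    define E where "E = exp (- a * q)"
    have E: "0 < E" by (simp add: E_def)
    have "lap_at (\<lambda>y. ((y - c) \<bullet> e) * F ((y - c) \<bullet> (y - c))) p (k * (4 * q * (a * (a * E)) + n * (- a * E)))"
      unfolding q_def n_def E_def k_def
    proof (rule lap_at_linear_times_radial[where F' = "\<lambda>q. - a * exp (- a * q)"])
      show "\<forall>\<^sub>F q in nhds ((p - c) \<bullet> (p - c)). (F has_real_derivative - a * exp (- a * q)) (at q)"
        unfolding F_def by (auto intro!: always_eventually derivative_eq_intros)
      show "((\<lambda>q. - a * exp (- a * q)) has_real_derivative a * (a * exp (- a * ((p - c) \<bullet> (p - c)))))
          (at ((p - c) \<bullet> (p - c)))"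
        by (auto intro!: derivative_eq_intros)
    qed
    moreover have "4 * q * (a * (a * E)) + n * (- a * E) = E * (a * (a * (4 * q) - n))"
      by (simp add: algebra_simps)
    moreover have "L * (k * F q) < k * (E * (a * (a * (4 * q) - n)))"
    proof -
      have "a * R\<^sup>2 \<le> a * (4 * q)" using a1 \<open>R\<^sup>2 / 4 \<le> q\<close> by simp
      then have 1: "L + 1 \<le> a * (4 * q) - n" using a2 by linarith
      then have "1 * (L + 1) \<le> a * (a * (4 * q) - n)" using a1 L by (intro mult_mono) auto
      then have "E * (L + 1) \<le> E * (a * (a * (4 * q) - n))" using E by simp
      moreover have "L * F q \<le> L * E"
        using L by (intro mult_left_mono) (auto simp: F_def E_def)
      moreover have "L * E < E * (L + 1)" using E by (simp add: algebra_simps)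
      ultimately have "L * F q < E * (a * (a * (4 * q) - n))" by linarith
      then have "k * (L * F q) < k * (E * (a * (a * (4 * q) - n)))"
        using p(2) unfolding k_def by (intro mult_strict_left_mono)
      then show ?thesis by (simp add: mult_ac)
    qed
    ultimately show "\<exists>l. L * (((p - c) \<bullet> e) * (exp (- a * (dist c p)\<^sup>2) - exp (- a * R\<^sup>2))) < l \<and>
           lap_at (\<lambda>y. ((y - c) \<bullet> e) * (exp (- a * (dist c y)\<^sup>2) - exp (- a * R\<^sup>2))) p l"
      unfolding F_dist[symmetric] q_def[symmetric] k_def[symmetric] by (metis k_def)
  qed
qed

section \<open>Frontier points lying on the plane\<close>

context singular_serrin
begin

text \<open>Otherwise \<open>u\<close> increases along \<open>e\<close> near \<open>x\<close>, and
  the centre \<open>p\<close> of a small interior ball lies beyond the plane. Domination puts the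
  mirror image of \<open>p\<close> into \<open>\<Omega>\<close>, and moving from there to
  \<open>p\<close> makes \<open>u\<close> strictly larger at \<open>p\<close>.\<close>

lemma normal_on_plane_nonneg:
  assumes e: "norm e = 1" and t: "0 < t" and P: "dominated e t"
    and x: "x \<in> frontier \<Omega>" "x \<bullet> e = t"
  shows "g x \<bullet> e \<le> 0"
proof (rule ccontr)
  assume "\<not> g x \<bullet> e \<le> 0"
  then have pos: "0 < g x \<bullet> e" by simp
  define R where "R = reflect e t"
  have ee: "e \<bullet> e = 1" using e by (simp add: norm_eq_1)
  have x0: "x \<noteq> 0" using frontier_nonzero x by blast
  obtain d where d: "0 < d" "\<And>z. z \<in> closure \<Omega> - {0} \<Longrightarrow> dist z x < d \<Longrightarrow> norm (g z - g x) < g x \<bullet> e"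
    using g_close[OF _ pos] x x0 frontier_closure by blast
  define r where "r = min d (norm x)"
  have r: "0 < r" "r \<le> d" "0 \<notin> ball x r" using d x0 by (auto simp: r_def)
  have inc: "0 < g z \<bullet> e" if "z \<in> closure \<Omega> \<inter> ball x r" for z
  proof -
    have "z \<in> closure \<Omega> - {0}" "dist z x < d" using that r by (auto simp: dist_commute)
    then have "norm (g z - g x) < g x \<bullet> e" by (rule d(2))
    moreover have "\<bar>(g z - g x) \<bullet> e\<bar> \<le> norm (g z - g x) * norm e" by (rule Cauchy_Schwarz_ineq2)
    ultimately have "\<bar>g z \<bullet> e - g x \<bullet> e\<bar> < g x \<bullet> e" using e by (simp add: inner_diff_left)
    then show ?thesis by linarith
  qed
  obtain \<rho> where \<rho>: "0 < \<rho>" "cball (x - \<rho> *\<^sub>R \<nu> x) \<rho> \<subseteq> ball x r" "cball (x - \<rho> *\<^sub>R \<nu> x) \<rho> - {x} \<subseteq> \<Omega>"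
    using interior_ball[OF x(1) open_ball, of x r] r by auto
  define p where "p = x - \<rho> *\<^sub>R \<nu> x"
  have nu: "norm (\<nu> x) = 1" by (rule normal[OF x(1)])
  have nue: "\<nu> x \<bullet> e < 0"
    using pos beta unfolding g_frontier[OF x(1)] by (simp add: mult_less_0_iff)
  have "p \<noteq> x" using \<rho> nu by (auto simp: p_def)
  moreover have "p \<in> cball p \<rho>" using \<rho> by simp
  ultimately have p: "p \<in> \<Omega>" "p \<in> ball x r" using \<rho> unfolding p_def[symmetric] by blast+
  define k where "k = 2 * (p \<bullet> e - t)"
  have "p \<bullet> e - t = - (\<rho> * (\<nu> x \<bullet> e))" by (simp add: p_def inner_diff_left x)
  moreover have "0 < - (\<rho> * (\<nu> x \<bullet> e))" using \<rho> nue by (simp add: mult_pos_neg)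
  ultimately have pe: "t < p \<bullet> e" and k: "0 < k" by (auto simp: k_def)
  have pR: "R p + k *\<^sub>R e = p" by (simp add: R_def reflect_def k_def)
  have Rx: "R x = x" using x by (simp add: R_def reflect_fixed)
  have "dist x (R p) = dist x p" using dist_reflect[OF e, of t x p] Rx by (simp add: R_def)
  then have Rp: "R p \<in> ball x r" using p by simp
  have "R p \<noteq> 0" using Rp r by auto
  then have "p \<noteq> (2 * t) *\<^sub>R e" using reflect_eq_0_iff[OF e] by (auto simp: R_def)
  then have le: "u p \<le> u (R p)" using P pe unfolding dominated_def R_def by blast
  moreover have "0 < u p" using p r by (intro u_pos) auto
  ultimately have Rp\<Omega>: "R p \<in> \<Omega>" using u_pos_imp_in[of "R p"] by simp
  have "u (R p) < u (R p + k *\<^sub>R e)"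
  proof (rule increasing_along_segment[OF r(3) Rp\<Omega> Rp])
    show "R p + k *\<^sub>R e \<in> ball x r" using p pR by simp
    show "0 < g y \<bullet> (k *\<^sub>R e)" if "y \<in> closure \<Omega> \<inter> ball x r" for y using inc[OF that] k by simp
  qed
  then show False using le pR by simp
qed

text \<open>The squared length of \<open>g\<close> is constant on the frontier, so its gradient
  \<open>2 *\<^sub>R H y (g y)\<close> has no tangential part at \<open>x\<close>; and
  \<open>g x\<close> is a nonzero multiple of the normal.\<close>

lemma mixed_derivative_zero:
  assumes x: "x \<in> frontier \<Omega>" and e: "e \<bullet> \<nu> x = 0"
  shows "H x (\<nu> x) \<bullet> e = 0"
proof -
  have xc: "x \<in> closure \<Omega> - {0}" using x frontier_closure frontier_nonzero by blast
  obtain M r where M: "0 < M" "0 < r"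
    "\<And>z. dist x z < r \<Longrightarrow> (z - x) \<bullet> \<nu> x < - M * (norm (z - x))\<^sup>2 \<Longrightarrow> z \<in> \<Omega>"
    "\<And>z. dist x z < r \<Longrightarrow> M * (norm (z - x))\<^sup>2 < (z - x) \<bullet> \<nu> x \<Longrightarrow> z \<notin> \<Omega>"
    using paraboloid[OF x] by metis
  define r' where "r' = min r (norm x)"
  have r': "0 < r'" "r' \<le> r" "0 \<notin> ball x r'" using M xc by (auto simp: r'_def)
  have sub: "closure \<Omega> \<inter> ball x r' \<subseteq> closure \<Omega> - {0}" using r' by auto
  define K where "K = (\<lambda>y. 2 *\<^sub>R H y (g y))"
  \<comment> \<open>Continuity of the Hessian is available for fixed vectors only, so
    \<open>g y\<close> is expanded in the basis.\<close>
  have Hg: "H y (g y) = (\<Sum>i\<in>Basis. (g y \<bullet> i) *\<^sub>R H y i)" if "y \<in> closure \<Omega> - {0}" for y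
  proof -
    interpret linear "H y" by (rule H_lin[OF that])
    have "H y (g y) = H y (\<Sum>i\<in>Basis. (g y \<bullet> i) *\<^sub>R i)" by (simp add: euclidean_representation)
    then show ?thesis by (simp only: sum scale)
  qed
  have "K x \<bullet> e = 0"
  proof (rule tangential_gradient_zero[OF dom(1) x normal[OF x] M(1) r'(1), where F = "\<lambda>y. g y \<bullet> g y"])
    show "z \<in> \<Omega>" if "dist x z < r'" "(z - x) \<bullet> \<nu> x < - M * (norm (z - x))\<^sup>2" for z
      using M(3)[of z] that r' by simp
    show "z \<notin> \<Omega>" if "dist x z < r'" "M * (norm (z - x))\<^sup>2 < (z - x) \<bullet> \<nu> x" for z
      using M(4)[of z] that r' by simp
    show "continuous_on (closure \<Omega> \<inter> ball x r') (\<lambda>y. g y \<bullet> g y)"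
      by (intro continuous_on_inner continuous_on_subset[OF g_cont sub])
    have "continuous_on (closure \<Omega> - {0}) (\<lambda>y. \<Sum>i\<in>Basis. (g y \<bullet> i) *\<^sub>R H y i)"
      by (intro continuous_intros g_cont H_cont)
    then have "continuous_on (closure \<Omega> - {0}) (\<lambda>y. H y (g y))"
      by (rule continuous_on_eq) (simp add: Hg)
    then have "continuous_on (closure \<Omega> - {0}) K" unfolding K_def by (intro continuous_intros)
    then show "continuous_on (closure \<Omega> \<inter> ball x r') K" by (rule continuous_on_subset[OF _ sub])
    show "GDERIV (\<lambda>y. g y \<bullet> g y) y :> K y" if "y \<in> \<Omega> \<inter> ball x r'" for y
    proof -
      have y: "y \<in> \<Omega> - {0}" "y \<in> closure \<Omega> - {0}" using that r' closure_subset[of \<Omega>] by auto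
      have "((\<lambda>y. g y \<bullet> g y) has_derivative (\<lambda>h. g y \<bullet> H y h + H y h \<bullet> g y)) (at y)"
        by (rule has_derivative_inner[OF dg[OF y(1)] dg[OF y(1)]])
      moreover have "(\<lambda>h. g y \<bullet> H y h + H y h \<bullet> g y) = (\<lambda>h. h \<bullet> K y)"
        using H_sym[OF y(2)] by (auto simp: K_def inner_commute)
      ultimately show ?thesis by (simp add: gderiv_def)
    qed
    show "g y \<bullet> g y = g x \<bullet> g x" if "y \<in> frontier \<Omega> \<inter> ball x r'" for y
    proof -
      have "y \<in> frontier \<Omega>" using that by blast
      then have "\<nu> y \<bullet> \<nu> y = 1" using normal by (simp add: norm_eq_1)
      moreover have "\<nu> x \<bullet> \<nu> x = 1" using normal[OF x] by (simp add: norm_eq_1)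
      ultimately show ?thesis using g_frontier[OF x] g_frontier[OF \<open>y \<in> frontier \<Omega>\<close>] by simp
    qed
    show "e \<bullet> \<nu> x = 0" by fact
  qed
  moreover have "K x = - (2 * \<beta>) *\<^sub>R H x (\<nu> x)"
  proof -
    interpret linear "H x" by (rule H_lin[OF xc])
    show ?thesis unfolding K_def g_frontier[OF x] scale by simp
  qed
  ultimately show ?thesis using beta by simp
qed

text \<open>Along the diagonals \<open>- \<nu> x \<plusminus> e\<close> the first derivatives agree because \<open>g x\<close> is normal, and the
  second ones differ by \<open>4 H x e \<bullet> \<nu> x\<close>, which vanishes by \<open>mixed_derivative_zero\<close>.\<close>
lemma corner_second_order:
  assumes e: "norm e = 1" and x: "x \<in> frontier \<Omega>" "\<nu> x \<bullet> e = 0"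
    and R: "0 < R" "0 \<notin> cball (x - R *\<^sub>R \<nu> x) R" "cball (x - R *\<^sub>R \<nu> x) R - {x} \<subseteq> \<Omega>"
    and \<epsilon>: "0 < \<epsilon>"
  obtains d where "0 < d"
    "\<And>s. 0 < s \<Longrightarrow> s < d \<Longrightarrow> \<bar>u (x + s *\<^sub>R (- \<nu> x - e)) - u (x + s *\<^sub>R (- \<nu> x + e))\<bar> \<le> \<epsilon> * s\<^sup>2"
proof -
  define n where "n = - \<nu> x"
  have ee: "e \<bullet> e = 1" using e by (simp add: norm_eq_1)
  have nn: "n \<bullet> n = 1" using normal[OF x(1)] by (simp add: n_def norm_eq_1)
  have ne: "n \<bullet> e = 0" "e \<bullet> n = 0" using x by (auto simp: n_def inner_commute)
  have xc: "x \<in> closure \<Omega> - {0}" using x frontier_closure frontier_nonzero by blast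
  define dm where "dm = n - e"
  define dp where "dp = n + e"
  have sq: "(norm (A *\<^sub>R n + B *\<^sub>R e))\<^sup>2 = A\<^sup>2 + B\<^sup>2" for A B
    unfolding power2_norm_eq_inner
    by (simp add: inner_add_left inner_add_right nn ee ne power2_eq_square)
  \<comment> \<open>Both diagonals stay in the interior ball: the squared distance to its centre is
    \<open>(s - R)\<^sup>2 + s\<^sup>2\<close>, at most \<open>R\<^sup>2\<close> for
    \<open>s\<close> up to \<open>R\<close>.\<close>
  have ray: "x + s *\<^sub>R (n + k *\<^sub>R e) \<in> \<Omega> - {0}" if s: "0 < s" "s < R" and k: "k * k = 1" for s k
  proof -
    have "x + s *\<^sub>R (n + k *\<^sub>R e) - (x - R *\<^sub>R \<nu> x) = (s - R) *\<^sub>R n + (s * k) *\<^sub>R e"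
      by (simp add: n_def algebra_simps)
    then have "(dist (x + s *\<^sub>R (n + k *\<^sub>R e)) (x - R *\<^sub>R \<nu> x))\<^sup>2 = (s - R)\<^sup>2 + (s * k)\<^sup>2"
      unfolding dist_norm by (simp only: sq)
    also have "(s * k)\<^sup>2 = s\<^sup>2" using k by (simp add: power2_eq_square)
    also have "(s - R)\<^sup>2 + s\<^sup>2 \<le> R\<^sup>2"
    proof -
      have "s * s \<le> R * s" using s by (intro mult_right_mono) auto
      then show ?thesis by (simp add: power2_eq_square algebra_simps)
    qed
    finally have "dist (x + s *\<^sub>R (n + k *\<^sub>R e)) (x - R *\<^sub>R \<nu> x) \<le> R"
      by (rule power2_le_imp_le) (use R in simp)
    then have c: "x + s *\<^sub>R (n + k *\<^sub>R e) \<in> cball (x - R *\<^sub>R \<nu> x) R" by (simp add: dist_commute)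
    have "(n + k *\<^sub>R e) \<bullet> n = 1" by (simp add: inner_add_left nn ne)
    then have "n + k *\<^sub>R e \<noteq> 0" by auto
    then have "x + s *\<^sub>R (n + k *\<^sub>R e) \<noteq> x" using s by simp
    then have "x + s *\<^sub>R (n + k *\<^sub>R e) \<in> \<Omega>" using R(3) c by blast
    moreover have "x + s *\<^sub>R (n + k *\<^sub>R e) \<noteq> 0" using R(2) c by metis
    ultimately show ?thesis by simp
  qed
  have rm: "x + s *\<^sub>R dm \<in> \<Omega> - {0}" if "0 < s" "s < R" for s
    using ray[OF that, of "- 1"] by (simp add: dm_def)
  have rp: "x + s *\<^sub>R dp \<in> \<Omega> - {0}" if "0 < s" "s < R" for s
    using ray[OF that, of 1] by (simp add: dp_def)
  have sub: "\<Omega> - {0} \<subseteq> closure \<Omega> - {0}" using closure_subset[of \<Omega>] by auto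
  define \<psi> where "\<psi> = (\<lambda>s. u (x + s *\<^sub>R dm) - u (x + s *\<^sub>R dp))"
  define \<psi>1 where "\<psi>1 = (\<lambda>s. g (x + s *\<^sub>R dm) \<bullet> dm - g (x + s *\<^sub>R dp) \<bullet> dp)"
  define \<psi>2 where "\<psi>2 = (\<lambda>s. H (x + s *\<^sub>R dm) dm \<bullet> dm - H (x + s *\<^sub>R dp) dp \<bullet> dp)"
  have range: "continuous_on {0..R / 2} (\<lambda>s. h (x + s *\<^sub>R d))"
    if "continuous_on (closure \<Omega> - {0}) h" "\<And>s. 0 < s \<Longrightarrow> s < R \<Longrightarrow> x + s *\<^sub>R d \<in> \<Omega> - {0}" for h :: "'a \<Rightarrow> 'c::topological_space" and d
  proof (rule continuous_on_compose2[OF that(1)])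
    show "continuous_on {0..R / 2} (\<lambda>s. x + s *\<^sub>R d)" by (intro continuous_intros)
    show "(\<lambda>s. x + s *\<^sub>R d) ` {0..R / 2} \<subseteq> closure \<Omega> - {0}"
    proof (rule image_subsetI)
      fix s assume "s \<in> {0..R / 2}"
      then show "x + s *\<^sub>R d \<in> closure \<Omega> - {0}"
        using that(2)[of s] sub xc R(1) by (cases "s = 0") auto
    qed
  qed
  have uc: "continuous_on (closure \<Omega> - {0}) u" by (rule continuous_on_subset[OF u_cont]) auto
  have c0: "continuous_on {0..R / 2} \<psi>" unfolding \<psi>_def
    by (intro continuous_on_diff range uc rm rp)
  have c1: "continuous_on {0..R / 2} \<psi>1" unfolding \<psi>1_def
    by (intro continuous_on_diff continuous_on_inner continuous_on_const range g_cont rm rp)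
  have c2: "continuous_on {0..R / 2} \<psi>2" unfolding \<psi>2_def
    by (intro continuous_on_diff continuous_on_inner continuous_on_const range[of "\<lambda>y. H y dm"] range[of "\<lambda>y. H y dp"] H_cont rm rp)
  have d1: "(\<psi> has_real_derivative \<psi>1 s) (at s)" if "0 < s" "s < R" for s
    unfolding \<psi>_def \<psi>1_def by (intro DERIV_diff gderiv_line du rm rp that)
  have dgl: "((\<lambda>s. g (x + s *\<^sub>R d) \<bullet> d) has_real_derivative H (x + s *\<^sub>R d) d \<bullet> d) (at s)"
    if "x + s *\<^sub>R d \<in> \<Omega> - {0}" for s d
  proof -
    have "GDERIV (\<lambda>y. g y \<bullet> d) (x + s *\<^sub>R d) :> H (x + s *\<^sub>R d) d"
      unfolding gderiv_def
    proof (rule has_derivative_eq_rhs[OF has_derivative_inner_left[OF dg[OF that]]])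
      show "(\<lambda>h. H (x + s *\<^sub>R d) h \<bullet> d) = (\<lambda>h. h \<bullet> H (x + s *\<^sub>R d) d)"
        using H_sym[of "x + s *\<^sub>R d"] that sub by blast
    qed
    then show ?thesis by (rule gderiv_line)
  qed
  have d2: "(\<psi>1 has_real_derivative \<psi>2 s) (at s)" if "0 < s" "s < R" for s
    unfolding \<psi>1_def \<psi>2_def by (intro DERIV_diff dgl rm rp that)
  have z0: "\<psi> 0 = 0" by (simp add: \<psi>_def)
  have gx: "g x = \<beta> *\<^sub>R n" using g_frontier[OF x(1)] by (simp add: n_def)
  have z1: "\<psi>1 0 = 0" by (simp add: \<psi>1_def gx dm_def dp_def inner_add_right inner_diff_right ne)
  have z2: "\<psi>2 0 = 0"
  proof -
    interpret linear "H x" by (rule H_lin[OF xc])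
    have "H x (\<nu> x) \<bullet> e = 0" by (rule mixed_derivative_zero[OF x(1)]) (use x in \<open>simp add: inner_commute\<close>)
    then have a: "H x n \<bullet> e = 0" unfolding n_def by (simp add: neg)
    then have b: "H x e \<bullet> n = 0" using H_sym[OF xc, of e n] by (simp add: inner_commute)
    show ?thesis
      by (simp add: \<psi>2_def dm_def dp_def add diff inner_add_left inner_add_right inner_diff_left inner_diff_right a b)
  qed
  have "0 \<in> {0..R / 2}" using R by simp
  then obtain \<delta> where \<delta>: "0 < \<delta>" "\<And>s. s \<in> {0..R / 2} \<Longrightarrow> dist s 0 < \<delta> \<Longrightarrow> dist (\<psi>2 s) (\<psi>2 0) < \<epsilon>"
    using c2 \<epsilon> unfolding continuous_on_iff by blast
  define d where "d = min \<delta> (R / 2)"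
  have d: "0 < d" "d \<le> \<delta>" "d \<le> R / 2" using \<delta> R by (auto simp: d_def)
  show ?thesis
  proof (rule that[OF d(1)])
    fix s :: real assume s: "0 < s" "s < d"
    have "\<bar>\<psi> s\<bar> \<le> \<epsilon> * s\<^sup>2"
    proof (rule small_second_derivative_imp_small[where d = d and \<psi>' = \<psi>1 and \<psi>'' = \<psi>2])
      show "\<psi> 0 = 0" "\<psi>1 0 = 0" "0 < s" "s < d" by fact+
      show "continuous_on {0..d} \<psi>" by (rule continuous_on_subset[OF c0]) (use d in auto)
      show "continuous_on {0..d} \<psi>1" by (rule continuous_on_subset[OF c1]) (use d in auto)
      fix k :: real assume k: "0 < k" "k < d"
      show "(\<psi> has_real_derivative \<psi>1 k) (at k)" using d1[of k] k d R(1) by simp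
      show "(\<psi>1 has_real_derivative \<psi>2 k) (at k)" using d2[of k] k d R(1) by simp
      show "\<bar>\<psi>2 k\<bar> \<le> \<epsilon>" using \<delta>(2)[of k] k d z2 by (simp add: dist_norm)
    qed
    then show "\<bar>u (x + s *\<^sub>R (- \<nu> x - e)) - u (x + s *\<^sub>R (- \<nu> x + e))\<bar> \<le> \<epsilon> * s\<^sup>2"
      by (simp add: \<psi>_def dm_def dp_def n_def)
  qed
qed

text \<open>Needed where the corner region is cut off: that piece reaches the plane, so positivity
  of \<open>w\<close> alone gives no usable bound. A sequence violating every constant has a limit
  in \<open>K\<close>; beyond the plane \<open>w\<close> is positive there, and on the plane the
  negative derivative along \<open>e\<close> gives linear growth.\<close>

lemma linear_lower_bound_near_plane:
  assumes e: "norm e = 1" and t: "0 < t" and P: "dominated e t"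
    and K: "compact K" "K \<subseteq> \<Omega>" "(2 * t) *\<^sub>R e \<notin> K" "\<And>y. y \<in> K \<Longrightarrow> t \<le> y \<bullet> e"
  obtains c where "0 < c" "\<And>y. y \<in> K \<Longrightarrow> c * (y \<bullet> e - t) \<le> u (reflect e t y) - u y"
proof (rule ccontr)
  note pick = that
  define w where "w = (\<lambda>y. u (reflect e t y) - u y)"
  assume contra: "\<not> thesis"
  have "\<exists>y\<in>K. w y < inverse (real (Suc n)) * (y \<bullet> e - t)" for n
  proof (rule ccontr)
    assume "\<not> (\<exists>y\<in>K. w y < inverse (real (Suc n)) * (y \<bullet> e - t))"
    then have "inverse (real (Suc n)) * (y \<bullet> e - t) \<le> u (reflect e t y) - u y" if "y \<in> K" for y
      using that by (fastforce simp: w_def not_less)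
    then show False using pick[of "inverse (real (Suc n))"] contra by simp
  qed
  then obtain Y where Y: "\<And>n. Y n \<in> K" "\<And>n. w (Y n) < inverse (real (Suc n)) * (Y n \<bullet> e - t)"
    by metis
  have Yt: "t < Y n \<bullet> e" for n
  proof (rule ccontr)
    assume "\<not> t < Y n \<bullet> e"
    then have eq: "Y n \<bullet> e = t" using K(4)[OF Y(1)[of n]] by simp
    then have "w (Y n) = 0" by (simp add: w_def reflect_fixed)
    then show False using Y(2)[of n] eq by simp
  qed
  obtain l r where l: "l \<in> K" "strict_mono r" "(Y \<circ> r) \<longlonglongrightarrow> l"
    using K(1) Y(1) unfolding compact_def by metis
  have inv: "(\<lambda>n. inverse (real (Suc (r n)))) \<longlonglongrightarrow> 0"
    using LIMSEQ_subseq_LIMSEQ[OF LIMSEQ_inverse_real_of_nat l(2)] by (simp add: o_def)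
  have l\<Omega>: "l \<in> \<Omega>" "l \<noteq> (2 * t) *\<^sub>R e" "t \<le> l \<bullet> e" using K l by blast+
  have l0: "l \<noteq> 0" using l\<Omega>(3) t by auto
  show False
  proof (cases "t < l \<bullet> e")
    case True
    have "isCont w l" unfolding w_def by (intro isCont_difference e l\<Omega> l0)
    then have "(\<lambda>n. w ((Y \<circ> r) n)) \<longlonglongrightarrow> w l" using l(3) by (rule isCont_tendsto_compose)
    moreover have "(\<lambda>n. inverse (real (Suc (r n))) * ((Y \<circ> r) n \<bullet> e - t)) \<longlonglongrightarrow> 0 * (l \<bullet> e - t)"
      by (intro tendsto_intros inv l(3))
    ultimately have "w l \<le> 0 * (l \<bullet> e - t)"
    proof (rule LIMSEQ_le, intro exI allI impI)
      show "w ((Y \<circ> r) n) \<le> inverse (real (Suc (r n))) * ((Y \<circ> r) n \<bullet> e - t)" for n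
        using Y(2)[of "r n"] by (simp only: o_def less_imp_le)
    qed
    then show False using strict_in_cap[OF e t P l\<Omega>(1) True l\<Omega>(2)] by (simp add: w_def)
  next
    case False
    then have le: "l \<bullet> e = t" using l\<Omega> by simp
    \<comment> \<open>The segment from the mirror image to \<open>y\<close> has length
      \<open>2 * (y \<bullet> e - t)\<close> and slope below \<open>- \<eta> / 2\<close>, hence
      \<open>w y\<close> exceeds \<open>\<eta> * (y \<bullet> e - t)\<close>.\<close>
    define \<eta> where "\<eta> = - (g l \<bullet> e)"
    have eta: "0 < \<eta>" using gradient_on_plane_inside[OF e t P l\<Omega>(1) le] by (simp add: \<eta>_def)
    have lc: "l \<in> closure \<Omega> - {0}" using l\<Omega> l0 closure_subset[of \<Omega>] by auto
    have "0 < \<eta> / 2" using eta by simp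
    then obtain d1 where d1: "0 < d1" "\<And>z. z \<in> closure \<Omega> - {0} \<Longrightarrow> dist z l < d1 \<Longrightarrow> norm (g z - g l) < \<eta> / 2"
      using g_close[OF lc] by blast
    obtain d2 where d2: "0 < d2" "ball l d2 \<subseteq> \<Omega> - {0}"
      using open_punctured l\<Omega> l0 open_contains_ball_eq[of "\<Omega> - {0}" l] by blast
    define d where "d = min d1 d2"
    have "ball l d \<subseteq> ball l d2" by (simp add: d_def subset_ball)
    then have d: "0 < d" "d \<le> d1" "ball l d \<subseteq> \<Omega> - {0}" using d1(1) d2 by (simp_all add: d_def)
    have gz: "g z \<bullet> e < - \<eta> / 2" if "z \<in> ball l d" for z
    proof -
      have "z \<in> \<Omega> - {0}" using that d(3) by blast
      then have "z \<in> closure \<Omega> - {0}" using closure_subset[of \<Omega>] by blast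
      moreover have "dist z l < d1" using that d(2) by (simp add: dist_commute)
      ultimately have "norm (g z - g l) < \<eta> / 2" by (rule d1(2))
      moreover have "\<bar>(g z - g l) \<bullet> e\<bar> \<le> norm (g z - g l) * norm e" by (rule Cauchy_Schwarz_ineq2)
      ultimately have "\<bar>g z \<bullet> e - g l \<bullet> e\<bar> < \<eta> / 2" using e by (simp add: inner_diff_left)
      then show ?thesis unfolding \<eta>_def by linarith
    qed
    have "\<forall>\<^sub>F n in sequentially. dist ((Y \<circ> r) n) l < d" using l(3) d(1) by (rule tendstoD)
    moreover have "\<forall>\<^sub>F n in sequentially. inverse (real (Suc (r n))) < \<eta>"
      using order_tendstoD(2)[OF inv eta] .
    ultimately have "\<forall>\<^sub>F n in sequentially. dist (Y (r n)) l < d \<and> inverse (real (Suc (r n))) < \<eta>"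
      by eventually_elim simp
    then obtain n where n: "dist (Y (r n)) l < d" "inverse (real (Suc (r n))) < \<eta>"
      using eventually_happens by fastforce
    define y where "y = Y (r n)"
    define k where "k = 2 * (y \<bullet> e - t)"
    have k: "0 < k" using Yt[of "r n"] by (simp add: k_def y_def)
    have Ry: "reflect e t y + k *\<^sub>R e = y" by (simp add: reflect_def k_def)
    have "dist (reflect e t y) (reflect e t l) = dist y l" by (rule dist_reflect[OF e])
    then have balls: "reflect e t y \<in> ball l d" "y \<in> ball l d"
      using n le by (auto simp: reflect_fixed y_def dist_commute)
    have seg: "reflect e t y + s *\<^sub>R (k *\<^sub>R e) \<in> ball l d" if "0 \<le> s" "s \<le> 1" for s
    proof -
      have "(1 - s) *\<^sub>R reflect e t y + s *\<^sub>R (reflect e t y + k *\<^sub>R e) \<in> ball l d"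
        unfolding Ry using convexD_alt[OF convex_ball balls that] .
      then show ?thesis by (simp add: algebra_simps)
    qed
    obtain s where s: "0 < s" "s < 1"
      "u (reflect e t y + k *\<^sub>R e) - u (reflect e t y) = g (reflect e t y + s *\<^sub>R (k *\<^sub>R e)) \<bullet> (k *\<^sub>R e)"
    proof (rule gderiv_mvt[of u "reflect e t y" "k *\<^sub>R e" g])
      show "continuous_on {0..1} (\<lambda>s. u (reflect e t y + s *\<^sub>R (k *\<^sub>R e)))"
      proof (rule continuous_on_compose2[OF u_cont])
        show "continuous_on {0..1} (\<lambda>s. reflect e t y + s *\<^sub>R (k *\<^sub>R e))" by (intro continuous_intros)
        show "(\<lambda>s. reflect e t y + s *\<^sub>R (k *\<^sub>R e)) ` {0..1} \<subseteq> - {0}"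
          by (rule image_subsetI) (use seg d(3) in force)
      qed
      show "GDERIV u (reflect e t y + s *\<^sub>R (k *\<^sub>R e)) :> g (reflect e t y + s *\<^sub>R (k *\<^sub>R e))" if "0 < s" "s < 1" for s
      proof -
        have "reflect e t y + s *\<^sub>R (k *\<^sub>R e) \<in> ball l d" by (rule seg) (use that in auto)
        then show ?thesis using d(3) by (blast intro: du)
      qed
    qed blast
    have "k * (g (reflect e t y + s *\<^sub>R (k *\<^sub>R e)) \<bullet> e) < k * (- \<eta> / 2)"
      using gz[OF seg[of s]] s k by (intro mult_strict_left_mono) auto
    then have "u y - u (reflect e t y) < k * (- \<eta> / 2)" using s(3) unfolding Ry by simp
    moreover have "k * (- \<eta> / 2) = - (\<eta> * (y \<bullet> e - t))" by (simp add: k_def)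
    ultimately have "\<eta> * (y \<bullet> e - t) < w y" unfolding w_def by linarith
    also have "w y < inverse (real (Suc (r n))) * (y \<bullet> e - t)" using Y(2)[of "r n"] by (simp add: y_def)
    also have "\<dots> < \<eta> * (y \<bullet> e - t)"
      using n(2) k by (intro mult_strict_right_mono) (auto simp: k_def)
    finally show False .
  qed
qed

text \<open>What remains is a plane orthogonal to the frontier, so that the centre of an interior
  ball lies on the plane. On the half ball Serrin's barrier forces \<open>w\<close> to grow like
  \<open>\<kappa> * s\<^sup>2\<close> along the inward diagonal, whereas
  \<open>corner_second_order\<close> allows only half of that.\<close>

lemma gradient_on_plane_frontier:
  assumes e: "norm e = 1" and t: "0 < t" and P: "dominated e t"
    and x: "x \<in> frontier \<Omega>" "x \<bullet> e = t"
  shows "g x \<bullet> e < 0"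
proof (rule ccontr)
  assume "\<not> g x \<bullet> e < 0"
  then have "g x \<bullet> e = 0" using normal_on_plane_nonneg[OF e t P x] by simp
  then have nue: "\<nu> x \<bullet> e = 0" using beta by (simp add: g_frontier[OF x(1)])
  define q where "q = (2 * t) *\<^sub>R e"
  define w where "w = (\<lambda>y. u (reflect e t y) - u y)"
  have ee: "e \<bullet> e = 1" using e by (simp add: norm_eq_1)
  have nu: "norm (\<nu> x) = 1" "\<nu> x \<bullet> \<nu> x = 1" using normal[OF x(1)] by (auto simp: norm_eq_1)
  have "q \<bullet> e = 2 * t" by (simp add: q_def ee)
  then have xS: "x \<in> - {0, q}" using x t by auto
  have oS: "open (- {0, q})" by (intro open_Compl) auto
  obtain R where R: "0 < R" "cball (x - R *\<^sub>R \<nu> x) R \<subseteq> - {0, q}" "cball (x - R *\<^sub>R \<nu> x) R - {x} \<subseteq> \<Omega>"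
    using interior_ball[OF x(1) oS xS] by metis
  define c where "c = x - R *\<^sub>R \<nu> x"
  have ce: "c \<bullet> e = t" by (simp add: c_def inner_diff_left x nue)
  have dcx: "dist c x = R" using R nu by (simp add: c_def dist_norm)
  have in\<Omega>: "y \<in> \<Omega>" if "y \<in> cball c R" "y \<noteq> x" for y using R(3) that unfolding c_def by blast
  have S: "y \<noteq> 0" "y \<noteq> q" if "y \<in> cball c R" for y using R(2) that unfolding c_def[symmetric] by blast+
  have qC: "(2 * t) *\<^sub>R e \<notin> cball c R" using S(2) unfolding q_def by blast
  obtain L where L: "0 \<le> L" "\<And>z. z \<in> cball c R \<Longrightarrow> z \<in> \<Omega> \<Longrightarrow> t < z \<bullet> e \<Longrightarrow> \<exists>l\<le>L * w z. lap_at w z l"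
    using cap_supersolution[OF e t P closed_cball qC] unfolding w_def by metis
  obtain a where a: "0 < a"
    and lap_barrier: "\<And>p. R / 2 \<le> dist c p \<Longrightarrow> 0 < (p - c) \<bullet> e \<Longrightarrow>
       \<exists>l. L * (((p - c) \<bullet> e) * (exp (- a * (dist c p)\<^sup>2) - exp (- a * R\<^sup>2))) < l \<and>
           lap_at (\<lambda>y. ((y - c) \<bullet> e) * (exp (- a * (dist c y)\<^sup>2) - exp (- a * R\<^sup>2))) p l"
    by (rule serrin_barrier[OF R(1) L(1), of c e]) (rule that)
  define \<zeta> where "\<zeta> = (\<lambda>y. ((y - c) \<bullet> e) * (exp (- a * (dist c y)\<^sup>2) - exp (- a * R\<^sup>2)))"
  have wpos: "0 < w y" if "y \<in> cball c R" "t < y \<bullet> e" for y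
  proof -
    have "y \<noteq> x" using that x by auto
    then have "y \<in> \<Omega>" using in\<Omega> that by blast
    then show ?thesis using strict_in_cap[OF e t P, of y] that S[OF that(1)] by (simp add: w_def q_def)
  qed
  have w0: "w y = 0" if "y \<bullet> e = t" for y using that by (simp add: w_def reflect_fixed)
  \<comment> \<open>The inner cut of the comparison region. It keeps distance \<open>R / 2\<close>
    from \<open>x\<close>, the only point of the closed ball off \<open>\<Omega>\<close> that could
    occur, so it is a compact subset of \<open>\<Omega>\<close>.\<close>
  define K where "K = cball c R \<inter> ({y. t \<le> y \<bullet> e} \<inter> sphere x (R / 2))"
  have "closed ({y. t \<le> y \<bullet> e} \<inter> sphere x (R / 2))"
    by (intro closed_Int closed_Collect_le continuous_intros closed_sphere)
  then have cK: "compact K" unfolding K_def by (intro compact_Int_closed compact_cball)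
  have "y \<noteq> x" if "y \<in> K" for y using that R(1) by (auto simp: K_def)
  then have K\<Omega>: "K \<subseteq> \<Omega>" using in\<Omega> by (auto simp: K_def)
  have qK: "(2 * t) *\<^sub>R e \<notin> K" using qC by (auto simp: K_def)
  obtain c0 where c0: "0 < c0" "\<And>y. y \<in> K \<Longrightarrow> c0 * (y \<bullet> e - t) \<le> w y"
    using linear_lower_bound_near_plane[OF e t P cK K\<Omega> qK] unfolding w_def K_def by blast
  \<comment> \<open>Points within \<open>R / 2\<close> of \<open>x\<close> are at least
    \<open>R / 2\<close> from \<open>c\<close>, as \<open>serrin_barrier\<close> requires. On the
    frontier of \<open>A\<close> the barrier vanishes on the sphere and on the plane, and
    \<open>K\<close> is covered by \<open>c0\<close>.\<close>
  define A where "A = ball c R \<inter> ({y. t < y \<bullet> e} \<inter> ball x (R / 2))"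
  have oA: "open A" unfolding A_def by (intro open_Int open_Collect_less continuous_intros open_ball)
  have "closed (cball c R \<inter> ({y. t \<le> y \<bullet> e} \<inter> cball x (R / 2)))"
    by (intro closed_Int closed_Collect_le continuous_intros closed_cball)
  moreover have "A \<subseteq> cball c R \<inter> ({y. t \<le> y \<bullet> e} \<inter> cball x (R / 2))" by (auto simp: A_def)
  ultimately have clA: "closure A \<subseteq> cball c R \<inter> ({y. t \<le> y \<bullet> e} \<inter> cball x (R / 2))"
    by (intro closure_minimal)
  have zeta_le: "\<zeta> y \<le> y \<bullet> e - t" if "t \<le> y \<bullet> e" for y
  proof -
    have "exp (- a * (dist c y)\<^sup>2) \<le> 1" using a by simp
    then have "exp (- a * (dist c y)\<^sup>2) - exp (- a * R\<^sup>2) \<le> 1" using exp_gt_zero[of "- a * R\<^sup>2"] by linarith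
    then have "((y - c) \<bullet> e) * (exp (- a * (dist c y)\<^sup>2) - exp (- a * R\<^sup>2)) \<le> ((y - c) \<bullet> e) * 1"
      using that ce by (intro mult_left_mono) (auto simp: inner_diff_left)
    then show ?thesis by (simp add: \<zeta>_def inner_diff_left ce)
  qed
  have barrier: "0 \<le> w y - c0 * \<zeta> y" if y: "y \<in> A" for y
  proof (rule comparison_principle[OF oA _ _ _ _ y])
    show "bounded A" by (rule bounded_subset[OF bounded_ball[of c R]]) (auto simp: A_def)
    show "continuous_on (closure A) (\<lambda>y. w y - c0 * \<zeta> y)"
    proof (rule continuous_at_imp_continuous_on, rule ballI)
      fix z assume "z \<in> closure A"
      then have "z \<in> cball c R" using clA by blast
      then have "isCont w z" unfolding w_def
        using S[of z] by (intro isCont_difference e) (auto simp: q_def)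
      moreover have "isCont \<zeta> z" unfolding \<zeta>_def by (intro continuous_intros)
      ultimately show "isCont (\<lambda>y. w y - c0 * \<zeta> y) z" by (intro continuous_intros)
    qed
    show "0 \<le> w z - c0 * \<zeta> z" if "z \<in> frontier A" for z
    proof -
      have z: "z \<in> closure A" "z \<notin> A" using that oA by (auto simp: frontier_def interior_open)
      have z1: "z \<in> cball c R" "t \<le> z \<bullet> e" "z \<in> cball x (R / 2)" using clA z(1) by auto
      consider "dist c z = R" | "z \<bullet> e = t" | "dist x z = R / 2"
        using z1 z(2) unfolding A_def by fastforce
      then show ?thesis
      proof cases
        case 1
        then have "\<zeta> z = 0" by (simp add: \<zeta>_def)
        moreover have "0 \<le> w z" using wpos[OF z1(1)] w0[of z] z1(2) by (cases "z \<bullet> e = t") auto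
        ultimately show ?thesis by simp
      next
        case 2
        then show ?thesis by (simp add: w0 \<zeta>_def inner_diff_left ce)
      next
        case 3
        then have "z \<in> K" using z1 by (simp add: K_def)
        then have "c0 * (z \<bullet> e - t) \<le> w z" by (rule c0(2))
        moreover have "c0 * \<zeta> z \<le> c0 * (z \<bullet> e - t)" using zeta_le[OF z1(2)] c0 by simp
        ultimately show ?thesis by simp
      qed
    qed
    show "\<exists>l<0. lap_at (\<lambda>y. w y - c0 * \<zeta> y) z l" if z: "z \<in> A" "w z - c0 * \<zeta> z < 0" for z
    proof -
      have z1: "z \<in> cball c R" "t < z \<bullet> e" "dist x z < R / 2" using z(1) by (auto simp: A_def)
      have "z \<noteq> x" using z1 x by auto
      then have "z \<in> \<Omega>" using in\<Omega> z1 by blast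
      then obtain l where l: "l \<le> L * w z" "lap_at w z l" using L(2)[OF z1(1)] z1 by blast
      have "R / 2 \<le> dist c z" using dist_triangle[of c x z] dcx z1(3) by (simp add: dist_commute)
      moreover have "0 < (z - c) \<bullet> e" using z1 ce by (simp add: inner_diff_left)
      ultimately obtain k where k: "L * \<zeta> z < k" "lap_at \<zeta> z k"
        using lap_barrier[of z] unfolding \<zeta>_def by blast
      have "lap_at (\<lambda>y. w y - c0 * \<zeta> y) z (l - c0 * k)" by (intro lap_at_diff lap_at_cmult l k)
      moreover have "l - c0 * k < 0"
      proof -
        have "c0 * (L * \<zeta> z) < c0 * k" using c0 k by simp
        then have "l - c0 * k < L * (w z - c0 * \<zeta> z)" using l by (simp add: algebra_simps)
        also have "\<dots> \<le> 0" using L z by (simp add: mult_nonneg_nonpos)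
        finally show ?thesis .
      qed
      ultimately show ?thesis by blast
    qed
  qed
  \<comment> \<open>On the diagonal the linear factor of \<open>\<zeta>\<close> is \<open>s\<close>,
    and the exponential one is at least \<open>exp (- a * R\<^sup>2) * (a * (R * s))\<close>,
    because \<open>2 * R * s - 2 * s\<^sup>2 \<ge> R * s\<close> for small \<open>s\<close>.\<close>
  define \<kappa> where "\<kappa> = c0 * (exp (- a * R\<^sup>2) * (a * R))"
  have kap: "0 < \<kappa>" using c0 a R by (simp add: \<kappa>_def)
  have k2: "0 < \<kappa> / 2" using kap by simp
  have nC: "0 \<notin> cball (x - R *\<^sub>R \<nu> x) R" using S(1)[of 0] unfolding c_def by blast
  obtain d where d: "0 < d"
    "\<And>s. 0 < s \<Longrightarrow> s < d \<Longrightarrow> \<bar>u (x + s *\<^sub>R (- \<nu> x - e)) - u (x + s *\<^sub>R (- \<nu> x + e))\<bar> \<le> \<kappa> / 2 * s\<^sup>2"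
    using corner_second_order[OF e x(1) nue R(1) nC R(3) k2] by metis
  \<comment> \<open>The direction has norm at most 2, so \<open>s < R / 4\<close> keeps
    \<open>y\<close> within \<open>R / 2\<close> of \<open>x\<close>.\<close>
  define s where "s = min d (R / 4) / 2"
  have R4: "0 < R / 4" using R by simp
  have s: "0 < s" "s < d" "s < R / 4" unfolding s_def by (rule half_min[OF d(1) R4])+
  define y where "y = x + s *\<^sub>R (- \<nu> x + e)"
  have ye: "y \<bullet> e = t + s" by (simp add: y_def inner_add_left inner_diff_left x nue ee)
  have "e \<bullet> \<nu> x = 0" using nue by (simp add: inner_commute)
  then have sq: "(norm (A *\<^sub>R \<nu> x - B *\<^sub>R e))\<^sup>2 = A\<^sup>2 + B\<^sup>2" for A B
    unfolding power2_norm_eq_inner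
    by (simp add: inner_diff_left inner_diff_right nu nue ee power2_eq_square)
  have cy: "c - y = (s - R) *\<^sub>R \<nu> x - s *\<^sub>R e" by (simp add: c_def y_def algebra_simps)
  have dcy: "(dist c y)\<^sup>2 = R\<^sup>2 - 2 * R * s + 2 * s\<^sup>2"
    unfolding dist_norm cy sq by (simp add: power2_eq_square algebra_simps)
  have "s * s < R * s" using s R by (intro mult_strict_right_mono) auto
  then have "(dist c y)\<^sup>2 < R\<^sup>2" unfolding dcy by (simp add: power2_eq_square)
  then have dcy': "dist c y < R" using R by (simp add: power2_less_imp_less)
  have "norm (- \<nu> x + e) \<le> 2" using norm_triangle_ineq[of "- \<nu> x" e] nu e by simp
  then have "s * norm (- \<nu> x + e) \<le> s * 2" using s by (intro mult_left_mono) auto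
  moreover have "dist x y = s * norm (- \<nu> x + e)" using s(1) by (simp add: y_def dist_norm)
  ultimately have "dist x y < R / 2" using s by linarith
  then have yA: "y \<in> A" using dcy' ye s by (simp add: A_def)
  have "reflect e t y = x + s *\<^sub>R (- \<nu> x - e)"
    by (simp add: reflect_def ye) (simp add: y_def algebra_simps flip: scaleR_add_left)
  then have "w y = u (x + s *\<^sub>R (- \<nu> x - e)) - u (x + s *\<^sub>R (- \<nu> x + e))"
    unfolding w_def by (simp only: y_def)
  then have "w y \<le> \<kappa> / 2 * s\<^sup>2" using d(2)[OF s(1,2)] by linarith
  moreover have "\<kappa> * s\<^sup>2 \<le> c0 * \<zeta> y"
  proof -
    have "2 * s * s \<le> R * s" using s by (intro mult_right_mono) auto
    then have "a * (R * s) \<le> a * (2 * R * s - 2 * s\<^sup>2)"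
      using a by (intro mult_left_mono) (auto simp: power2_eq_square)
    also have "\<dots> \<le> exp (a * (2 * R * s - 2 * s\<^sup>2)) - 1"
      using exp_ge_add_one_self[of "a * (2 * R * s - 2 * s\<^sup>2)"] by linarith
    finally have "exp (- a * R\<^sup>2) * (a * (R * s)) \<le> exp (- a * R\<^sup>2) * (exp (a * (2 * R * s - 2 * s\<^sup>2)) - 1)"
      by (intro mult_left_mono) auto
    also have "\<dots> = exp (- a * (dist c y)\<^sup>2) - exp (- a * R\<^sup>2)"
      unfolding dcy by (simp add: algebra_simps flip: exp_add)
    finally have "s * (exp (- a * R\<^sup>2) * (a * (R * s))) \<le> s * (exp (- a * (dist c y)\<^sup>2) - exp (- a * R\<^sup>2))"
      using s by (intro mult_left_mono) auto
    also have "\<dots> = \<zeta> y" by (simp add: \<zeta>_def inner_diff_left ce ye)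
    finally have "c0 * (s * (exp (- a * R\<^sup>2) * (a * (R * s)))) \<le> c0 * \<zeta> y" using c0 by simp
    then show ?thesis by (simp add: \<kappa>_def power2_eq_square mult_ac)
  qed
  ultimately have "\<kappa> * s\<^sup>2 \<le> \<kappa> / 2 * s\<^sup>2" using barrier[OF yA] by linarith
  moreover have "0 < \<kappa> * s\<^sup>2" using kap s by simp
  ultimately show False by simp
qed

lemma gradient_on_plane:
  assumes "norm e = 1" "0 < t" "dominated e t" "x \<in> closure \<Omega>" "x \<bullet> e = t"
  shows "g x \<bullet> e < 0"
  using gradient_on_plane_inside gradient_on_plane_frontier frontierI assms by blast

end

section \<open>Moving the plane to the origin\<close>

context singular_serrin
begin

text \<open>Violations survive in the limit as a non-strict inequality, which strictness in the
  closed cap then contradicts; the limit points must avoid the two singularities for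
  \<open>u\<close> to be continuous there.\<close>

lemma not_dominated_limit:
  assumes e: "norm e = 1" and S: "S \<longlonglongrightarrow> t" and Z: "Z \<longlonglongrightarrow> z"
    and z: "z \<noteq> 0" "z \<noteq> (2 * t) *\<^sub>R e"
    and lt: "\<And>n. u (reflect e (S n) (Z n)) < u (Z n)"
  shows "u (reflect e t z) \<le> u z"
proof -
  have lim: "(\<lambda>n. reflect e (S n) (Z n)) \<longlonglongrightarrow> reflect e t z" by (intro tendsto_intros S Z)
  have "isCont u (reflect e t z)" using z reflect_eq_0_iff[OF e] by (intro u_isCont) auto
  then have "(\<lambda>n. u (reflect e (S n) (Z n))) \<longlonglongrightarrow> u (reflect e t z)"
    using lim by (rule isCont_tendsto_compose)
  moreover have "(\<lambda>n. u (Z n)) \<longlonglongrightarrow> u z"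
    by (rule isCont_tendsto_compose[OF u_isCont[OF z(1)] Z])
  ultimately show ?thesis
  proof (rule LIMSEQ_le, intro exI allI impI)
    show "u (reflect e (S n) (Z n)) \<le> u (Z n)" for n using lt[of n] by simp
  qed
qed

lemma convergent_parameters:
  assumes "0 \<le> c" "\<And>n. t - c * inverse (real (Suc n)) < S n" "\<And>n. S n \<le> t"
  shows "S \<longlonglongrightarrow> t"
proof (rule tendsto_sandwich[of "\<lambda>n. t - c * inverse (real (Suc n))" S sequentially "\<lambda>_. t"])
  have "(\<lambda>n. t - c * inverse (real (Suc n))) \<longlonglongrightarrow> t - c * 0"
    by (intro tendsto_intros LIMSEQ_inverse_real_of_nat)
  then show "(\<lambda>n. t - c * inverse (real (Suc n))) \<longlonglongrightarrow> t" by simp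
qed (use assms in \<open>auto intro!: always_eventually less_imp_le simp del: of_nat_Suc\<close>)

lemma subsequence_in_domain:
  fixes Z :: "nat \<Rightarrow> 'a"
  assumes "\<And>n. Z n \<in> \<Omega>"
  obtains r z where "strict_mono r" "(\<lambda>n. Z (r n)) \<longlonglongrightarrow> z" "z \<in> closure \<Omega>"
proof -
  have 1: "seq_compact (closure \<Omega>)"
    using dom(3) by (intro compact_imp_seq_compact) simp
  have 2: "\<forall>n. Z n \<in> closure \<Omega>" using assms closure_subset[of \<Omega>] by blast
  show ?thesis
  proof (rule seq_compactE[OF 1 2])
    fix z and r :: "nat \<Rightarrow> nat"
    assume "z \<in> closure \<Omega>" "strict_mono r" "(Z \<circ> r) \<longlonglongrightarrow> z"
    then show thesis using that[of r z] by (simp add: o_def)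
  qed
qed

text \<open>The excluded point moves with the plane, and near it no continuity of the reflected
  function is at hand. On a sphere of fixed radius about it strictness at \<open>t\<close> persists
  for nearby planes by compactness; inside, the singular maximum principle applies.\<close>

lemma dominated_near_reflected_singularity:
  assumes e: "norm e = 1" and t: "0 < t" and P: "dominated e t"
  obtains \<eta> r where "0 < \<eta>" "0 < r"
    "\<And>s z. t - \<eta> < s \<Longrightarrow> s \<le> t \<Longrightarrow> z \<in> ball ((2 * s) *\<^sub>R e) r - {(2 * s) *\<^sub>R e} \<Longrightarrow> u z \<le> u (reflect e s z)"
proof -
  have ee: "e \<bullet> e = 1" using e by (simp add: norm_eq_1)
  obtain r1 where r1: "0 < r1" "ball 0 r1 \<subseteq> \<Omega>" using dom open_contains_ball_eq by blast
  obtain B where B: "0 < B" "\<And>x. t \<le> norm x \<Longrightarrow> u x \<le> B" using u_bounded[OF t] by blast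
  obtain L where L: "0 \<le> L"
      "\<And>e t y. norm e = 1 \<Longrightarrow> y \<in> \<Omega> - {0} \<Longrightarrow> reflect e t y \<in> \<Omega> - {0} \<Longrightarrow> u y \<le> B \<Longrightarrow> u (reflect e t y) \<le> B \<Longrightarrow>
       \<exists>l. \<bar>l\<bar> \<le> L * \<bar>u (reflect e t y) - u y\<bar> \<and> lap_at (\<lambda>y. u (reflect e t y) - u y) y l \<and>
           lap_at (\<lambda>y. u y - u (reflect e t y)) y (- l)"
    using lap_comparison[of B] by blast
  \<comment> \<open>The entries keep the mirror image of the ball in \<open>\<Omega>\<close>, the
    ball itself away from the origin, and \<open>r\<close> within the range of the singular maximum
    principle.\<close>
  define m where "m = Min {r1, t / 2, 2 / (32 * (L + 1))}"
  define r where "r = m / 2"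
  have "0 < m" "m \<le> r1" "m \<le> t / 2" "m \<le> 2 / (32 * (L + 1))" using r1 t L by (auto simp: m_def)
  then have r: "0 < r" "r < r1" "r \<le> t / 4" "r \<le> 1 / (32 * (L + 1))" by (auto simp: r_def)
  have below: "2 * s - r \<le> z \<bullet> e" if "dist ((2 * s) *\<^sub>R e) z \<le> r" for s z
  proof -
    have "((2 * s) *\<^sub>R e - z) \<bullet> e \<le> norm ((2 * s) *\<^sub>R e - z) * norm e" by (rule norm_cauchy_schwarz)
    then have "((2 * s) *\<^sub>R e - z) \<bullet> e \<le> r" using that e by (simp add: dist_norm)
    then show ?thesis by (simp add: inner_diff_left ee)
  qed
  \<comment> \<open>If this failed for all \<open>n\<close>, violating points on the spheres would
    converge to one on the sphere for \<open>t\<close>, in the closed cap and off the reflected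
    singularity.\<close>
  have "\<exists>n. \<forall>s z. t - t / 4 * inverse (real (Suc n)) < s \<longrightarrow> s \<le> t \<longrightarrow> dist ((2 * s) *\<^sub>R e) z = r \<longrightarrow> u z \<le> u (reflect e s z)"
  proof (rule ccontr)
    assume "\<not> ?thesis"
    then have "\<forall>n. \<exists>s z. t - t / 4 * inverse (real (Suc n)) < s \<and> s \<le> t \<and> dist ((2 * s) *\<^sub>R e) z = r \<and> u (reflect e s z) < u z"
      by (simp only: not_ex not_all not_imp not_le simp_thms)
    then obtain S Z where SZ: "\<And>n. t - t / 4 * inverse (real (Suc n)) < S n" "\<And>n. S n \<le> t"
      "\<And>n. dist ((2 * S n) *\<^sub>R e) (Z n) = r" "\<And>n. u (reflect e (S n) (Z n)) < u (Z n)"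
      by metis
    have St: "S \<longlonglongrightarrow> t" by (rule convergent_parameters[OF _ SZ(1,2)]) (use t in simp)
    have "Z n \<in> \<Omega>" for n
    proof -
      have "Z n \<noteq> (2 * S n) *\<^sub>R e" using SZ(3)[of n] r by auto
      then have "0 \<le> u (reflect e (S n) (Z n))" using reflect_eq_0_iff[OF e] by (intro u_nonneg) auto
      then show ?thesis using SZ(4)[of n] by (intro u_pos_imp_in) linarith
    qed
    then obtain \<rho> z where z: "strict_mono \<rho>" "(\<lambda>n. Z (\<rho> n)) \<longlonglongrightarrow> z" "z \<in> closure \<Omega>"
      using subsequence_in_domain by blast
    have St': "(\<lambda>n. S (\<rho> n)) \<longlonglongrightarrow> t" using LIMSEQ_subseq_LIMSEQ[OF St z(1)] by (simp add: o_def)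
    have "(\<lambda>n. dist ((2 * S (\<rho> n)) *\<^sub>R e) (Z (\<rho> n))) \<longlonglongrightarrow> dist ((2 * t) *\<^sub>R e) z"
      by (intro tendsto_intros St' z)
    then have dz: "dist ((2 * t) *\<^sub>R e) z = r" by (simp add: SZ(3) LIMSEQ_const_iff)
    then have zt: "t < z \<bullet> e" "z \<noteq> (2 * t) *\<^sub>R e" using below[of t z] r t by auto
    then have z0: "z \<noteq> 0" using t by auto
    have "u (reflect e t z) \<le> u z" by (rule not_dominated_limit[OF e St' z(2) z0 zt(2) SZ(4)])
    then show False using strict_in_closed_cap[OF e t P z(3) zt] by simp
  qed
  then obtain n where n: "\<And>s z. t - t / 4 * inverse (real (Suc n)) < s \<Longrightarrow> s \<le> t \<Longrightarrow>
      dist ((2 * s) *\<^sub>R e) z = r \<Longrightarrow> u z \<le> u (reflect e s z)" by blast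
  \<comment> \<open>With \<open>s\<close> above three quarters of \<open>t\<close> and
    \<open>r \<le> t / 4\<close>, the ball about \<open>(2 * s) *\<^sub>R e\<close> has distance at
    least \<open>t\<close> from the origin, where \<open>B\<close> bounds \<open>u\<close>.\<close>
  define \<eta> where "\<eta> = t / 4 * inverse (real (Suc n))"
  have "inverse (real (Suc n)) \<le> 1" by (simp add: inverse_le_1_iff)
  then have eta: "0 < \<eta>" "\<eta> \<le> t / 4"
    unfolding \<eta>_def using t mult_left_mono[of "inverse (real (Suc n))" 1 "t / 4"] by auto
  show ?thesis
  proof (rule that[OF eta(1) r(1)])
    fix s z assume s: "t - \<eta> < s" "s \<le> t" and z: "z \<in> ball ((2 * s) *\<^sub>R e) r - {(2 * s) *\<^sub>R e}"
    define c where "c = (2 * s) *\<^sub>R e"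
    define m where "m = (\<lambda>y. u y - u (reflect e s y))"
    have Rc: "reflect e s c = 0" using reflect_eq_0_iff[OF e] by (simp add: c_def)
    have far: "t \<le> norm y" "y \<noteq> 0" if "y \<in> cball c r" for y
    proof -
      have "2 * s - r \<le> y \<bullet> e" using below[of s y] that by (simp add: c_def)
      moreover have "y \<bullet> e \<le> norm y" using norm_cauchy_schwarz[of y e] e by simp
      ultimately show "t \<le> norm y" using s eta r t by linarith
      then show "y \<noteq> 0" using t by auto
    qed
    have Rnz: "reflect e s y \<noteq> 0" if "y \<noteq> c" for y using reflect_eq_0_iff[OF e] that by (auto simp: c_def)
    have "m z \<le> 0"
    proof (rule singular_maximum_principle[where c = c and r = r and L = L and B = B and m = m])
      show "2 \<le> DIM('a)" by (rule dim)
      show "0 \<le> L" "0 < r" "r \<le> 1 / (32 * (L + 1))" by fact+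
      show "continuous_on (cball c r - {c}) m"
      proof (rule continuous_at_imp_continuous_on, rule ballI)
        fix y assume y: "y \<in> cball c r - {c}"
        show "isCont m y" unfolding m_def
          using far[of y] y by (intro continuous_diff isCont_reflected u_isCont e) (auto simp: c_def)
      qed
      show "m y \<le> B" if "y \<in> cball c r - {c}" for y
        using B(2)[of y] far[of y] u_nonneg[OF Rnz[of y]] that by (auto simp: m_def)
      show "m y \<le> 0" if "dist c y = r" for y
        using n[of s y] that s by (simp add: m_def \<eta>_def c_def del: of_nat_Suc)
      show "z \<in> ball c r - {c}" using z by (simp add: c_def)
      show "\<exists>l\<ge>- L * m y. lap_at m y l" if y: "y \<in> ball c r - {c}" "0 < m y" for y
      proof -
        have y1: "y \<in> cball c r" "y \<noteq> c" using y by auto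
        have "dist (reflect e s y) 0 = dist y c" using dist_reflect[OF e, of s y c] Rc by simp
        then have "reflect e s y \<in> ball 0 r1" using y r by (simp add: dist_commute)
        then have R: "reflect e s y \<in> \<Omega> - {0}" using r1 Rnz[OF y1(2)] by blast
        have lt: "u (reflect e s y) < u y" using y by (simp add: m_def)
        then have "0 < u y" using u_pos[OF R] by linarith
        then have y\<Omega>: "y \<in> \<Omega> - {0}" using u_pos_imp_in far(2)[OF y1(1)] by blast
        \<comment> \<open>The reflected values may be unbounded near \<open>c\<close>, but where
          \<open>m\<close> is positive they are below \<open>u y\<close>, so the Lipschitz constant
          for \<open>B\<close> applies.\<close>
        have "u y \<le> B" using B(2) far(1)[OF y1(1)] by blast
        moreover from this have "u (reflect e s y) \<le> B" using lt by linarith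
        ultimately obtain l where l: "\<bar>l\<bar> \<le> L * \<bar>u (reflect e s y) - u y\<bar>" "lap_at (\<lambda>y. u y - u (reflect e s y)) y (- l)"
          using L(2)[OF e y\<Omega> R] by blast
        have "\<bar>u (reflect e s y) - u y\<bar> = m y" using lt by (simp add: m_def)
        then have "- L * m y \<le> - l" using l(1) by simp
        then show ?thesis using l(2) unfolding m_def by blast
      qed
    qed
    then show "u z \<le> u (reflect e s z)" by (simp add: m_def)
  qed
qed

text \<open>Violations for planes tending to \<open>t\<close> converge to a point of the closure
  with \<open>t \<le> y \<bullet> e\<close>. Beyond the plane this contradicts strictness; on the
  plane \<open>u\<close> is strictly decreasing along \<open>e\<close> nearby, while a violating
  pair increases.\<close>

lemma dominated_below:
  assumes e: "norm e = 1" and t: "0 < t" and P: "dominated e t"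
  obtains \<eta> where "0 < \<eta>" "\<And>s. t - \<eta> < s \<Longrightarrow> s \<le> t \<Longrightarrow> dominated e s"
proof (rule ccontr)
  assume contra: "\<not> thesis"
  obtain \<eta> \<rho> where \<eta>: "0 < \<eta>" "0 < \<rho>"
    "\<And>s z. t - \<eta> < s \<Longrightarrow> s \<le> t \<Longrightarrow> z \<in> ball ((2 * s) *\<^sub>R e) \<rho> - {(2 * s) *\<^sub>R e} \<Longrightarrow> u z \<le> u (reflect e s z)"
    using dominated_near_reflected_singularity[OF e t P] by blast
  define c where "c = min \<eta> t"
  have c: "0 < c" "c \<le> \<eta>" using \<eta> t by (auto simp: c_def)
  have "\<exists>s y. t - c * inverse (real (Suc n)) < s \<and> s \<le> t \<and> s < y \<bullet> e \<and> y \<noteq> (2 * s) *\<^sub>R e \<and> u (reflect e s y) < u y" for n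
  proof (rule ccontr)
    assume no: "\<not> ?thesis"
    have "0 < c * inverse (real (Suc n))" using c by simp
    then have "\<exists>s. t - c * inverse (real (Suc n)) < s \<and> s \<le> t \<and> \<not> dominated e s"
      using contra that by blast
    then show False using no unfolding dominated_def by (auto simp: not_le)
  qed
  then obtain S Y where SY: "\<And>n. t - c * inverse (real (Suc n)) < S n" "\<And>n. S n \<le> t" "\<And>n. S n < Y n \<bullet> e"
    "\<And>n. Y n \<noteq> (2 * S n) *\<^sub>R e" "\<And>n. u (reflect e (S n) (Y n)) < u (Y n)"
    by metis
  have St: "S \<longlonglongrightarrow> t" by (rule convergent_parameters[OF _ SY(1,2)]) (use c in simp)
  \<comment> \<open>The preceding lemma keeps violations away from the moving point
    \<open>(2 * s) *\<^sub>R e\<close>, so their limit is not the reflected singularity.\<close>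
  have far: "\<rho> \<le> dist ((2 * S n) *\<^sub>R e) (Y n)" for n
  proof (rule ccontr)
    assume "\<not> ?thesis"
    then have "Y n \<in> ball ((2 * S n) *\<^sub>R e) \<rho> - {(2 * S n) *\<^sub>R e}" using SY(4) by simp
    moreover have "c * inverse (real (Suc n)) \<le> c * 1"
      using c by (intro mult_left_mono) (auto simp: inverse_le_1_iff)
    then have "t - \<eta> < S n" using SY(1)[of n] c by linarith
    ultimately have "u (Y n) \<le> u (reflect e (S n) (Y n))" using \<eta>(3) SY(2) by blast
    then show False using SY(5)[of n] by simp
  qed
  have "Y n \<in> \<Omega>" for n
  proof -
    have "0 \<le> u (reflect e (S n) (Y n))" using reflect_eq_0_iff[OF e] SY(4) by (intro u_nonneg) auto
    then show ?thesis using SY(5)[of n] by (intro u_pos_imp_in) linarith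
  qed
  then obtain r y where y: "strict_mono r" "(\<lambda>n. Y (r n)) \<longlonglongrightarrow> y" "y \<in> closure \<Omega>"
    using subsequence_in_domain by blast
  have Y\<Omega>: "Y n \<in> \<Omega>" for n by fact
  have St': "(\<lambda>n. S (r n)) \<longlonglongrightarrow> t" using LIMSEQ_subseq_LIMSEQ[OF St y(1)] by (simp add: o_def)
  have "(\<lambda>n. dist ((2 * S (r n)) *\<^sub>R e) (Y (r n))) \<longlonglongrightarrow> dist ((2 * t) *\<^sub>R e) y"
    by (intro tendsto_intros St' y)
  then have "\<rho> \<le> dist ((2 * t) *\<^sub>R e) y" by (rule LIMSEQ_le_const) (use far in blast)
  then have yq: "y \<noteq> (2 * t) *\<^sub>R e" using \<eta> by auto
  have "(\<lambda>n. Y (r n) \<bullet> e) \<longlonglongrightarrow> y \<bullet> e" by (intro tendsto_intros y)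
  with St' have yt: "t \<le> y \<bullet> e"
  proof (rule LIMSEQ_le, intro exI allI impI)
    show "S (r n) \<le> Y (r n) \<bullet> e" for n using SY(3)[of "r n"] by simp
  qed
  have y0: "y \<noteq> 0" using yt t by auto
  show False
  proof (cases "t < y \<bullet> e")
    case True
    have "u (reflect e t y) \<le> u y" by (rule not_dominated_limit[OF e St' y(2) y0 yq SY(5)])
    then show False using strict_in_closed_cap[OF e t P y(3) True yq] by simp
  next
    case False
    then have ye: "y \<bullet> e = t" using yt by simp
    have neg: "g y \<bullet> e < 0" by (rule gradient_on_plane[OF e t P y(3) ye])
    then have pos: "0 < - (g y \<bullet> e)" by simp
    have yc: "y \<in> closure \<Omega> - {0}" using y y0 by simp
    obtain d where d: "0 < d" "\<And>z. z \<in> closure \<Omega> - {0} \<Longrightarrow> dist z y < d \<Longrightarrow> norm (g z - g y) < - (g y \<bullet> e)"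
      using g_close[OF yc pos] by blast
    define b where "b = min d (norm y)"
    have b: "0 < b" "b \<le> d" "0 \<notin> ball y b" using d y0 by (auto simp: b_def)
    have inc: "g z \<bullet> e < 0" if "z \<in> closure \<Omega> \<inter> ball y b" for z
    proof -
      have "z \<noteq> 0" using that b(3) by blast
      then have "z \<in> closure \<Omega> - {0}" "dist z y < d" using that b(2) by (auto simp: dist_commute)
      then have "norm (g z - g y) < - (g y \<bullet> e)" by (rule d(2))
      moreover have "\<bar>(g z - g y) \<bullet> e\<bar> \<le> norm (g z - g y) * norm e" by (rule Cauchy_Schwarz_ineq2)
      ultimately have "\<bar>g z \<bullet> e - g y \<bullet> e\<bar> < - (g y \<bullet> e)" using e by (simp add: inner_diff_left)
      then show ?thesis by linarith
    qed
    have "(\<lambda>n. reflect e (S (r n)) (Y (r n))) \<longlonglongrightarrow> reflect e t y" by (intro tendsto_intros St' y)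
    then have "\<forall>\<^sub>F n in sequentially. dist (reflect e (S (r n)) (Y (r n))) y < b"
      using tendstoD[OF _ b(1)] by (simp add: reflect_fixed[OF ye])
    moreover have "\<forall>\<^sub>F n in sequentially. dist (Y (r n)) y < b" using y(2) b(1) by (rule tendstoD)
    ultimately have "\<forall>\<^sub>F n in sequentially. dist (reflect e (S (r n)) (Y (r n))) y < b \<and> dist (Y (r n)) y < b"
      by eventually_elim simp
    then obtain n where n: "dist (reflect e (S (r n)) (Y (r n))) y < b" "dist (Y (r n)) y < b"
      using eventually_happens by fastforce
    \<comment> \<open>The mirror image is reached by going back a distance \<open>k\<close>.
      Starting inside \<open>\<Omega>\<close>, \<open>increasing_along_segment\<close> also covers
      the question whether the way leaves the domain.\<close>
    define k where "k = 2 * (Y (r n) \<bullet> e - S (r n))"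
    have k: "0 < k" using SY(3)[of "r n"] by (simp add: k_def)
    have R: "Y (r n) + (- k) *\<^sub>R e = reflect e (S (r n)) (Y (r n))"
      by (simp add: reflect_def k_def algebra_simps)
    have "u (Y (r n)) < u (Y (r n) + (- k) *\<^sub>R e)"
    proof (rule increasing_along_segment[OF b(3) Y\<Omega>])
      show "Y (r n) \<in> ball y b" "Y (r n) + (- k) *\<^sub>R e \<in> ball y b"
        unfolding R using n by (auto simp: dist_commute)
      show "0 < g z \<bullet> ((- k) *\<^sub>R e)" if "z \<in> closure \<Omega> \<inter> ball y b" for z
        using inc[OF that] k by (simp add: mult_pos_neg)
    qed
    then show False using SY(5)[of "r n"] unfolding R by simp
  qed
qed

text \<open>Beyond the domain \<open>u\<close> vanishes, so far planes are dominated. The infimum of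
  the positions from which all larger ones are dominated is again dominated, by continuity, and
  \<open>dominated_below\<close> would lower it.\<close>

lemma dominated_all:
  assumes e: "norm e = 1" and t: "0 < t"
  shows "dominated e t"
proof (rule ccontr)
  assume no: "\<not> dominated e t"
  obtain T where T: "\<And>x. x \<in> \<Omega> \<Longrightarrow> norm x \<le> T" using dom(3) bounded_iff by metis
  have "0 \<le> T" using T[OF dom(4)] by simp
  have large: "dominated e s" if "T \<le> s" for s
    unfolding dominated_def
  proof (intro allI impI)
    fix y assume y: "s < y \<bullet> e" "y \<noteq> (2 * s) *\<^sub>R e"
    have "y \<bullet> e \<le> norm y" using norm_cauchy_schwarz[of y e] e by simp
    then have "y \<notin> \<Omega>" using T[of y] y that by auto
    then have "u y = 0" by (rule u_out)
    then show "u y \<le> u (reflect e s y)" using u_nonneg[of "reflect e s y"] reflect_eq_0_iff[OF e] y by auto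
  qed
  define A where "A = {s. 0 < s \<and> (\<forall>r\<ge>s. dominated e r)}"
  \<comment> \<open>\<open>T\<close> is only known to be nonnegative; the 1 provides the strict
    positivity required in \<open>A\<close>.\<close>
  have TA: "T + 1 \<in> A" using large \<open>0 \<le> T\<close> by (auto simp: A_def)
  have lb: "t \<le> s" if "s \<in> A" for s
  proof (rule ccontr)
    assume "\<not> t \<le> s"
    then have "s \<le> t" by simp
    then show False using that no by (auto simp: A_def)
  qed
  have bdd: "bdd_below A" using lb by (rule bdd_belowI)
  define t0 where "t0 = Inf A"
  have t0: "t \<le> t0" unfolding t0_def using TA lb by (intro cInf_greatest) auto
  then have t0pos: "0 < t0" using t by simp
  have above: "dominated e s" if "t0 < s" for s
  proof -
    have "A \<noteq> {}" using TA by blast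
    moreover have "Inf A < s" using that by (simp add: t0_def)
    ultimately obtain a where "a \<in> A" "a < s" using cInf_lessD by blast
    then show ?thesis by (auto simp: A_def)
  qed
  have Pt0: "dominated e t0"
    unfolding dominated_def
  proof (intro allI impI)
    fix y assume y: "t0 < y \<bullet> e" "y \<noteq> (2 * t0) *\<^sub>R e"
    have R: "((\<lambda>s. reflect e s y) \<longlongrightarrow> reflect e t0 y) (at_right t0)" by (intro tendsto_intros)
    have "isCont u (reflect e t0 y)" using reflect_eq_0_iff[OF e] y by (intro u_isCont) auto
    then have lim: "((\<lambda>s. u (reflect e s y)) \<longlongrightarrow> u (reflect e t0 y)) (at_right t0)"
      using R by (rule isCont_tendsto_compose)
    \<comment> \<open>The excluded point moves with \<open>s\<close>, but it avoids \<open>y\<close>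
      for \<open>s\<close> close to \<open>t0\<close>.\<close>
    have "((\<lambda>s. y - (2 * s) *\<^sub>R e) \<longlongrightarrow> y - (2 * t0) *\<^sub>R e) (at_right t0)" by (intro tendsto_intros)
    then have "\<forall>\<^sub>F s in at_right t0. y - (2 * s) *\<^sub>R e \<noteq> 0"
      by (rule tendsto_imp_eventually_ne) (use y in simp)
    moreover have "\<forall>\<^sub>F s in at_right t0. s \<in> {t0<..<y \<bullet> e}"
      by (rule eventually_at_right_real[OF y(1)])
    ultimately have "\<forall>\<^sub>F s in at_right t0. u y \<le> u (reflect e s y)"
    proof eventually_elim
      case (elim s)
      then have "dominated e s" "s < y \<bullet> e" "y \<noteq> (2 * s) *\<^sub>R e" using above by auto
      then show ?case unfolding dominated_def by blast
    qed
    then show "u y \<le> u (reflect e t0 y)"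
      by (rule tendsto_lowerbound[OF lim]) simp
  qed
  obtain \<eta> where \<eta>: "0 < \<eta>" "\<And>s. t0 - \<eta> < s \<Longrightarrow> s \<le> t0 \<Longrightarrow> dominated e s"
    using dominated_below[OF e t0pos Pt0] by blast
  define s where "s = t0 - min \<eta> t0 / 2"
  have s: "0 < s" "t0 - \<eta> < s" "s < t0" using half_min[OF \<eta>(1) t0pos] by (auto simp: s_def)
  have "dominated e r" if "s \<le> r" for r
    using \<eta>(2)[of r] above[of r] that s by (cases "r \<le> t0") auto
  then have "s \<in> A" using s by (simp add: A_def)
  then have "t0 \<le> s" unfolding t0_def by (rule cInf_lower[OF _ bdd])
  then show False using s by simp
qed

text \<open>Letting \<open>s\<close> decrease to 0 turns domination into an inequality between
  \<open>y\<close> and its mirror image; the directions \<open>e\<close> and \<open>- e\<close>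
  share the plane through the origin and give both inequalities.\<close>

lemma reflection_symmetric:
  assumes e: "norm e = 1" and y: "y \<noteq> 0"
  shows "u (reflect e 0 y) = u y"
proof -
  have le: "u y \<le> u (reflect a 0 y)" if a: "norm a = 1" "0 < y \<bullet> a" "y \<noteq> 0" for a y
  proof -
    have R: "((\<lambda>s. reflect a s y) \<longlongrightarrow> reflect a 0 y) (at_right 0)" by (intro tendsto_intros)
    have "isCont u (reflect a 0 y)" using reflect_eq_0_iff[OF a(1), of 0 y] a by (intro u_isCont) auto
    then have lim: "((\<lambda>s. u (reflect a s y)) \<longlongrightarrow> u (reflect a 0 y)) (at_right 0)"
      using R by (rule isCont_tendsto_compose)
    have "((\<lambda>s. y - (2 * s) *\<^sub>R a) \<longlongrightarrow> y - (2 * 0) *\<^sub>R a) (at_right 0)" by (intro tendsto_intros)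
    then have "\<forall>\<^sub>F s in at_right 0. y - (2 * s) *\<^sub>R a \<noteq> 0"
      by (rule tendsto_imp_eventually_ne) (use a in simp)
    moreover have "\<forall>\<^sub>F s in at_right 0. s \<in> {0<..<y \<bullet> a}"
      by (rule eventually_at_right_real[OF a(2)])
    ultimately have "\<forall>\<^sub>F s in at_right 0. u y \<le> u (reflect a s y)"
    proof eventually_elim
      case (elim s)
      then have "dominated a s" "s < y \<bullet> a" "y \<noteq> (2 * s) *\<^sub>R a" using dominated_all[OF a(1)] by auto
      then show ?case unfolding dominated_def by blast
    qed
    then show ?thesis by (rule tendsto_lowerbound[OF lim]) simp
  qed
  have le': "u y \<le> u (reflect e 0 y)" if "y \<noteq> 0" for y
  proof -
    consider "0 < y \<bullet> e" | "y \<bullet> e = 0" | "0 < y \<bullet> (- e)" by fastforce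
    then show ?thesis
    proof cases
      case 1 then show ?thesis using le[OF e _ that] by blast
    next
      case 2 then show ?thesis by (simp add: reflect_fixed)
    next
      case 3
      have "u y \<le> u (reflect (- e) 0 y)" by (rule le[OF _ 3 that]) (simp add: e)
      moreover have "reflect (- e) 0 y = reflect e 0 y" by (simp add: reflect_def)
      ultimately show ?thesis by simp
    qed
  qed
  have "reflect e 0 y \<noteq> 0" using reflect_eq_0_iff[OF e, of 0 y] y by simp
  then show ?thesis using le'[OF y] le'[of "reflect e 0 y"] e by simp
qed

text \<open>Two distinct points of equal norm are exchanged by the reflection in their bisecting
  hyperplane, which passes through the origin.\<close>

lemma u_norm_eq:
  assumes "norm x = norm y" "x \<noteq> 0"
  shows "u x = u y"
proof (cases "x = y")
  case False
  define e where "e = (1 / norm (x - y)) *\<^sub>R (x - y)"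
  have nz: "norm (x - y) \<noteq> 0" using False by simp
  have e: "norm e = 1" using nz by (simp add: e_def)
  have "x \<bullet> x = y \<bullet> y" using assms(1) by (simp add: norm_eq)
  then have "2 * (x \<bullet> (x - y)) = (norm (x - y))\<^sup>2"
    unfolding power2_norm_eq_inner by (simp add: inner_diff_left inner_diff_right inner_commute)
  moreover have "norm (x - y) * (x \<bullet> e) = x \<bullet> (x - y)"
    unfolding e_def inner_scaleR_right using nz by simp
  ultimately have "norm (x - y) * (2 * (x \<bullet> e)) = norm (x - y) * norm (x - y)"
    unfolding power2_eq_square by linarith
  then have "2 * (x \<bullet> e) = norm (x - y)" using nz mult_left_cancel by blast
  then have "reflect e 0 x = y" using nz by (simp add: reflect_def) (simp add: e_def)
  then show ?thesis using reflection_symmetric[OF e assms(2)] by simp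
qed simp

text \<open>Off the origin \<open>\<Omega>\<close> is where the extended \<open>u\<close> is
  positive, so symmetry of \<open>u\<close> makes the domain radial; being open, connected and
  bounded with \<open>0\<close> inside, it is a ball.\<close>

theorem radial_in_ball:
  "\<exists>R>0. \<Omega> = ball 0 R \<and>
    (\<exists>h. (\<forall>x\<in>closure \<Omega> - {0}. u x = h (norm x)) \<and> strict_antimono_on {0<..R} h)"
proof -
  define R where "R = (SUP x\<in>\<Omega>. norm x)"
  obtain T where T: "\<And>x. x \<in> \<Omega> \<Longrightarrow> norm x \<le> T" using dom(3) bounded_iff by metis
  have bdd: "bdd_above (norm ` \<Omega>)" using T by (intro bdd_aboveI[of _ T]) auto
  have up: "norm x \<le> R" if "x \<in> \<Omega>" for x unfolding R_def using that bdd by (rule cSUP_upper)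
  have radial: "y \<in> \<Omega>" if "x \<in> \<Omega>" "norm x = norm y" for x y
  proof (cases "x = 0")
    case True then show ?thesis using that dom(4) by simp
  next
    case False
    then have "0 < u y" using u_norm_eq[OF that(2) False] u_pos[of x] that(1) by simp
    then show ?thesis by (rule u_pos_imp_in)
  qed
  have "ball 0 R \<subseteq> \<Omega>"
  proof
    fix x :: 'a assume "x \<in> ball 0 R"
    then have "norm x < R" by simp
    moreover have "\<Omega> \<noteq> {}" using dom(4) by blast
    ultimately obtain y where y: "y \<in> \<Omega>" "norm x < norm y"
      unfolding R_def using less_cSUP_iff[OF _ bdd] by blast
    \<comment> \<open>The norms attained in \<open>\<Omega>\<close> form an interval starting at 0,
      so \<open>norm x\<close> is attained and radiality places \<open>x\<close> itself in the
      domain.\<close>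
    have "connected (norm ` \<Omega>)" by (intro connected_continuous_image dom continuous_intros)
    moreover have "0 \<in> norm ` \<Omega>" using dom(4) by force
    moreover have "norm y \<in> norm ` \<Omega>" using y by blast
    ultimately have "norm x \<in> norm ` \<Omega>"
      unfolding connected_iff_interval using y norm_ge_zero[of x] less_imp_le by blast
    then show "x \<in> \<Omega>" using radial by (metis imageE)
  qed
  moreover have "\<Omega> \<subseteq> ball 0 R"
  proof
    fix x assume x: "x \<in> \<Omega>"
    obtain d where d: "0 < d" "ball x d \<subseteq> \<Omega>" using dom(1) x open_contains_ball_eq by blast
    obtain i :: 'a where i: "i \<in> Basis" using nonempty_Basis by blast
    \<comment> \<open>The outward radial direction, or any unit vector at the origin; a small step
      along it shows that the supremum \<open>R\<close> is not attained.\<close>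
    define v where "v = (if x = 0 then i else (1 / norm x) *\<^sub>R x)"
    have v: "norm v = 1" "norm (x + (d / 2) *\<^sub>R v) = norm x + d / 2"
    proof -
      show "norm v = 1" using i by (auto simp: v_def)
      show "norm (x + (d / 2) *\<^sub>R v) = norm x + d / 2"
      proof (cases "x = 0")
        case True then show ?thesis using i d by (simp add: v_def)
      next
        case False
        then have "x + (d / 2) *\<^sub>R v = ((norm x + d / 2) / norm x) *\<^sub>R x"
          by (simp add: v_def add_divide_distrib scaleR_add_left)
        then show ?thesis using False d by simp
      qed
    qed
    have "x + (d / 2) *\<^sub>R v \<in> ball x d" using d v by (simp add: dist_norm)
    then have "norm x + d / 2 \<le> R" using up[of "x + (d / 2) *\<^sub>R v"] d v by auto
    then show "x \<in> ball 0 R" using d by simp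
  qed
  ultimately have \<Omega>R: "\<Omega> = ball 0 R" by blast
  have R: "0 < R" using dom(4) unfolding \<Omega>R by simp
  obtain i :: 'a where "i \<in> Basis" using nonempty_Basis by blast
  then have i: "norm i = 1" "i \<bullet> i = 1" by (auto simp: inner_Basis)
  define h where "h = (\<lambda>r. u (r *\<^sub>R i))"
  have "u x = h (norm x)" if "x \<in> closure \<Omega> - {0}" for x
    unfolding h_def by (rule u_norm_eq) (use that i in auto)
  moreover have "strict_antimono_on {0<..R} h"
    unfolding monotone_on_def
  proof (intro ballI impI)
    fix a b assume ab: "a \<in> {0<..R}" "b \<in> {0<..R}" "a < b"
    \<comment> \<open>The plane halfway between the two points on the ray exchanges them, so
      strictness in the closed cap is strict monotonicity, including the end point
      \<open>R\<close>.\<close>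
    define t where "t = (a + b) / 2"
    have t: "0 < t" using ab by (simp add: t_def)
    have "u (b *\<^sub>R i) < u (reflect i t (b *\<^sub>R i))"
    proof (rule strict_in_closed_cap[OF i(1) t dominated_all[OF i(1) t]])
      show "b *\<^sub>R i \<in> closure \<Omega>" unfolding \<Omega>R using R ab i by (simp add: closure_ball)
      show "t < (b *\<^sub>R i) \<bullet> i" using ab i by (simp add: t_def)
      have "(b *\<^sub>R i) \<bullet> i \<noteq> ((2 * t) *\<^sub>R i) \<bullet> i" using ab i by (simp add: t_def)
      then show "b *\<^sub>R i \<noteq> (2 * t) *\<^sub>R i" by metis
    qed
    moreover have "reflect i t (b *\<^sub>R i) = a *\<^sub>R i"
    proof -
      have "reflect i t (b *\<^sub>R i) = b *\<^sub>R i - (2 * (b - t)) *\<^sub>R i"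
        by (simp only: reflect_def inner_scaleR_left i mult_1_right)
      also have "2 * (b - t) = b - a" by (simp add: t_def field_simps)
      also have "b *\<^sub>R i - (b - a) *\<^sub>R i = a *\<^sub>R i" by (simp add: algebra_simps)
      finally show ?thesis .
    qed
    ultimately show "h b < h a" by (simp add: h_def)
  qed
  ultimately show ?thesis using \<Omega>R R by blast
qed

end

section \<open>The overdetermined problem\<close>

text \<open>The second difference \<open>D\<close> is symmetric in \<open>v\<close> and
  \<open>w\<close>, and divided by \<open>s\<^sup>2\<close> it tends to
  \<open>H v \<bullet> w\<close>. One mean value step reduces \<open>D\<close> to a difference of
  gradients, so differentiability of \<open>G\<close> at the single point \<open>p\<close> is
  enough.\<close>

lemma second_derivative_symmetric:
  fixes W :: "'a::euclidean_space \<Rightarrow> real"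
  assumes G: "\<forall>\<^sub>F y in nhds p. GDERIV W y :> G y" and H: "(G has_derivative H) (at p)"
  shows "H v \<bullet> w = v \<bullet> H w"
proof -
  interpret H: bounded_linear H using H by (rule has_derivative_bounded_linear)
  define D where "D = (\<lambda>s v w. W (p + s *\<^sub>R v + s *\<^sub>R w) - W (p + s *\<^sub>R v) - W (p + s *\<^sub>R w) + W p)"
  obtain d0 where d0: "0 < d0" "\<And>y. dist y p < d0 \<Longrightarrow> GDERIV W y :> G y"
    using G unfolding eventually_nhds_metric by blast
  have est: "\<exists>d>0. \<forall>s. 0 < s \<longrightarrow> s < d \<longrightarrow> \<bar>D s v w - s\<^sup>2 * (H v \<bullet> w)\<bar> \<le> s\<^sup>2 * (\<epsilon> * ((norm v + 2 * norm w) * norm w))"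
    if \<epsilon>: "0 < \<epsilon>" for \<epsilon> v w
  proof -
    obtain d1 where d1: "0 < d1" "\<And>y. norm (y - p) < d1 \<Longrightarrow> norm (G y - G p - H (y - p)) \<le> \<epsilon> * norm (y - p)"
      using H \<epsilon> unfolding has_derivative_at_alt by blast
    define d where "d = min d0 d1 / (norm v + norm w + 1)"
    have nn: "0 < norm v + norm w + 1" using norm_ge_zero[of v] norm_ge_zero[of w] by linarith
    have d: "0 < d" using d0 d1 nn by (simp add: d_def)
    have "\<bar>D s v w - s\<^sup>2 * (H v \<bullet> w)\<bar> \<le> s\<^sup>2 * (\<epsilon> * ((norm v + 2 * norm w) * norm w))" if s: "0 < s" "s < d" for s
    proof -
      have sm: "s * (norm v + norm w + 1) < min d0 d1" using s nn by (simp add: d_def pos_less_divide_eq)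
      have sm': "s * (norm v + norm w) < min d0 d1" using sm s by (simp add: algebra_simps)
      have b1: "norm (s *\<^sub>R v + (k * s) *\<^sub>R w) \<le> s * (norm v + norm w)"
        and b2: "norm ((k * s) *\<^sub>R w) \<le> s * norm w" if "0 \<le> k" "k \<le> 1" for k
      proof -
        have "(k * s) * norm w \<le> s * norm w" using that s by (intro mult_right_mono) (auto simp: mult_le_cancel_right1)
        then show b: "norm ((k * s) *\<^sub>R w) \<le> s * norm w" using that s by simp
        show "norm (s *\<^sub>R v + (k * s) *\<^sub>R w) \<le> s * (norm v + norm w)"
          using norm_triangle_ineq[of "s *\<^sub>R v" "(k * s) *\<^sub>R w"] b s by (simp add: algebra_simps)
      qed
      have b2': "norm ((k * s) *\<^sub>R w) \<le> s * (norm v + norm w)" if "0 \<le> k" "k \<le> 1" for k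
      proof -
        have "s * norm w \<le> s * (norm v + norm w)" using s by (intro mult_left_mono) auto
        then show ?thesis using b2[OF that] by linarith
      qed
      \<comment> \<open>Its increment from 0 to 1 is \<open>D s v w\<close>; the mean value point
        produces the displacements \<open>h1\<close> and \<open>h2\<close>, which differ by
        \<open>s *\<^sub>R v\<close>.\<close>
      define \<phi> where "\<phi> = (\<lambda>k. W (p + s *\<^sub>R v + k *\<^sub>R (s *\<^sub>R w)) - W (p + k *\<^sub>R (s *\<^sub>R w)))"
      have der: "(\<phi> has_real_derivative (G (p + s *\<^sub>R v + k *\<^sub>R (s *\<^sub>R w)) \<bullet> (s *\<^sub>R w) - G (p + k *\<^sub>R (s *\<^sub>R w)) \<bullet> (s *\<^sub>R w))) (at k)"
        if k: "0 \<le> k" "k \<le> 1" for k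
        unfolding \<phi>_def
      proof (intro DERIV_diff gderiv_line d0(2))
        have "p + s *\<^sub>R v + k *\<^sub>R s *\<^sub>R w - p = s *\<^sub>R v + (k * s) *\<^sub>R w" by simp
        then show "dist (p + s *\<^sub>R v + k *\<^sub>R s *\<^sub>R w) p < d0" using b1[OF k] sm' unfolding dist_norm by simp
        have "p + k *\<^sub>R s *\<^sub>R w - p = (k * s) *\<^sub>R w" by simp
        then show "dist (p + k *\<^sub>R s *\<^sub>R w) p < d0" using b2'[OF k] sm' unfolding dist_norm by simp
      qed
      obtain k where k: "0 < k" "k < 1"
        "\<phi> 1 - \<phi> 0 = (1 - 0) * (G (p + s *\<^sub>R v + k *\<^sub>R (s *\<^sub>R w)) \<bullet> (s *\<^sub>R w) - G (p + k *\<^sub>R (s *\<^sub>R w)) \<bullet> (s *\<^sub>R w))"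
        using MVT2[of 0 1 \<phi> "\<lambda>k. G (p + s *\<^sub>R v + k *\<^sub>R (s *\<^sub>R w)) \<bullet> (s *\<^sub>R w) - G (p + k *\<^sub>R (s *\<^sub>R w)) \<bullet> (s *\<^sub>R w)"] der
        by auto
      define h1 where "h1 = s *\<^sub>R v + (k * s) *\<^sub>R w"
      define h2 where "h2 = (k * s) *\<^sub>R w"
      have k01: "0 \<le> k" "k \<le> 1" using k by auto
      have Dk: "D s v w = s * ((G (p + h1) - G (p + h2)) \<bullet> w)"
        using k(3) by (simp add: D_def \<phi>_def h1_def h2_def inner_diff_left algebra_simps)
      have n1: "norm h1 \<le> s * (norm v + norm w)" unfolding h1_def by (rule b1[OF k01])
      have n2: "norm h2 \<le> s * norm w" unfolding h2_def by (rule b2[OF k01])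
      have n2': "norm h2 \<le> s * (norm v + norm w)" unfolding h2_def by (rule b2'[OF k01])
      have r1: "norm (G (p + h1) - G p - H h1) \<le> \<epsilon> * norm h1" using d1(2)[of "p + h1"] n1 sm' by simp
      have r2: "norm (G (p + h2) - G p - H h2) \<le> \<epsilon> * norm h2" using d1(2)[of "p + h2"] n2' sm' by simp
      have "H h1 - H h2 = s *\<^sub>R H v" by (simp add: h1_def h2_def H.add H.scaleR)
      then have HH: "(H h1 - H h2) \<bullet> w = s * (H v \<bullet> w)" by simp
      have split: "(G (p + h1) - G p - H h1) - (G (p + h2) - G p - H h2) = (G (p + h1) - G (p + h2)) - (H h1 - H h2)"
        by simp
      have eq: "D s v w - s\<^sup>2 * (H v \<bullet> w) = s * (((G (p + h1) - G p - H h1) - (G (p + h2) - G p - H h2)) \<bullet> w)"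
        unfolding split inner_diff_left[of "G (p + h1) - G (p + h2)"] HH Dk
        by (simp add: power2_eq_square right_diff_distrib)
      have "norm ((G (p + h1) - G p - H h1) - (G (p + h2) - G p - H h2)) \<le> \<epsilon> * norm h1 + \<epsilon> * norm h2"
        using norm_triangle_ineq4[of "G (p + h1) - G p - H h1" "G (p + h2) - G p - H h2"] r1 r2 by linarith
      also have "\<dots> \<le> \<epsilon> * (s * (norm v + norm w)) + \<epsilon> * (s * norm w)"
        using n1 n2 \<open>0 < \<epsilon>\<close> by (intro add_mono mult_left_mono) auto
      also have "\<dots> = s * (\<epsilon> * (norm v + 2 * norm w))" by (simp add: algebra_simps)
      finally have "norm ((G (p + h1) - G p - H h1) - (G (p + h2) - G p - H h2)) * norm w \<le> s * (\<epsilon> * (norm v + 2 * norm w)) * norm w"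
        by (intro mult_right_mono) auto
      then have "\<bar>((G (p + h1) - G p - H h1) - (G (p + h2) - G p - H h2)) \<bullet> w\<bar> \<le> s * (\<epsilon> * (norm v + 2 * norm w)) * norm w"
        using Cauchy_Schwarz_ineq2 order_trans by blast
      then have "s * \<bar>((G (p + h1) - G p - H h1) - (G (p + h2) - G p - H h2)) \<bullet> w\<bar> \<le> s * (s * (\<epsilon> * (norm v + 2 * norm w)) * norm w)"
        using s by (intro mult_left_mono) auto
      then show ?thesis unfolding eq abs_mult using s by (simp add: power2_eq_square mult_ac)
    qed
    then show ?thesis using d by blast
  qed
  have sym: "D s v w = D s w v" for s v w by (simp add: D_def algebra_simps)
  show ?thesis
  proof (rule ccontr)
    assume ne: "H v \<bullet> w \<noteq> v \<bullet> H w"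
    define \<delta> where "\<delta> = \<bar>H v \<bullet> w - H w \<bullet> v\<bar>"
    have \<delta>: "0 < \<delta>" using ne by (simp add: \<delta>_def inner_commute)
    \<comment> \<open>The sum of the two error constants; the 1 makes it positive and the final
      comparison strict.\<close>
    define C where "C = (norm v + 2 * norm w) * norm w + (norm w + 2 * norm v) * norm v + 1"
    have C: "0 < C" unfolding C_def by (intro add_nonneg_pos add_nonneg_nonneg mult_nonneg_nonneg) auto
    define \<epsilon> where "\<epsilon> = \<delta> / (2 * C)"
    have \<epsilon>: "0 < \<epsilon>" using \<delta> C by (simp add: \<epsilon>_def)
    obtain a where a: "0 < a" "\<And>s. 0 < s \<Longrightarrow> s < a \<Longrightarrow> \<bar>D s v w - s\<^sup>2 * (H v \<bullet> w)\<bar> \<le> s\<^sup>2 * (\<epsilon> * ((norm v + 2 * norm w) * norm w))"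
      using est[OF \<epsilon>, of v w] by blast
    obtain b where b: "0 < b" "\<And>s. 0 < s \<Longrightarrow> s < b \<Longrightarrow> \<bar>D s w v - s\<^sup>2 * (H w \<bullet> v)\<bar> \<le> s\<^sup>2 * (\<epsilon> * ((norm w + 2 * norm v) * norm v))"
      using est[OF \<epsilon>, of w v] by blast
    define s where "s = min a b / 2"
    have s: "0 < s" "s < a" "s < b" unfolding s_def by (rule half_min[OF a(1) b(1)])+
    have "\<bar>s\<^sup>2 * (H v \<bullet> w) - s\<^sup>2 * (H w \<bullet> v)\<bar> \<le>
        s\<^sup>2 * (\<epsilon> * ((norm v + 2 * norm w) * norm w)) + s\<^sup>2 * (\<epsilon> * ((norm w + 2 * norm v) * norm v))"
      using a(2)[OF s(1,2)] b(2)[OF s(1,3)] sym[of s v w] by linarith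
    also have "\<dots> = s\<^sup>2 * (\<epsilon> * (C - 1))" by (simp add: C_def algebra_simps)
    also have "\<bar>s\<^sup>2 * (H v \<bullet> w) - s\<^sup>2 * (H w \<bullet> v)\<bar> = s\<^sup>2 * \<delta>"
      by (simp add: \<delta>_def abs_mult flip: right_diff_distrib)
    finally have "\<delta> \<le> \<epsilon> * (C - 1)" using s by simp
    also have "\<dots> < \<epsilon> * C" using \<epsilon> by simp
    also have "\<dots> = \<delta> / 2" using C by (simp add: \<epsilon>_def)
    finally show False using \<delta> by simp
  qed
qed

section \<open>Reading the hypotheses in terms of gradient and Hessian\<close>

lemma continuous_on_eq_0_limit:
  fixes F :: "'a::euclidean_space \<Rightarrow> real"
  assumes "continuous_on S F" "x \<in> S" "D \<subseteq> S" "x \<in> closure D" "\<And>y. y \<in> D \<Longrightarrow> F y = 0"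
  shows "F x = 0"
proof -
  obtain X where X: "\<And>n. X n \<in> D" "X \<longlonglongrightarrow> x" using assms(4) closure_sequential[of x D] by blast
  have "(\<lambda>n. F (X n)) \<longlonglongrightarrow> F x"
    by (rule continuous_on_tendsto_compose[OF assms(1) X(2) assms(2)]) (use X assms(3) in \<open>auto intro!: always_eventually\<close>)
  then show ?thesis using assms(5)[OF X(1)] by (simp add: LIMSEQ_const_iff)
qed

lemma locally_lipschitz_imp_lipschitz:
  assumes f: "locally_lipschitz_on {0..} f"
  shows "\<exists>L\<ge>0. \<forall>s\<in>{0..B}. \<forall>t\<in>{0..B}. \<bar>f s - f t\<bar> \<le> L * \<bar>s - t\<bar>"
proof -
  \<comment> \<open>\<open>f\<close> is regarded as a field over a one-point time set, so that the
    compactness theorem for \<open>local_lipschitz\<close> applies.\<close>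
  have "local_lipschitz {0::real} {0..B} (\<lambda>_. f)"
    unfolding local_lipschitz_def
  proof (intro ballI)
    fix x t assume "x \<in> {0..B}" "t \<in> {0::real}"
    then have "x \<in> {0..}" by simp
    then obtain d L where d: "0 < d" and L: "L-lipschitz_on (cball x d \<inter> {0..}) f"
      using f unfolding locally_lipschitz_on_def by blast
    have "L-lipschitz_on (cball x d \<inter> {0..B}) f"
      by (rule lipschitz_on_subset[OF L]) auto
    then show "\<exists>u>0. \<exists>L. \<forall>t\<in>cball t u \<inter> {0}. L-lipschitz_on (cball x u \<inter> {0..B}) f"
      using d by (intro exI[of _ d] conjI exI[of _ L] ballI)
  qed
  then obtain L where "\<And>t. t \<in> {0::real} \<Longrightarrow> L-lipschitz_on {0..B} f"
    by (rule local_lipschitz_compact_implies_lipschitz) auto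
  then have "L-lipschitz_on {0..B} f" by simp
  then show ?thesis unfolding lipschitz_on_def by (auto simp: dist_real_def)
qed

lemma Ck_upto_2_derivatives:
  fixes u :: "'a::euclidean_space \<Rightarrow> real"
  assumes u: "Ck_upto 2 U S u"
  obtains g H where "continuous_on S u" "continuous_on S g" "\<And>v. continuous_on S (\<lambda>x. H x v)"
    "\<And>x. linear (H x)" "\<And>x. x \<in> U \<Longrightarrow> GDERIV u x :> g x" "\<And>x. x \<in> U \<Longrightarrow> (g has_derivative H x) (at x)"
proof -
  obtain g where g: "continuous_on S u" "\<And>x. x \<in> U \<Longrightarrow> GDERIV u x :> g x"
    "\<And>i. i \<in> Basis \<Longrightarrow> Ck_upto (Suc 0) U S (\<lambda>x. g x \<bullet> i)"
    using u by (auto simp: numeral_2_eq_2)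
  then have "\<forall>i\<in>Basis. \<exists>h. (\<forall>x\<in>U. GDERIV (\<lambda>x. g x \<bullet> i) x :> h x) \<and> (\<forall>j\<in>Basis. continuous_on S (\<lambda>x. h x \<bullet> j))"
    by simp
  then obtain h where h: "\<And>i x. i \<in> Basis \<Longrightarrow> x \<in> U \<Longrightarrow> GDERIV (\<lambda>x. g x \<bullet> i) x :> h i x"
    "\<And>i j. i \<in> Basis \<Longrightarrow> j \<in> Basis \<Longrightarrow> continuous_on S (\<lambda>x. h i x \<bullet> j)"
    by metis
  \<comment> \<open>The rows of the Hessian are the gradients of the components of \<open>g\<close>,
    hence linearity holds everywhere by construction.\<close>
  define H where "H = (\<lambda>x v. \<Sum>i\<in>Basis. (h i x \<bullet> v) *\<^sub>R i)"
  show ?thesis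
  proof (rule that[of g H])
    show "continuous_on S u" by fact
    show "continuous_on S g"
      by (rule continuous_on_componentwise_inner) (use g(3) in simp)
    have "continuous_on S (h i)" if "i \<in> Basis" for i
      by (rule continuous_on_componentwise_inner) (use h(2)[OF that] in simp)
    then show "continuous_on S (\<lambda>x. H x v)" for v unfolding H_def by (intro continuous_intros)
    show "linear (H x)" for x
      by (rule linearI) (simp_all add: H_def inner_add_right scaleR_add_left sum.distrib scaleR_sum_right)
    show "GDERIV u x :> g x" if "x \<in> U" for x by (rule g(2)[OF that])
    show "(g has_derivative H x) (at x)" if x: "x \<in> U" for x
      unfolding has_derivative_componentwise_within[of g "H x"]
    proof
      fix i :: 'a assume i: "i \<in> Basis"
      have "(\<lambda>v. H x v \<bullet> i) = (\<lambda>v. v \<bullet> h i x)"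
      proof
        show "H x v \<bullet> i = v \<bullet> h i x" for v
          unfolding H_def inner_sum_left_Basis[OF i] by (rule inner_commute)
      qed
      then show "((\<lambda>x. g x \<bullet> i) has_derivative (\<lambda>v. H x v \<bullet> i)) (at x)"
        using h(1)[OF i x] by (simp add: gderiv_def)
    qed
  qed
qed

text \<open>The outer \<open>deriv\<close> sees the first partial derivatives near \<open>x\<close>,
  so they must be identified with components of \<open>g\<close> on a neighbourhood before the trace
  can be read off.\<close>

lemma laplacian_eq_trace:
  fixes u :: "'a::euclidean_space \<Rightarrow> real"
  assumes U: "open U" "x \<in> U" and g: "\<And>y. y \<in> U \<Longrightarrow> GDERIV u y :> g y" and H: "(g has_derivative H) (at x)"
  shows "laplacian u x = (\<Sum>i\<in>Basis. H i \<bullet> i)"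
proof -
  interpret H: bounded_linear H using H by (rule has_derivative_bounded_linear)
  have pd: "partial_deriv i u y = g y \<bullet> i" if "y \<in> U" for i y
  proof -
    have "((\<lambda>t. u (y + t *\<^sub>R i)) has_real_derivative g y \<bullet> i) (at 0)"
      by (rule gderiv_line) (simp add: g that)
    then show ?thesis unfolding partial_deriv_def by (rule DERIV_imp_deriv)
  qed
  have "partial_deriv i (partial_deriv i u) x = H i \<bullet> i" for i
  proof -
    have "((\<lambda>t. x + t *\<^sub>R i) \<longlongrightarrow> x + 0 *\<^sub>R i) (nhds 0)" by (intro tendsto_intros filterlim_ident)
    then have "\<forall>\<^sub>F t in nhds 0. x + t *\<^sub>R i \<in> U" using U by (simp add: topological_tendstoD)
    then have ev: "\<forall>\<^sub>F t in nhds 0. partial_deriv i u (x + t *\<^sub>R i) = g (x + t *\<^sub>R i) \<bullet> i"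
      by eventually_elim (rule pd)
    have "((\<lambda>t. x + t *\<^sub>R i) has_derivative (\<lambda>h. h *\<^sub>R i)) (at 0)"
      by (auto intro!: derivative_eq_intros)
    then have "((\<lambda>t. g (x + t *\<^sub>R i)) has_derivative (\<lambda>h. H (h *\<^sub>R i))) (at 0)"
      by (rule has_derivative_compose) (use H in simp)
    then have "((\<lambda>t. g (x + t *\<^sub>R i) \<bullet> i) has_derivative (\<lambda>h. H (h *\<^sub>R i) \<bullet> i)) (at 0)"
      by (rule has_derivative_inner_left)
    moreover have "(\<lambda>h. H (h *\<^sub>R i) \<bullet> i) = (*) (H i \<bullet> i)"
      by (auto simp: H.scaleR mult.commute)
    ultimately have "((\<lambda>t. g (x + t *\<^sub>R i) \<bullet> i) has_real_derivative H i \<bullet> i) (at 0)"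
      by (simp add: has_field_derivative_def)
    then have "deriv (\<lambda>t. g (x + t *\<^sub>R i) \<bullet> i) 0 = H i \<bullet> i" by (rule DERIV_imp_deriv)
    moreover have "deriv (\<lambda>t. partial_deriv i u (x + t *\<^sub>R i)) 0 = deriv (\<lambda>t. g (x + t *\<^sub>R i) \<bullet> i) 0"
      by (rule deriv_cong_ev[OF ev refl])
    ultimately show ?thesis unfolding partial_deriv_def[of i "partial_deriv i u"] by simp
  qed
  then show ?thesis by (simp add: laplacian_def)
qed

text \<open>By the mean value theorem the one-sided quotient is a value of
  \<open>g \<bullet> \<nu>\<close> on the inward normal inside the domain, and \<open>g\<close> is
  continuous up to \<open>x\<close>.\<close>

lemma normal_derivative_eq_gradient:
  fixes u :: "'a::euclidean_space \<Rightarrow> real"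
  assumes \<Omega>: "open \<Omega>" and x: "x \<in> closure \<Omega> - {0}" and \<nu>: "outward_unit_normal \<Omega> x \<nu>"
    and u: "continuous_on (closure \<Omega> - {0}) u" and du: "\<And>y. y \<in> \<Omega> - {0} \<Longrightarrow> GDERIV u y :> g y"
    and g: "continuous_on (closure \<Omega> - {0}) g" and nd: "has_normal_derivative u x \<nu> a"
  shows "g x \<bullet> \<nu> = a"
proof -
  have n1: "norm \<nu> = 1" using \<nu> by (simp add: outward_unit_normal_def)
  have "\<forall>\<^sub>F t in at_right 0. x - t *\<^sub>R \<nu> \<in> \<Omega>"
    using \<nu> unfolding outward_unit_normal_def by (auto elim: eventually_mono)
  then obtain b where b: "0 < b" "\<And>t. 0 < t \<Longrightarrow> t < b \<Longrightarrow> x - t *\<^sub>R \<nu> \<in> \<Omega>"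
    unfolding eventually_at_right_field by auto
  have "((\<lambda>t. (u (x + t *\<^sub>R \<nu>) - u x) / t) \<longlongrightarrow> g x \<bullet> \<nu>) (at_left 0)"
  proof (rule tendstoI)
    fix \<epsilon> :: real assume "0 < \<epsilon>"
    then obtain d where d: "0 < d" "\<And>z. z \<in> closure \<Omega> - {0} \<Longrightarrow> dist z x < d \<Longrightarrow> dist (g z) (g x) < \<epsilon>"
      using g x unfolding continuous_on_iff by meson
    \<comment> \<open>The last entry keeps the inward segment off the singularity.\<close>
    define c where "c = Min {b, d, norm x}"
    have c: "0 < c" "c \<le> b" "c \<le> d" "c \<le> norm x" using b d x by (auto simp: c_def)
    have "dist ((u (x + t *\<^sub>R \<nu>) - u x) / t) (g x \<bullet> \<nu>) < \<epsilon>" if t: "- c < t" "t < 0" for t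
    proof -
      have pt: "x + k *\<^sub>R (t *\<^sub>R \<nu>) \<in> \<Omega> - {0} \<and> dist (x + k *\<^sub>R (t *\<^sub>R \<nu>)) x < d" if k: "0 < k" "k \<le> 1" for k
      proof -
        have "k * (- t) \<le> 1 * (- t)" using k t by (intro mult_right_mono) auto
        moreover have "k * (- t) = - (k * t)" by simp
        ultimately have "- (k * t) < c" using t by linarith
        moreover have "0 < - (k * t)" using mult_pos_neg[OF k(1) t(2)] by simp
        ultimately have kt: "0 < - (k * t)" "- (k * t) < c" by auto
        have "x - (- (k * t)) *\<^sub>R \<nu> \<in> \<Omega>" by (rule b(2)) (use kt c in auto)
        then have 1: "x + k *\<^sub>R (t *\<^sub>R \<nu>) \<in> \<Omega>" by simp
        have 2: "dist (x + k *\<^sub>R (t *\<^sub>R \<nu>)) x = - (k * t)" using n1 kt by (simp add: dist_norm)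
        have "x + k *\<^sub>R (t *\<^sub>R \<nu>) \<noteq> 0"
        proof
          assume "x + k *\<^sub>R (t *\<^sub>R \<nu>) = 0"
          then have "norm x = - (k * t)" using 2 by (simp add: dist_norm)
          then show False using kt c by simp
        qed
        then show ?thesis using 1 2 kt c by simp
      qed
      obtain k where k: "0 < k" "k < 1" "u (x + t *\<^sub>R \<nu>) - u x = g (x + k *\<^sub>R (t *\<^sub>R \<nu>)) \<bullet> (t *\<^sub>R \<nu>)"
      proof (rule gderiv_mvt[of u x "t *\<^sub>R \<nu>" g])
        show "continuous_on {0..1} (\<lambda>s. u (x + s *\<^sub>R (t *\<^sub>R \<nu>)))"
        proof (rule continuous_on_compose2[OF u])
          show "continuous_on {0..1} (\<lambda>s. x + s *\<^sub>R (t *\<^sub>R \<nu>))" by (intro continuous_intros)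
          show "(\<lambda>s. x + s *\<^sub>R (t *\<^sub>R \<nu>)) ` {0..1} \<subseteq> closure \<Omega> - {0}"
          proof (rule image_subsetI)
            fix s :: real assume "s \<in> {0..1}"
            then show "x + s *\<^sub>R (t *\<^sub>R \<nu>) \<in> closure \<Omega> - {0}"
              using pt[of s] x closure_subset[of \<Omega>] by (cases "s = 0") auto
          qed
        qed
        show "GDERIV u (x + s *\<^sub>R (t *\<^sub>R \<nu>)) :> g (x + s *\<^sub>R (t *\<^sub>R \<nu>))" if "0 < s" "s < 1" for s
          using pt[of s] that by (intro du) auto
      qed blast
      define z where "z = x + k *\<^sub>R (t *\<^sub>R \<nu>)"
      have z: "z \<in> closure \<Omega> - {0}" "dist z x < d"
        using pt[of k] k closure_subset[of \<Omega>] by (auto simp: z_def)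
      have q: "(u (x + t *\<^sub>R \<nu>) - u x) / t = g z \<bullet> \<nu>" unfolding k(3) using t by (simp add: z_def)
      have "\<bar>(g z - g x) \<bullet> \<nu>\<bar> \<le> norm (g z - g x) * norm \<nu>" by (rule Cauchy_Schwarz_ineq2)
      also have "\<dots> < \<epsilon>" using d(2)[OF z] n1 by (simp add: dist_norm)
      finally show ?thesis unfolding q by (simp add: dist_real_def inner_diff_left)
    qed
    then show "\<forall>\<^sub>F t in at_left 0. dist ((u (x + t *\<^sub>R \<nu>) - u x) / t) (g x \<bullet> \<nu>) < \<epsilon>"
      unfolding eventually_at_left_field using c(1) by (intro exI[of _ "- c"]) auto
  qed
  moreover have "((\<lambda>t. (u (x + t *\<^sub>R \<nu>) - u x) / t) \<longlongrightarrow> a) (at_left 0)"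
    using nd unfolding has_normal_derivative_def has_field_derivative_iff by simp
  ultimately show ?thesis by (intro tendsto_unique[of "at_left (0::real)"]) auto
qed

theorem theorem1p1:
  fixes \<Omega> :: "(real ^ 'n) set"
    and f :: "real \<Rightarrow> real"
    and \<alpha> :: real
    and u :: "real ^ 'n \<Rightarrow> real"
    and \<nu> :: "real ^ 'n \<Rightarrow> real ^ 'n"
  assumes dim: "2 \<le> CARD('n)"
    and domain: "open \<Omega>" "connected \<Omega>" "bounded \<Omega>" "C2_boundary \<Omega>" "0 \<in> \<Omega>"
    and f_lip: "locally_lipschitz_on {0..} f"
    and alpha: "\<alpha> < 0"
    and u_C2: "Ck_upto 2 (\<Omega> - {0}) (closure \<Omega> - {0}) u"
    and equation: "\<forall>x \<in> \<Omega> - {0}. - laplacian u x = f (u x)"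
    and positive: "\<forall>x \<in> \<Omega> - {0}. 0 < u x"
    and dirichlet: "\<forall>x \<in> frontier \<Omega>. u x = 0"
    and normal: "\<forall>x \<in> frontier \<Omega>. outward_unit_normal \<Omega> x (\<nu> x)"
    and neumann: "\<forall>x \<in> frontier \<Omega>. has_normal_derivative u x (\<nu> x) \<alpha>"
    and singular: "\<not> removable_singularity \<Omega> u"
  shows "\<exists>R>0. \<Omega> = ball 0 R \<and>
    (\<exists>g. (\<forall>x \<in> closure \<Omega> - {0}. u x = g (norm x)) \<and> strict_antimono_on {0<..R} g)"
proof -
  define S where "S = closure \<Omega> - {0}"
  obtain g H where cu: "continuous_on S u" and cg: "continuous_on S g" and cH: "\<And>v. continuous_on S (\<lambda>x. H x v)"
    and linH: "\<And>x. linear (H x)" and du: "\<And>x. x \<in> \<Omega> - {0} \<Longrightarrow> GDERIV u x :> g x"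
    and dg: "\<And>x. x \<in> \<Omega> - {0} \<Longrightarrow> (g has_derivative H x) (at x)"
    using Ck_upto_2_derivatives[OF u_C2] unfolding S_def by metis
  have o: "open (\<Omega> - {0})" using domain(1) by (rule open_delete)
  have sub: "\<Omega> - {0} \<subseteq> S" using closure_subset[of \<Omega>] by (auto simp: S_def)
  have fr: "x \<notin> \<Omega>" "x \<in> S" "norm (\<nu> x) = 1" if "x \<in> frontier \<Omega>" for x
    using that domain(1,5) normal by (auto simp: frontier_def interior_open S_def outward_unit_normal_def)
  have frI: "x \<in> frontier \<Omega>" if "x \<in> S" "x \<notin> \<Omega>" for x
    using that domain(1) by (simp add: frontier_def interior_open S_def)
  \<comment> \<open>The given \<open>u\<close> is arbitrary outside \<open>closure \<Omega>\<close>.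
    The cut-off function fits the locale and agrees with \<open>u\<close> on \<open>S\<close> by the
    Dirichlet condition.\<close>
  define ub where "ub = (\<lambda>x. if x \<in> \<Omega> then u x else 0)"
  have ubS: "ub x = u x" if "x \<in> S" for x
    using that frI[of x] dirichlet by (auto simp: ub_def)
  have para: "\<exists>M>0. \<exists>r>0. \<forall>z. dist x z < r \<longrightarrow>
          ((z - x) \<bullet> \<nu> x < - M * (norm (z - x))\<^sup>2 \<longrightarrow> z \<in> \<Omega>) \<and>
          (M * (norm (z - x))\<^sup>2 < (z - x) \<bullet> \<nu> x \<longrightarrow> z \<notin> \<Omega>)" if x: "x \<in> frontier \<Omega>" for x
  proof -
    have nx: "outward_unit_normal \<Omega> x (\<nu> x)" using normal x by blast
    show ?thesis by (rule two_sided_paraboloid[OF domain(1,4) x nx]) blast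
  qed
  have gfr: "g x = - (- \<alpha>) *\<^sub>R \<nu> x" if x: "x \<in> frontier \<Omega>" for x
  proof -
    have nx: "outward_unit_normal \<Omega> x (\<nu> x)" using normal x by blast
    have nn: "\<nu> x \<bullet> \<nu> x = 1" using fr(3)[OF x] by (simp add: norm_eq_1)
    have ga: "g x \<bullet> \<nu> x = \<alpha>"
      by (rule normal_derivative_eq_gradient[OF domain(1) _ nx _ du])
        (use fr(2)[OF x] cu cg neumann x in \<open>auto simp: S_def\<close>)
    obtain M r where M: "0 < M" "0 < r"
      "\<And>z. dist x z < r \<Longrightarrow> (z - x) \<bullet> \<nu> x < - M * (norm (z - x))\<^sup>2 \<Longrightarrow> z \<in> \<Omega>"
      "\<And>z. dist x z < r \<Longrightarrow> M * (norm (z - x))\<^sup>2 < (z - x) \<bullet> \<nu> x \<Longrightarrow> z \<notin> \<Omega>"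
      using para[OF x] by metis
    define r' where "r' = min r (norm x)"
    have "x \<noteq> 0" using fr(2)[OF x] by (simp add: S_def)
    then have r': "0 < r'" "r' \<le> r" "0 \<notin> ball x r'" using M by (auto simp: r'_def)
    have bs: "closure \<Omega> \<inter> ball x r' \<subseteq> S" using r' by (auto simp: S_def)
    \<comment> \<open>Testing the constancy of \<open>u\<close> on the frontier with the tangential
      part of \<open>g x\<close> itself shows that this part is zero; the Neumann condition gives
      the rest.\<close>
    define v where "v = g x - (g x \<bullet> \<nu> x) *\<^sub>R \<nu> x"
    have vn: "v \<bullet> \<nu> x = 0" by (simp add: v_def inner_diff_left nn)
    have "g x \<bullet> v = 0"
    proof (rule tangential_gradient_zero[OF domain(1) x fr(3)[OF x] M(1) r'(1) _ _ _ _ _ _ vn])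
      show "z \<in> \<Omega>" if "dist x z < r'" "(z - x) \<bullet> \<nu> x < - M * (norm (z - x))\<^sup>2" for z
        using M(3)[of z] that r' by simp
      show "z \<notin> \<Omega>" if "dist x z < r'" "M * (norm (z - x))\<^sup>2 < (z - x) \<bullet> \<nu> x" for z
        using M(4)[of z] that r' by simp
      show "continuous_on (closure \<Omega> \<inter> ball x r') u" by (rule continuous_on_subset[OF cu bs])
      show "continuous_on (closure \<Omega> \<inter> ball x r') g" by (rule continuous_on_subset[OF cg bs])
      show "GDERIV u y :> g y" if "y \<in> \<Omega> \<inter> ball x r'" for y using that r' by (intro du) auto
      show "u y = u x" if "y \<in> frontier \<Omega> \<inter> ball x r'" for y using that x dirichlet by simp
    qed
    then have "v \<bullet> v = 0" using vn by (simp add: v_def inner_diff_left inner_commute)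
    then show ?thesis by (simp add: v_def ga)
  qed
  have symH: "H x v \<bullet> w = v \<bullet> H x w" if x: "x \<in> S" for x v w
  proof -
    have "H x v \<bullet> w - v \<bullet> H x w = 0"
    proof (rule continuous_on_eq_0_limit[where S = S and D = "\<Omega> - {0}"
          and F = "\<lambda>x. H x v \<bullet> w - v \<bullet> H x w"])
      show "continuous_on S (\<lambda>x. H x v \<bullet> w - v \<bullet> H x w)" by (intro continuous_intros cH)
      \<comment> \<open>Deleting the origin can remove only the origin from the closure, so every
        point of \<open>S\<close> is a limit of points where \<open>H\<close> is the derivative of
        \<open>g\<close>.\<close>
      have "closure \<Omega> \<subseteq> closure (insert 0 (\<Omega> - {0}))" by (intro closure_mono) auto
      then have "closure \<Omega> \<subseteq> insert 0 (closure (\<Omega> - {0}))" unfolding closure_insert .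
      then show "x \<in> closure (\<Omega> - {0})" using x by (auto simp: S_def)
      show "H y v \<bullet> w - v \<bullet> H y w = 0" if y: "y \<in> \<Omega> - {0}" for y
      proof -
        have "\<forall>\<^sub>F z in nhds y. GDERIV u z :> g z"
          using eventually_nhds_in_open[OF o y] by eventually_elim (rule du)
        then show ?thesis using second_derivative_symmetric[OF _ dg[OF y]] by simp
      qed
    qed (use x sub in auto)
    then show ?thesis by simp
  qed
  interpret singular_serrin \<Omega> ub g H \<nu> f "- \<alpha>"
  proof (rule singular_serrin.intro)
    show "2 \<le> DIM(real ^ 'n)" using dim by simp
    show "open \<Omega>" "connected \<Omega>" "bounded \<Omega>" "0 \<in> \<Omega>" by fact+
    show "norm (\<nu> x) = 1" if "x \<in> frontier \<Omega>" for x by (rule fr(3)[OF that])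
    show "continuous_on (- {0}) ub"
    proof -
      \<comment> \<open>The punctured space is a union of two relatively closed sets that overlap on
        the frontier, where both branches are 0.\<close>
      have U: "- {0} = (closure \<Omega> - {0}) \<union> (- \<Omega> - {0})" using closure_subset[of \<Omega>] by auto
      show ?thesis
        unfolding ub_def U
      proof (rule continuous_on_cases_local)
        have "closure \<Omega> - {0} = ((closure \<Omega> - {0}) \<union> (- \<Omega> - {0})) \<inter> closure \<Omega>" by auto
        then show "closedin (top_of_set ((closure \<Omega> - {0}) \<union> (- \<Omega> - {0}))) (closure \<Omega> - {0})"
          using closedin_closed_Int[OF closed_closure] by metis
        have "- \<Omega> - {0} = ((closure \<Omega> - {0}) \<union> (- \<Omega> - {0})) \<inter> - \<Omega>" using closure_subset[of \<Omega>] by auto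
        moreover have "closed (- \<Omega>)" using domain(1) by (rule closed_Compl)
        ultimately show "closedin (top_of_set ((closure \<Omega> - {0}) \<union> (- \<Omega> - {0}))) (- \<Omega> - {0})"
          using closedin_closed_Int by metis
        show "continuous_on (closure \<Omega> - {0}) u" using cu by (simp add: S_def)
        show "u x = 0" if "x \<in> closure \<Omega> - {0} \<and> x \<notin> \<Omega> \<or> x \<in> - \<Omega> - {0} \<and> x \<in> \<Omega>" for x
          using that frI[of x] dirichlet by (auto simp: S_def)
      qed simp
    qed
    show "ub x = 0" if "x \<notin> \<Omega>" for x using that by (simp add: ub_def)
    show "0 < ub x" if "x \<in> \<Omega> - {0}" for x using that positive by (simp add: ub_def)
    show "GDERIV ub x :> g x" if "x \<in> \<Omega> - {0}" for x
      by (rule gderiv_transform_open[OF du[OF that] o that]) (simp add: ub_def)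
    show "(g has_derivative H x) (at x)" if "x \<in> \<Omega> - {0}" for x by (rule dg[OF that])
    show "continuous_on (closure \<Omega> - {0}) g" using cg by (simp add: S_def)
    show "continuous_on (closure \<Omega> - {0}) (\<lambda>x. H x v)" for v using cH by (simp add: S_def)
    show "linear (H x)" if "x \<in> closure \<Omega> - {0}" for x by (rule linH)
    show "H x v \<bullet> w = v \<bullet> H x w" if "x \<in> closure \<Omega> - {0}" for x v w
      using symH that by (simp add: S_def)
    show "(\<Sum>i\<in>Basis. H x i \<bullet> i) = - f (ub x)" if x: "x \<in> \<Omega> - {0}" for x
      using laplacian_eq_trace[OF o x du dg[OF x]] equation x by (force simp: ub_def)
    show "\<exists>L\<ge>0. \<forall>s\<in>{0..B}. \<forall>t\<in>{0..B}. \<bar>f s - f t\<bar> \<le> L * \<bar>s - t\<bar>" for B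
      by (rule locally_lipschitz_imp_lipschitz[OF f_lip])
    show "0 < - \<alpha>" using alpha by simp
    show "g x = - (- \<alpha>) *\<^sub>R \<nu> x" if "x \<in> frontier \<Omega>" for x by (rule gfr[OF that])
    show "\<exists>M>0. \<exists>r>0. \<forall>z. dist x z < r \<longrightarrow>
          ((z - x) \<bullet> \<nu> x < - M * (norm (z - x))\<^sup>2 \<longrightarrow> z \<in> \<Omega>) \<and>
          (M * (norm (z - x))\<^sup>2 < (z - x) \<bullet> \<nu> x \<longrightarrow> z \<notin> \<Omega>)" if "x \<in> frontier \<Omega>" for x
      by (rule para[OF that])
    fix r U G assume r: "0 < r" and U: "\<And>x. x \<in> ball 0 r \<Longrightarrow> GDERIV U x :> G x" "continuous_on (ball 0 r) G"
      and eq: "\<And>x. x \<in> ball 0 r - {0} \<Longrightarrow> ub x = U x"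
    \<comment> \<open>The ball is shrunk into \<open>\<Omega>\<close>, where the cut-off function
      and \<open>u\<close> coincide.\<close>
    obtain s where s: "0 < s" "ball 0 s \<subseteq> \<Omega>" using domain(1,5) open_contains_ball_eq by blast
    have "removable_singularity \<Omega> u"
    proof (rule C1_extension_imp_removable[OF domain(1,3,5) _ du, of "min r s" U G])
      show "continuous_on (closure \<Omega> - {0}) u" "continuous_on (closure \<Omega> - {0}) g"
        using cu cg by (auto simp: S_def)
      show "0 < min r s" using r s by simp
      show "GDERIV U x :> G x" if "x \<in> ball 0 (min r s)" for x using that U by simp
      show "continuous_on (ball 0 (min r s)) G" by (rule continuous_on_subset[OF U(2)]) auto
      show "u x = U x" if "x \<in> ball 0 (min r s) - {0}" for x
      proof -
        have "x \<in> \<Omega>" using that s by auto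
        then show ?thesis using eq[of x] that by (simp add: ub_def)
      qed
    qed
    then show False using singular by blast
  qed
  obtain R h where R: "0 < R" "\<Omega> = ball 0 R" "\<forall>x\<in>closure \<Omega> - {0}. ub x = h (norm x)" "strict_antimono_on {0<..R} h"
    using radial_in_ball by blast
  have "\<forall>x\<in>closure \<Omega> - {0}. u x = h (norm x)" using R(3) ubS by (simp add: S_def)
  then show ?thesis using R by blast
qed

end
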